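(* Let $k\ge1$ be an integer, $\mathbf{k}:=4k-1$, and let $\delta$ be a fixed constant with $0<\delta<1/4$. For real $r$ with $\mathbf{k}^{1/2-\delta}<r\le\mathbf{k}$ we have $$\hat g_{2k}(0,0;ir)\ll\frac{1}{\mathbf{k}^{5/6}}\min\left(1,\frac{\mathbf{k}^{1/12}}{|\mathbf{k}-4r|^{1/4}}\right)+\frac{k^{-1/4-3\delta}+k^{-1/2}}{r}.$$
   Context: For an integer $m\ge1$, $0\le\Re u$, $x>0$ and $1-2m<\Delta<1/2-\Re u$, let $$I_m(u;x)=\frac{1}{2\pi i}\int_{(\Delta)}\frac{\Gamma(m-1/2+w/2)}{\Gamma(m+1/2-w/2)}\Gamma\left(\tfrac12-u-w\right)\sin\left(\pi\frac{1/2+u+w}{2}\right)x^w\,dw,$$ where $(\Delta)$ is the line $\Re w=\Delta$ (for $\Re u=0$ the integral is conditionally convergent for $x\neq 2$). For $0<x<\infty$ let $$g_{2k}(u,v;x)=\frac{x^{1/2+v}}{(1+x)^{1/2+v}}I_{2k}\left(u;\frac{2}{(1+x)^{1/2}}\right),$$ and let $\hat g_{2k}(u,v;s)=\int_0^\infty g_{2k}(u,v;x)x^{s-1}\,dx$ be its Mellin transform in $x$. The minimum is understood to be $1$ when $\mathbf{k}=4r$. The implied constant depends only on $\delta$. *)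

theory Defs
  imports "HOL-Analysis.Analysis"
begin

text \<open>
  The integral over the line \<open>Re w = c\<close>, oriented upwards, of \<open>f w dw\<close>. The Henstock--Kurzweil
  integral over the whole real line agrees with the (two-sided) improper integral, so conditionally
  convergent line integrals are covered.
\<close>
definition vertical_line_integral :: "real \<Rightarrow> (complex \<Rightarrow> complex) \<Rightarrow> complex" where
  "vertical_line_integral c f = \<i> * integral UNIV (\<lambda>t::real. f (Complex c t))"

definition mellin :: "(real \<Rightarrow> complex) \<Rightarrow> complex \<Rightarrow> complex" where
  "mellin f s = integral {0<..} (\<lambda>x::real. f x * of_real x powr (s - 1))"

text \<open>
  \<open>I_fun \<Delta> m u x\<close> is \<open>I\<^sub>m(u;x)\<close> computed on the line \<open>Re w = \<Delta>\<close>; it is meant for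
  \<open>m \<ge> 1\<close>, \<open>0 \<le> Re u\<close>, \<open>x > 0\<close> and \<open>1 - 2m < \<Delta> < 1/2 - Re u\<close>.
\<close>
definition I_fun :: "real \<Rightarrow> nat \<Rightarrow> complex \<Rightarrow> real \<Rightarrow> complex" where
  "I_fun \<Delta> m u x =
     1 / (2 * of_real pi * \<i>) *
       vertical_line_integral \<Delta> (\<lambda>w.
         Gamma (of_nat m - 1/2 + w/2) / Gamma (of_nat m + 1/2 - w/2) *
         Gamma (1/2 - u - w) * sin (of_real pi * ((1/2 + u + w) / 2)) *
         of_real x powr w)"

text \<open>\<open>g_fun \<Delta> n u v x\<close> is \<open>g\<^sub>n(u,v;x)\<close>, where \<open>n = 2k\<close>.\<close>
definition g_fun :: "real \<Rightarrow> nat \<Rightarrow> complex \<Rightarrow> complex \<Rightarrow> real \<Rightarrow> complex" where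
  "g_fun \<Delta> n u v x =
     of_real x powr (1/2 + v) / of_real (1 + x) powr (1/2 + v) *
       I_fun \<Delta> n u (2 / (1 + x) powr (1/2))"

definition g_hat :: "real \<Rightarrow> nat \<Rightarrow> complex \<Rightarrow> complex \<Rightarrow> complex \<Rightarrow> complex" where
  "g_hat \<Delta> n u v s = mellin (g_fun \<Delta> n u v) s"

definition bold :: "nat \<Rightarrow> real" where
  "bold k = 4 * real k - 1"

text \<open>The case distinction is needed because division by zero yields \<open>0\<close> in HOL.\<close>
definition min_factor :: "nat \<Rightarrow> real \<Rightarrow> real" where
  "min_factor k r =
     (if bold k = 4 * r then 1
      else min 1 (bold k powr (1/12) / \<bar>bold k - 4 * r\<bar> powr (1/4)))"

end

(*
  Closing the contour to the right turns I_m(0; 2 xi) into a multiple, of size m^(-1/2), of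
  xi^(1/2) f(xi), where f is the even solution with f(0) = 1 of Legendre's equation of degree
  2m - 3/2. With m = 2k, K = 4k - 1 and xi = sin phi, the function U = (cos phi)^(1/2) f(sin phi)
  satisfies U'' + (K^2 + 1 / (4 cos^2 phi)) U = 0, and x = cot^2 phi turns the Mellin transform into
  a multiple of the integral of U(phi) (sin phi cos phi)^(-1/2) (cot phi)^(2 i r) over (0, pi/2).
  For tan phi <= K the function U is a combination of exp(i K phi) and exp(-i K phi) with
  coefficients of bounded variation; beyond that point U is bounded and the integral of the
  amplitude is O(K^(-1/2)). It remains to bound the integrals of q exp(i h) with
  q = (sin phi cos phi)^(-1/2) and h = +-K phi + 2 r log cot phi. Here h' = +-K - 2 r q^2, so that
  q / h' is a monotone function of q, and the first derivative test away from the stationary point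
  q^2 = K / (2r) gives K^(-1/3) min(1, K^(1/12) / |K - 4r|^(1/4)).
*)
theory Submission
  imports Defs "HOL-Complex_Analysis.Complex_Analysis"
begin

text \<open>The initial obstacle is convergence: on every admissible line the kernel is only
  O(1/|w|), so absolute convergence provides neither the existence of the integral nor the contour
  shift. The regularised kernel is bounded, which lets the horizontal sides of rectangles vanish in
  the limit, and the recurrence under w -> w + 2 supplies the missing decay. The shape of the bound
  comes from pi/4. There q has its minimum sqrt 2, and for K = 4r the two stationary points,
  symmetric about pi/4, merge into one at which h'' vanishes too. A cubic phase whose third
  derivative has order K gives the length K^(-1/3); separated points for K > 4r give (K (K -
  4r))^(-1/4). The remaining K^(-1/2) of K^(-5/6) is the Gamma quotient. The cut at tan phi = K is
  where the accumulated perturbation, the integral of 1 / (4 K cos^2), reaches 1/4. What lies beyond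
  is harmless because r \<le> K keeps |K - 4r| of order at most K, so that the claimed bound never
  drops below a multiple of K^(-1/2).\<close>

section \<open>Ratios of Gamma values on vertical lines\<close>

text \<open>The negative \<open>M\<close> of \<open>L\<close> is convex: in its second derivative
  the term 1/t^2 outweighs (y^2 - t^2) / (t^2 + y^2)^2. Concavity is applied between x and x + 1,
  and factor by factor in the product for the Gamma quotient.\<close>

lemma ln_quotient_norm_concave:
  fixes x y a :: real
  assumes "x > 0" "0 \<le> a" "a \<le> 1"
  defines "L \<equiv> \<lambda>t. ln (t / cmod (Complex t y))"
  shows "(1 - a) * L x + a * L (x + 1) \<le> L (x + a)"
proof -
  define M where "M = (\<lambda>t::real. ln (t\<^sup>2 + y\<^sup>2) / 2 - ln t)"
  have LM: "L t = - M t" if "t > 0" for t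
  proof -
    have "t\<^sup>2 + y\<^sup>2 > 0" using that by (simp add: add_pos_nonneg)
    then show ?thesis using that
      by (simp add: L_def M_def ln_div ln_sqrt complex_norm)
  qed
  have "convex_on {0<..} M"
  proof (rule f''_ge0_imp_convex)
    fix t :: real assume "t \<in> {0<..}"
    then have t: "t > 0" and p: "t\<^sup>2 + y\<^sup>2 > 0" by (auto simp: add_pos_nonneg)
    show "(M has_real_derivative (t / (t\<^sup>2 + y\<^sup>2) - 1 / t)) (at t)"
      unfolding M_def using t p by (auto intro!: derivative_eq_intros simp: divide_simps)
    show "((\<lambda>t. t / (t\<^sup>2 + y\<^sup>2) - 1 / t) has_real_derivative
             ((y\<^sup>2 - t\<^sup>2) / (t\<^sup>2 + y\<^sup>2)\<^sup>2 + 1 / t\<^sup>2)) (at t)"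
      using t p by (auto intro!: derivative_eq_intros simp: power2_eq_square)
    have "(t\<^sup>2 - y\<^sup>2) * t\<^sup>2 \<le> (t\<^sup>2 + y\<^sup>2)\<^sup>2"
    proof -
      have "(t\<^sup>2 + y\<^sup>2)\<^sup>2 - (t\<^sup>2 - y\<^sup>2) * t\<^sup>2 = 3 * t\<^sup>2 * y\<^sup>2 + (y\<^sup>2)\<^sup>2"
        by (simp add: power2_eq_square algebra_simps)
      also have "\<dots> \<ge> 0" by simp
      finally show ?thesis by simp
    qed
    then show "0 \<le> (y\<^sup>2 - t\<^sup>2) / (t\<^sup>2 + y\<^sup>2)\<^sup>2 + 1 / t\<^sup>2"
      using t p by (simp add: divide_simps) (simp add: algebra_simps)
  qed auto
  then have "M ((1 - a) *\<^sub>R x + a *\<^sub>R (x + 1)) \<le> (1 - a) * M x + a * M (x + 1)"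
    using assms by (intro convex_onD) auto
  moreover have "(1 - a) *\<^sub>R x + a *\<^sub>R (x + 1) = x + a" by (simp add: algebra_simps)
  ultimately show ?thesis using LM assms by simp
qed

text \<open>In the quotient of the two Gauss products the factors n! and |n^z| = n^x cancel; only
  quotients t / |t + i y| with t = x + j remain.\<close>

lemma Gamma_ratio_LIMSEQ:
  fixes x y :: real
  assumes "x > 0"
  shows "(\<lambda>n. \<Prod>j\<le>n. (x + real j) / cmod (Complex (x + real j) y))
           \<longlonglongrightarrow> cmod (Gamma (Complex x y)) / Gamma x"
proof -
  have "Gamma x \<noteq> 0" using Gamma_real_pos[OF assms] by simp
  then have "(\<lambda>n. cmod (Gamma_series (Complex x y) n) / Gamma_series x n)
          \<longlonglongrightarrow> cmod (Gamma (Complex x y)) / Gamma x"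
    using assms Gamma_real_pos[of x]
    by (intro tendsto_intros Gamma_series_LIMSEQ) auto
  moreover have "cmod (Gamma_series (Complex x y) n) / Gamma_series x n =
      (\<Prod>j\<le>n. (x + real j) / cmod (Complex (x + real j) y))" for n
  proof -
    have e: "cmod (exp (Complex x y * of_real (ln (real n)))) = exp (x * ln (real n))"
      by simp
    have p: "pochhammer x (Suc n) = (\<Prod>j\<le>n. x + real j)"
      by (simp add: pochhammer_Suc_prod lessThan_Suc_atMost atLeast0AtMost)
    have q: "cmod (pochhammer (Complex x y) (Suc n)) = (\<Prod>j\<le>n. cmod (Complex (x + real j) y))"
      by (simp add: pochhammer_Suc_prod atLeast0AtMost prod_norm [symmetric] complex_eq_iff
            cong: prod.cong) (intro prod.cong refl arg_cong[of _ _ cmod], simp add: complex_eq_iff)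
    have "pochhammer x (Suc n) > 0" using assms by (intro pochhammer_pos) auto
    then show ?thesis
      unfolding Gamma_series_def Suc_eq_plus1[symmetric] norm_divide norm_mult e q p prod_dividef
      by (simp add: norm_fact field_simps)
  qed
  ultimately show ?thesis by simp
qed

text \<open>\<open>|\<Gamma>(x + iy)| / \<Gamma>(x)\<close> is log-concave in \<open>x\<close>, because each factor of its product is.\<close>
lemma norm_Gamma_ratio_le:
  fixes x y a :: real
  assumes x: "x > 0" and a: "0 \<le> a" "a \<le> 1"
  shows "cmod (Gamma (Complex x y)) * cmod (Complex x y) powr a * Gamma (x + a)
           \<le> cmod (Gamma (Complex (x + a) y)) * x powr a * Gamma x"
proof -
  define h where "h = (\<lambda>n x. \<Prod>j\<le>n. (x + real j) / cmod (Complex (x + real j) y))"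
  define H where "H = (\<lambda>x. cmod (Gamma (Complex x y)) / Gamma x)"
  have nz: "cmod (Complex t y) > 0" if "t > 0" for t using that by (simp add: complex_eq_iff)
  have G0: "Complex t y \<notin> \<int>\<^sub>\<le>\<^sub>0" if "t > 0" for t
    using that by (auto elim!: nonpos_Ints_cases simp: complex_eq_iff)
  have Hpos: "H t > 0" if "t > 0" for t
    using that G0[OF that] Gamma_real_pos[OF that] by (simp add: H_def Gamma_eq_zero_iff)
  have lim: "(\<lambda>n. h n t) \<longlonglongrightarrow> H t" if "t > 0" for t
    unfolding h_def H_def by (rule Gamma_ratio_LIMSEQ[OF that])
  have hpos: "h n t > 0" if "t > 0" for n t
    unfolding h_def using that by (intro prod_pos ballI divide_pos_pos nz add_pos_nonneg) auto
  have ineq: "h n x powr (1 - a) * h n (x + 1) powr a \<le> h n (x + a)" for n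
  proof -
    have ln_h: "ln (h n t) = (\<Sum>j\<le>n. ln ((t + real j) / cmod (Complex (t + real j) y)))" if "t > 0" for t
      unfolding h_def using that
      by (subst ln_prod) (auto simp: complex_eq_iff add_pos_nonneg)
    have "(1 - a) * ln (h n x) + a * ln (h n (x + 1)) \<le> ln (h n (x + a))"
      using x a ln_quotient_norm_concave[of "x + real j" a y for j]
      by (simp add: ln_h sum_distrib_left sum.distrib [symmetric] add_ac add_pos_nonneg sum_mono)
    then have "exp ((1 - a) * ln (h n x) + a * ln (h n (x + 1))) \<le> exp (ln (h n (x + a)))" by simp
    then show ?thesis
      using hpos[of x n] hpos[of "x+1" n] hpos[of "x+a" n] x a by (simp add: powr_def exp_add)
  qed
  have "H x powr (1 - a) * H (x + 1) powr a \<le> H (x + a)"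
  proof (rule LIMSEQ_le)
    show "(\<lambda>n. h n x powr (1 - a) * h n (x + 1) powr a) \<longlonglongrightarrow> H x powr (1 - a) * H (x + 1) powr a"
      using x a Hpos[of x] Hpos[of "x+1"] by (intro tendsto_intros lim) auto
    show "(\<lambda>n. h n (x + a)) \<longlonglongrightarrow> H (x + a)" using x a by (intro lim) auto
  qed (use ineq in auto)
  \<comment> \<open>The functional equation turns the value at x + 1 back into one at x, so that the
    final inequality compares only x and x + a.\<close>
  moreover have "H (x + 1) = H x * (cmod (Complex x y) / x)"
  proof -
    have "Complex (x + 1) y = Complex x y + 1" by (simp add: complex_eq_iff)
    then have "Gamma (Complex (x + 1) y) = Complex x y * Gamma (Complex x y)"
      using Gamma_plus1[OF G0[OF x]] by simp
    moreover have "Gamma (x + 1) = x * Gamma x" using x by (intro Gamma_plus1) auto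
    ultimately show ?thesis using x by (simp add: H_def norm_mult mult.commute)
  qed
  ultimately have "H x powr (1 - a) * (H x powr a * (cmod (Complex x y) powr a / x powr a)) \<le> H (x + a)"
    using Hpos[OF x] x by (simp add: powr_mult powr_divide)
  moreover have "H x powr (1 - a) * H x powr a = H x"
    using Hpos[OF x] by (simp add: powr_add [symmetric])
  ultimately have "H x * (cmod (Complex x y) powr a / x powr a) \<le> H (x + a)"
    by (simp add: mult.assoc [symmetric])
  then show ?thesis
    using x a Gamma_real_pos[of x] Gamma_real_pos[of "x + a"]
    by (simp add: H_def field_simps)
qed

text \<open>A uniform form of the Stirling decay |z|^(-a) in a strip. The preceding inequality
  dominates the quotient on a vertical line by its value on the real axis, where it is continuous on
  a compact interval.\<close>

lemma Gamma_rGamma_bound: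
  fixes x0 x1 a :: real
  assumes "0 < x0" "0 \<le> a" "a \<le> 1"
  obtains C where "C \<ge> 0"
    "\<And>z. x0 \<le> Re z \<Longrightarrow> Re z \<le> x1 \<Longrightarrow> cmod (Gamma z * rGamma (z + of_real a)) \<le> C * cmod z powr - a"
proof -
  define f where "f = (\<lambda>x. x powr a * Gamma x / Gamma (x + a))"
  have np: "x \<notin> \<int>\<^sub>\<le>\<^sub>0" if "x > 0" for x :: real using that by (auto elim!: nonpos_Ints_cases)
  have nz: "Gamma x \<noteq> 0" if "x > 0" for x :: real using Gamma_real_pos[OF that] by simp
  have "continuous_on {0<..} (Gamma :: real \<Rightarrow> real)"
    by (intro continuous_on_Gamma) (auto dest: np)
  then have "continuous_on {x0..x1} (Gamma :: real \<Rightarrow> real)" "continuous_on {x0..x1} (\<lambda>x. Gamma (x + a))"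
    using assms
    by (auto elim!: continuous_on_subset intro!: continuous_intros
        intro: continuous_on_compose2[of "{0<..}" "Gamma :: real \<Rightarrow> real"])
  then have "continuous_on {x0..x1} f"
    unfolding f_def using assms nz
    by (auto intro!: continuous_on_divide continuous_on_mult continuous_on_powr continuous_on_const continuous_on_id)
  then have "bounded (f ` {x0..x1})" by (intro compact_imp_bounded compact_continuous_image) auto
  then obtain C where "\<forall>x\<in>{x0..x1}. \<bar>f x\<bar> \<le> C" unfolding bounded_iff by auto
  then have C: "\<And>x. x \<in> {x0..x1} \<Longrightarrow> \<bar>f x\<bar> \<le> C" by blast
  have "cmod (Gamma z * rGamma (z + of_real a)) \<le> max C 0 * cmod z powr - a"
    if z: "x0 \<le> Re z" "Re z \<le> x1" for z
  proof -
    obtain x y where xy: "z = Complex x y" by (cases z)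
    have x: "x > 0" "x \<in> {x0..x1}" using z xy assms by auto
    have "z \<noteq> 0" using x xy by (auto simp: complex_eq_iff)
    have za: "z + of_real a = Complex (x + a) y" by (simp add: xy complex_eq_iff)
    have "Complex (x + a) y \<notin> \<int>\<^sub>\<le>\<^sub>0"
      using x assms by (auto elim!: nonpos_Ints_cases simp: complex_eq_iff)
    then have g: "cmod (Gamma (Complex (x + a) y)) > 0" by (simp add: Gamma_eq_zero_iff)
    have "cmod (Gamma z) * cmod z powr a * Gamma (x + a)
           \<le> cmod (Gamma (z + of_real a)) * x powr a * Gamma x"
      using norm_Gamma_ratio_le[OF x(1) assms(2,3), of y] unfolding za[symmetric] xy[symmetric] .
    then have "cmod (Gamma z) * cmod (rGamma (z + of_real a)) * cmod z powr a \<le> f x"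
      using g Gamma_real_pos[of "x + a"] x assms
      by (simp add: f_def rGamma_inverse_Gamma norm_inverse norm_divide za field_simps)
    also have "\<dots> \<le> max C 0" using C[OF x(2)] by linarith
    finally show ?thesis using \<open>z \<noteq> 0\<close> by (simp add: norm_mult powr_minus field_simps)
  qed
  then show thesis using that[of "max C 0"] by auto
qed

section \<open>The Mellin kernel: regularisation, recurrence, boundedness\<close>

definition mellin_kernel :: "nat \<Rightarrow> complex \<Rightarrow> complex" where
  "mellin_kernel m w = Gamma (of_nat m - 1/2 + w/2) / Gamma (of_nat m + 1/2 - w/2) *
     Gamma (1/2 - w) * sin (of_real pi * ((1/2 + w) / 2))"

text \<open>
  By the duplication and reflection formulas this is \<open>(w - 1/2) * mellin_kernel m w\<close>, in a form that
  shows that the only pole of the kernel with \<open>1 - 2 m < Re w < 5/2\<close> is \<open>w = 1/2\<close>.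
\<close>
definition reg_kernel :: "nat \<Rightarrow> complex \<Rightarrow> complex" where
  "reg_kernel m w = - 2 * of_real (sqrt pi) * exp (- (1/2 + w) * of_real (ln 2)) *
     (Gamma (of_nat m - 1/2 + w/2) * rGamma (of_nat m + 1/2 - w/2)) *
     (Gamma (5/4 - w/2) * rGamma (1/4 + w/2))"

lemma notin_nonpos_Ints: "Re z > 0 \<Longrightarrow> z \<notin> \<int>\<^sub>\<le>\<^sub>0"
  by (auto elim!: nonpos_Ints_cases)

text \<open>With z = 1/4 - w/2, duplication splits Gamma(1/2 - w) = Gamma(2z) into Gamma z and
  Gamma(z + 1/2). The latter cancels against a reciprocal Gamma value that reflection extracts from
  the sine, and Gamma z = Gamma(z + 1) / z isolates the pole at w = 1/2.\<close>

lemma mellin_kernel_eq: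
  assumes "Re w < 1/2"
  shows "mellin_kernel m w = reg_kernel m w / (w - 1/2)"
proof -
  define z where "z = 1/4 - w/2"
  have rz: "Re z > 0" using assms by (simp add: z_def)
  then have z: "z \<notin> \<int>\<^sub>\<le>\<^sub>0" "z + 1/2 \<notin> \<int>\<^sub>\<le>\<^sub>0" "z \<noteq> 0"
    by (auto intro!: notin_nonpos_Ints)
  have dup: "Gamma z * Gamma (z + 1/2) =
      exp ((1 - 2 * z) * of_real (ln 2)) * of_real (sqrt pi) * Gamma (2 * z)"
    by (rule Gamma_legendre_duplication[OF z(1,2)])
  have G1: "Gamma (1/2 - w) = exp (- (1/2 + w) * of_real (ln 2)) * Gamma z * Gamma (z + 1/2) / of_real (sqrt pi)"
  proof -
    have e: "1/2 - w = 2 * z" "- (1/2 + w) = - (1 - 2 * z)" by (simp_all add: z_def)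
    have "exp (- (1 - 2 * z) * of_real (ln 2)) * exp ((1 - 2 * z) * of_real (ln 2)) = 1"
      by (simp add: algebra_simps flip: exp_add)
    then show ?thesis unfolding e mult.assoc dup by (simp add: mult.assoc [symmetric])
  qed
  have "rGamma (1/4 + w/2) * rGamma (1 - (1/4 + w/2)) = sin (of_real pi * (1/4 + w/2)) / of_real pi"
    by (rule rGamma_reflection_complex)
  moreover have "1 - (1/4 + w/2) = z + 1/2" "of_real pi * (1/4 + w/2) = of_real pi * ((1/2 + w) / 2)"
    by (simp_all add: z_def field_simps)
  ultimately have sn: "sin (of_real pi * ((1/2 + w) / 2)) = of_real pi * rGamma (1/4 + w/2) * rGamma (z + 1/2)"
    by (simp add: mult.assoc)
  have g: "Gamma (z + 1/2) * rGamma (z + 1/2) = 1"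
    using z by (simp add: rGamma_inverse_Gamma Gamma_eq_zero_iff)
  have G5: "Gamma (5/4 - w/2) = z * Gamma z" using Gamma_plus1[OF z(1)] by (simp add: z_def)
  have "w - 1/2 = - 2 * z" by (simp add: z_def)
  have "mellin_kernel m w = exp (- (1/2 + w) * of_real (ln 2)) * (of_real pi / of_real (sqrt pi)) *
     (Gamma (of_nat m - 1/2 + w/2) * rGamma (of_nat m + 1/2 - w/2)) * (Gamma z * rGamma (1/4 + w/2))
     * (Gamma (z + 1/2) * rGamma (z + 1/2))"
  proof -
    have "A / B * (E * g1 * g2 / s) * (p * r1 * r2) = E * (p / s) * (A * inverse B) * (g1 * r1) * (g2 * r2)"
      for A B E g1 g2 s p r1 r2 :: complex by (simp add: divide_inverse mult_ac)
    then show ?thesis unfolding mellin_kernel_def G1 sn rGamma_inverse_Gamma[of "of_nat m + 1/2 - w/2"] .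
  qed
  also have "of_real pi / of_real (sqrt pi) = (of_real (sqrt pi) :: complex)"
    by (simp add: real_div_sqrt flip: of_real_divide)
  finally show ?thesis
    unfolding g reg_kernel_def G5 \<open>w - 1/2 = - 2 * z\<close> using z(3) by (simp add: mult_ac)
qed

lemma reg_kernel_holomorphic: "reg_kernel m holomorphic_on {w. 1 - 2 * real m < Re w \<and> Re w < 5/2}"
  unfolding reg_kernel_def
  by (intro holomorphic_intros) (auto intro!: notin_nonpos_Ints)

text \<open>The step w -> w + 2 moves every Gamma argument by one, so the functional equation
  produces a rational factor, and the exponential contributes 1/4. This is the origin of the
  recurrence of the series coefficients.\<close>

lemma reg_kernel_shift:
  assumes "Re w \<ge> 0" "m \<ge> 1" "Re w < 1/2"
  shows "4 * (w + 1/2) * (w - 1/2) * reg_kernel m (w + 2) =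
    (w\<^sup>2 - (2 * of_nat m - 1)\<^sup>2) * reg_kernel m w"
proof -
  define s where "s = w / 2"
  define n where "n = (of_nat m :: complex)"
  have w: "w = 2 * s" "w / 2 = s" "(w + 2) / 2 = s + 1" by (simp_all add: s_def field_simps)
  have ns: "n - 1/2 + s \<notin> \<int>\<^sub>\<le>\<^sub>0" "1/4 - s \<notin> \<int>\<^sub>\<le>\<^sub>0"
    using assms by (auto simp: s_def n_def intro!: notin_nonpos_Ints)
  define E where "E = exp (- (1/2 + w) * of_real (ln 2))"
  have e: "exp (- (1/2 + (w + 2)) * of_real (ln 2)) = E / (4::complex)"
  proof -
    have "- (1/2 + (w + 2)) * of_real (ln 2) = - (1/2 + w) * of_real (ln 2) - of_real (2 * ln 2)"
      by (simp add: algebra_simps)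
    moreover have "exp (complex_of_real (2 * ln 2)) = 4"
    proof -
      have "exp (2 * ln 2) = (4::real)" by (simp add: exp_double)
      then show ?thesis by (metis exp_of_real of_real_numeral)
    qed
    ultimately show ?thesis by (simp add: exp_diff E_def)
  qed
  have 1: "Gamma (n - 1/2 + (s + 1)) = (n - 1/2 + s) * Gamma (n - 1/2 + s)"
    using Gamma_plus1[OF ns(1)] by (simp add: add_ac)
  have 2: "rGamma (n + 1/2 - (s + 1)) = (n - 1/2 - s) * rGamma (n + 1/2 - s)"
  proof -
    have "n + 1/2 - (s + 1) = n - 1/2 - s" "n - 1/2 - s + 1 = n + 1/2 - s" by simp_all
    then show ?thesis using rGamma_plus1[of "n - 1/2 - s"] by (simp only:)
  qed
  have 3: "rGamma (1/4 + s) = (1/4 + s) * rGamma (1/4 + (s + 1))"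
    using rGamma_plus1[of "1/4 + s"] by (simp add: add_ac)
  have 4: "Gamma (5/4 - s) = (1/4 - s) * Gamma (5/4 - (s + 1))"
  proof -
    have "5/4 - (s + 1) = 1/4 - s" "1/4 - s + 1 = 5/4 - s" by simp_all
    then show ?thesis using Gamma_plus1[OF ns(2)] by (simp only:)
  qed
  define g1 g2 g3 g4 where "g1 = Gamma (n - 1/2 + s)" "g2 = rGamma (n + 1/2 - s)"
    "g3 = rGamma (1/4 + (s + 1))" "g4 = Gamma (5/4 - (s + 1))"
  have poly: "4 * (2 * s + 1/2) * (2 * s - 1/2) * (E / 4) * ((n - 1/2 + s) * (n - 1/2 - s))
      = ((2 * s)\<^sup>2 - (2 * n - 1)\<^sup>2) * E * ((1/4 + s) * (1/4 - s))"
    by (simp add: field_simps power2_eq_square)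
  define c where "c = - 2 * complex_of_real (sqrt pi)"
  have "4 * (w + 1/2) * (w - 1/2) * reg_kernel m (w + 2) =
     c * (g1 * g2 * g3 * g4) *
      (4 * (2 * s + 1/2) * (2 * s - 1/2) * (E / 4) * ((n - 1/2 + s) * (n - 1/2 - s)))"
    unfolding reg_kernel_def e w(2,3) n_def[symmetric] 1 2 g1_g2_g3_g4_def[symmetric] c_def[symmetric]
    by (simp add: w(1) mult_ac)
  also have "\<dots> = (w\<^sup>2 - (2 * of_nat m - 1)\<^sup>2) * reg_kernel m w"
    unfolding poly
    unfolding reg_kernel_def E_def[symmetric] w(2,3) n_def[symmetric] 3 4 g1_g2_g3_g4_def[symmetric] c_def[symmetric]
    by (simp add: w(1) mult_ac)
  finally show ?thesis .
qed

text \<open>The reciprocal Gamma factors are exchanged: Gamma(m - 1/2 + s) is paired with 1/Gamma(m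
  + 1/4 + s) and Gamma(5/4 - s) with 1/Gamma(3/2 - s), so that both shifts lie in [0, 1]. This gives
  decay of orders 3/4 and 1/4. The price is a quotient of Pochhammer products of degrees m and m -
  1, which grows linearly and is exactly compensated.\<close>

lemma reg_kernel_bounded:
  fixes m :: nat
  assumes m: "m \<ge> 1" and s: "1 - 2 * real m < s0" "s1 < 5/2"
  obtains C where "C > 0" "\<And>w. s0 \<le> Re w \<Longrightarrow> Re w \<le> s1 \<Longrightarrow> cmod (reg_kernel m w) \<le> C"
proof -
  define n where "n = (of_nat m :: complex)"
  \<comment> \<open>A common lower bound for the real parts of the Gamma arguments. The cap 1/2 is
    there for \<open>low\<close>, where (d/2) * t must not exceed t/4.\<close>
  define d where "d = min (1/2) (min (real m - 1/2 + s0/2) (5/4 - s1/2))"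
  have d: "d > 0" "d \<le> 1/2" "d \<le> real m - 1/2 + s0/2" "d \<le> 5/4 - s1/2"
    using m s unfolding d_def by linarith+
  have low: "d / 2 * (1 + t) \<le> cmod z" if "d \<le> Re z" "\<bar>Im z\<bar> = t / 2" for z t
  proof -
    have "d / 2 + t / 4 \<le> cmod z"
      using abs_Re_le_cmod[of z] abs_Im_le_cmod[of z] that d by linarith
    moreover have "d / 2 * t \<le> t / 4" using d that(2) mult_right_mono[of d "1/2" t]  abs_ge_zero[of "Im z"] by simp
    ultimately show ?thesis by (simp add: algebra_simps)
  qed
  obtain C1 where C1: "C1 \<ge> 0" "\<And>z. d \<le> Re z \<Longrightarrow> Re z \<le> real m - 1/2 + s1/2 \<Longrightarrow>
      cmod (Gamma z * rGamma (z + of_real (3/4))) \<le> C1 * cmod z powr - (3/4)"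
    using Gamma_rGamma_bound[of d "3/4" "real m - 1/2 + s1/2"] d by auto
  obtain C2 where C2: "C2 \<ge> 0" "\<And>z. d \<le> Re z \<Longrightarrow> Re z \<le> 5/4 - s0/2 \<Longrightarrow>
      cmod (Gamma z * rGamma (z + of_real (1/4))) \<le> C2 * cmod z powr - (1/4)"
    using Gamma_rGamma_bound[of d "1/4" "5/4 - s0/2"] d by auto
  define e where "e = real m + 1 + \<bar>s0\<bar> + \<bar>s1\<bar>"
  define k where "k = m - 1"
  have mk: "m = Suc k" using m by (simp add: k_def)
  define C where "C = 2 * sqrt pi * exp ((\<bar>s0\<bar> + 1/2) * ln 2) *
    (C1 * (d/2) powr - (3/4)) * (C2 * (d/2) powr - (1/4)) * (e ^ m / (d / 2) ^ k)"
  have "cmod (reg_kernel m w) \<le> C" if w: "s0 \<le> Re w" "Re w \<le> s1" for w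
  proof -
    define s where "s = w / 2"
    define b where "b = 1 + \<bar>Im w\<bar>"
    have b: "b \<ge> 1" by (simp add: b_def)
    have res: "Re s = Re w / 2" "Im s = Im w / 2" by (simp_all add: s_def)
    define A1 where "A1 = Gamma (n - 1/2 + s) * rGamma (n + 1/4 + s)"
    define A2 where "A2 = Gamma (5/4 - s) * rGamma (3/2 - s)"
    have 1: "rGamma (1/4 + s) = pochhammer (1/4 + s) m * rGamma (n + 1/4 + s)"
      using pochhammer_rGamma[of "1/4 + s" m] by (simp add: n_def add_ac)
    have 2: "rGamma (3/2 - s) = pochhammer (3/2 - s) k * rGamma (n + 1/2 - s)"
    proof -
      have "3/2 - s + of_nat k = n + 1/2 - s" by (simp add: n_def mk)
      then show ?thesis using pochhammer_rGamma[of "3/2 - s" k] by (simp only:)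
    qed
    have pnz: "(d / 2 * b) ^ k \<le> cmod (pochhammer (3/2 - s) k)"
    proof -
      have "d / 2 * b \<le> cmod (3/2 - s + of_nat j)" for j
        unfolding b_def by (rule low) (use w d res in auto)
      then have "(\<Prod>j<k. d / 2 * b) \<le> (\<Prod>j<k. cmod (3/2 - s + of_nat j))"
        using d b by (intro prod_mono) auto
      then show ?thesis by (simp add: pochhammer_prod prod_norm atLeast0LessThan)
    qed
    have dbk: "0 < (d / 2 * b) ^ k" using d b by simp
    have up: "cmod (pochhammer (1/4 + s) m) \<le> (e * b) ^ m"
    proof -
      have "cmod (1/4 + s + of_nat j) \<le> e * b" if "j < m" for j
      proof -
        have "cmod (1/4 + s + of_nat j) \<le> \<bar>Re (1/4 + s + of_nat j)\<bar> + \<bar>Im (1/4 + s + of_nat j)\<bar>"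
          by (rule cmod_le)
        also have "\<dots> \<le> e + \<bar>Im w\<bar>" using that w by (auto simp: res e_def abs_if split: if_splits)
        also have "\<dots> \<le> e * b"
          using mult_right_mono[of 1 e "\<bar>Im w\<bar>"] m by (simp add: b_def e_def algebra_simps)
        finally show ?thesis .
      qed
      then have "(\<Prod>j<m. cmod (1/4 + s + of_nat j)) \<le> (\<Prod>j<m. e * b)"
        by (intro prod_mono) auto
      then show ?thesis by (simp add: pochhammer_prod prod_norm atLeast0LessThan)
    qed
    have neg: "cmod z powr - p \<le> (d / 2) powr - p * b powr - p"
      if "d \<le> Re z" "\<bar>Im z\<bar> = \<bar>Im w\<bar> / 2" "p \<ge> 0" for z p
    proof -
      have "cmod z powr - p \<le> (d / 2 * b) powr - p"
        using low[OF that(1,2)] that(3) d b by (intro powr_mono2') (auto simp: b_def)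
      also have "(d / 2 * b) powr - p = (d / 2) powr - p * b powr - p"
        by (rule powr_mult)
      finally show ?thesis .
    qed
    have a1: "cmod A1 \<le> C1 * ((d / 2) powr - (3/4) * b powr - (3/4))"
    proof -
      have e: "n - 1/2 + s + of_real (3/4) = n + 1/4 + s" by simp
      have "cmod A1 \<le> C1 * cmod (n - 1/2 + s) powr - (3/4)"
        unfolding A1_def e[symmetric] using d w by (intro C1(2)) (auto simp: n_def res)
      also have "\<dots> \<le> C1 * ((d / 2) powr - (3/4) * b powr - (3/4))"
        using C1(1) d w by (intro mult_left_mono neg) (auto simp: n_def res)
      finally show ?thesis .
    qed
    have a2: "cmod A2 \<le> C2 * ((d / 2) powr - (1/4) * b powr - (1/4))"
    proof -
      have e: "5/4 - s + of_real (1/4) = 3/2 - s" by simp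
      have "cmod A2 \<le> C2 * cmod (5/4 - s) powr - (1/4)"
        unfolding A2_def e[symmetric] using d w by (intro C2(2)) (auto simp: res)
      also have "\<dots> \<le> C2 * ((d / 2) powr - (1/4) * b powr - (1/4))"
        using C2(1) d w by (intro mult_left_mono neg) (auto simp: res)
      finally show ?thesis .
    qed
    have ex: "cmod (exp (- (1/2 + w) * of_real (ln 2))) \<le> exp ((\<bar>s0\<bar> + 1/2) * ln 2)"
      using w by (auto simp: intro!: mult_right_mono)
    have pk: "pochhammer (3/2 - s) k \<noteq> 0" using pnz dbk by auto
    have "reg_kernel m w = - 2 * of_real (sqrt pi) * exp (- (1/2 + w) * of_real (ln 2)) * A1 * A2 *
       (pochhammer (1/4 + s) m / pochhammer (3/2 - s) k)"
      unfolding reg_kernel_def s_def[symmetric] n_def[symmetric] A1_def A2_def 1 2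
      using pk by (simp add: field_simps)
    then have "cmod (reg_kernel m w) = 2 * sqrt pi * cmod (exp (- (1/2 + w) * of_real (ln 2))) * cmod A1 * cmod A2 *
       (cmod (pochhammer (1/4 + s) m) / cmod (pochhammer (3/2 - s) k))"
      by (simp add: norm_mult norm_divide)
    also have "\<dots> \<le> 2 * sqrt pi * exp ((\<bar>s0\<bar> + 1/2) * ln 2) *
       (C1 * ((d / 2) powr - (3/4) * b powr - (3/4))) * (C2 * ((d / 2) powr - (1/4) * b powr - (1/4)))
       * ((e * b) ^ m / (d / 2 * b) ^ k)"
      using C1(1) C2(1) dbk up pnz m
      by (intro mult_mono a1 a2 ex frac_le order_refl mult_nonneg_nonneg)
         (auto simp: e_def b_def)
    also have "\<dots> = C * (b powr - (3/4) * b powr - (1/4) * b)"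
      using b d by (simp add: C_def mk power_mult_distrib field_simps)
    also have "b powr - (3/4) * b powr - (1/4) * b = 1"
    proof -
      have "b powr - (3/4) * b powr - (1/4) = b powr - 1" by (simp flip: powr_add)
      then show ?thesis using b by (simp add: powr_minus)
    qed
    finally show ?thesis by simp
  qed
  then have "cmod (reg_kernel m w) \<le> max C 1" if "s0 \<le> Re w" "Re w \<le> s1" for w
    using that by (meson max.coboundedI1)
  then show thesis by (intro that[of "max C 1"]) auto
qed

section \<open>Shifting vertical lines of integration\<close>

text \<open>The gauge integral over the line is the limit over independently moving end points.
  Conditionally convergent line integrals thereby become limits that can be added and
  shifted.\<close>

lemma has_integral_UNIV_iff_tendsto:
  fixes f :: "real \<Rightarrow> 'a :: banach"
  assumes "continuous_on UNIV f"
  shows "(f has_integral L) UNIV \<longleftrightarrow>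
    ((\<lambda>(a, b). integral {a..b} f) \<longlongrightarrow> L) (at_bot \<times>\<^sub>F at_top)"
proof -
  have int: "f integrable_on {a..b}" for a b
    by (intro integrable_continuous_real continuous_on_subset[OF assms]) auto
  show ?thesis
  proof
    assume "(f has_integral L) UNIV"
    then have H: "\<exists>B>0. \<forall>a b. ball 0 B \<subseteq> cbox a b \<longrightarrow> norm (integral (cbox a b) f - L) < e" if "e > 0" for e
      using that unfolding has_integral_alt' by simp
    show "((\<lambda>(a, b). integral {a..b} f) \<longlongrightarrow> L) (at_bot \<times>\<^sub>F at_top)"
      unfolding tendsto_iff
    proof (intro allI impI)
      fix e :: real assume "e > 0"
      then obtain B where B: "B > 0" "\<And>a b. ball 0 B \<subseteq> {a..b} \<Longrightarrow> norm (integral {a..b} f - L) < e"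
        using H by (metis cbox_interval)
      have "eventually (\<lambda>a. a \<le> - B) at_bot" "eventually (\<lambda>b. b \<ge> B) at_top"
        by (rule eventually_le_at_bot eventually_ge_at_top)+
      then have "eventually (\<lambda>x. fst x \<le> - B \<and> snd x \<ge> B) (at_bot \<times>\<^sub>F at_top)"
        using eventually_prodI[of "\<lambda>a. a \<le> - B" at_bot "\<lambda>b. b \<ge> B" at_top] by simp
      then show "eventually (\<lambda>x. dist (case x of (a, b) \<Rightarrow> integral {a..b} f) L < e) (at_bot \<times>\<^sub>F at_top)"
      proof eventually_elim
        case (elim x)
        have "ball 0 B \<subseteq> {fst x..snd x}" using elim by (auto simp: dist_norm)
        then show ?case using B(2) by (simp add: case_prod_unfold dist_norm)
      qed
    qed
  next
    assume lim: "((\<lambda>(a, b). integral {a..b} f) \<longlongrightarrow> L) (at_bot \<times>\<^sub>F at_top)"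
    show "(f has_integral L) UNIV"
      unfolding has_integral_alt'
    proof (intro conjI allI impI)
      fix e :: real assume "e > 0"
      with lim have "eventually (\<lambda>x. dist (case x of (a, b) \<Rightarrow> integral {a..b} f) L < e) (at_bot \<times>\<^sub>F at_top)"
        by (auto simp: tendsto_iff)
      then obtain P Q where "eventually P at_bot" "eventually Q at_top"
        and PQ: "\<And>a b. P a \<Longrightarrow> Q b \<Longrightarrow> dist (integral {a..b} f) L < e"
        by (auto simp: eventually_prod_filter)
      then obtain A B where AB: "\<And>a. a \<le> A \<Longrightarrow> P a" "\<And>b. b \<ge> B \<Longrightarrow> Q b"
        by (auto simp: eventually_at_bot_linorder eventually_at_top_linorder)
      define R where "R = max 1 (max \<bar>A\<bar> \<bar>B\<bar>)"
      have "norm (integral (cbox a b) (\<lambda>x. if x \<in> UNIV then f x else 0) - L) < e"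
        if "ball 0 R \<subseteq> cbox a b" for a b
      proof -
        \<comment> \<open>The ball is open; its closure is needed to place the points R and - R
          themselves inside the interval.\<close>
        have "closure (ball 0 R) \<subseteq> cbox a b" using that by (intro closure_minimal) auto
        then have sub: "cball 0 R \<subseteq> {a..b}" by (simp add: R_def cbox_interval)
        moreover have "R \<in> cball 0 R" "- R \<in> cball 0 R" by (auto simp: R_def)
        ultimately have "a \<le> - R" "R \<le> b" using subsetD[OF sub] by auto
        then have "P a" "Q b" by (auto simp: R_def intro!: AB)
        from PQ[OF this] show ?thesis by (simp add: dist_norm cbox_interval)
      qed
      moreover have "R > 0" by (simp add: R_def)
      ultimately show "\<exists>B>0. \<forall>a b. ball 0 B \<subseteq> cbox a b \<longrightarrow>
          norm (integral (cbox a b) (\<lambda>x. if x \<in> UNIV then f x else 0) - L) < e" by blast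
    qed (use int in \<open>simp add: cbox_interval\<close>)
  qed
qed

lemma rect_integral_bound:
  assumes "continuous_on (closed_segment (Complex c1 t) (Complex c2 t)) h" "c1 < c2"
    and "\<And>x. c1 \<le> x \<Longrightarrow> x \<le> c2 \<Longrightarrow> cmod (h (Complex x t)) \<le> B"
  shows "cmod (contour_integral (linepath (Complex c1 t) (Complex c2 t)) h) \<le> B * (c2 - c1)"
proof -
  have "B \<ge> 0" using assms(3)[of c1] assms(2) norm_ge_zero[of "h (Complex c1 t)"] by linarith
  have "cmod (contour_integral (linepath (Complex c1 t) (Complex c2 t)) h)
       \<le> B * cmod (Complex c2 t - Complex c1 t)"
  proof (rule contour_integral_bound_linepath)
    show "h contour_integrable_on linepath (Complex c1 t) (Complex c2 t)"
      by (intro contour_integrable_continuous_linepath assms)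
    fix x assume "x \<in> closed_segment (Complex c1 t) (Complex c2 t)"
    then show "cmod (h x) \<le> B"
      using assms(2,3) by (cases x) (auto simp: closed_segment_same_Im closed_segment_eq_real_ivl)
  qed fact
  then show ?thesis using assms(2) by (simp add: complex_diff cmod_eq_Re)
qed

text \<open>The horizontal sides of the rectangle \<open>[c1, c2] \<times> [a, b]\<close> contribute \<open>O(1/|a| + 1/|b|)\<close>.\<close>
lemma vertical_shift_tendsto:
  fixes f :: "complex \<Rightarrow> complex"
  assumes holo: "f holomorphic_on {w. x0 < Re w \<and> Re w < x1}"
    and c: "x0 < c1" "c1 < c2" "c2 < x1" and p: "x0 < p" "p < x1" "p \<noteq> c1" "p \<noteq> c2"
    and bd: "\<And>w. c1 \<le> Re w \<Longrightarrow> Re w \<le> c2 \<Longrightarrow> cmod (f w) \<le> C"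
  defines "h \<equiv> \<lambda>w. f w / (w - of_real p)"
  shows "((\<lambda>(a, b). integral {a..b} (\<lambda>t. h (Complex c2 t)) - integral {a..b} (\<lambda>t. h (Complex c1 t)))
    \<longlongrightarrow> (if c1 < p \<and> p < c2 then 2 * of_real pi * f (of_real p) else 0)) (at_bot \<times>\<^sub>F at_top)"
proof -
  define S where "S = {w. x0 < Re w \<and> Re w < x1}"
  have S: "open S" "convex S"
  proof -
    have "S = {w. x0 < Re w} \<inter> {w. Re w < x1}" by (auto simp: S_def)
    then show "open S" "convex S"
      by (auto intro!: open_Int open_halfspace_Re_gt open_halfspace_Re_lt convex_Int
            convex_halfspace_Re_gt convex_halfspace_Re_lt)
  qed
  have "cmod (f (of_real c1)) \<le> C" by (rule bd) (use c in auto)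
  then have C0: "C \<ge> 0" by (rule order_trans[OF norm_ge_zero])
  have hc: "continuous_on {w \<in> S. w \<noteq> of_real p} h"
  proof -
    have "continuous_on {w \<in> S. w \<noteq> of_real p} f"
      by (rule continuous_on_subset[OF holomorphic_on_imp_continuous_on[OF holo]]) (auto simp: S_def)
    then show ?thesis unfolding h_def by (intro continuous_intros) auto
  qed
  define J where "J = (\<lambda>a b. integral {a..b} (\<lambda>t. h (Complex c2 t)) - integral {a..b} (\<lambda>t. h (Complex c1 t)))"
  define res where "res = (if c1 < p \<and> p < c2 then 2 * of_real pi * f (of_real p) else 0)"
  have key: "cmod (J a b - res)
       \<le> C / \<bar>a\<bar> * (c2 - c1) + C / \<bar>b\<bar> * (c2 - c1)" if ab: "a < 0" "0 < b" for a b
  proof -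
    define z1 z2 z3 z4 where z: "z1 = Complex c1 a" "z2 = Complex c2 a" "z3 = Complex c2 b" "z4 = Complex c1 b"
    define I1 I2 I3 I4 where I: "I1 = contour_integral (linepath z1 z2) h" "I2 = contour_integral (linepath z2 z3) h"
      "I3 = contour_integral (linepath z4 z3) h" "I4 = contour_integral (linepath z1 z4) h"
    have rp: "rectpath z1 z3 = linepath z1 z2 +++ linepath z2 z3 +++ linepath z3 z4 +++ linepath z4 z1"
      by (simp add: rectpath_def z Let_def)
    have pim: "path_image (rectpath z1 z3) \<subseteq> S - {of_real p}"
      using c ab p by (subst path_image_rectpath) (auto simp: z S_def)
    have segs: "closed_segment z1 z2 \<subseteq> S - {of_real p}" "closed_segment z2 z3 \<subseteq> S - {of_real p}"
      "closed_segment z3 z4 \<subseteq> S - {of_real p}" "closed_segment z4 z1 \<subseteq> S - {of_real p}"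
      using pim by (simp_all add: rp path_image_join)
    have cont: "continuous_on (closed_segment z1 z2) h" "continuous_on (closed_segment z2 z3) h"
      "continuous_on (closed_segment z3 z4) h" "continuous_on (closed_segment z4 z1) h"
      using segs by (auto intro!: continuous_on_subset[OF hc])
    have wn: "winding_number (rectpath z1 z3) (of_real p) = (if c1 < p \<and> p < c2 then 1 else 0)"
    proof (cases "c1 < p \<and> p < c2")
      case True
      then show ?thesis using ab c
        by (simp add: winding_number_rectpath in_box_complex_iff z)
    next
      case False
      then have "of_real p \<notin> cbox z1 z3" using p by (auto simp: in_cbox_complex_iff z)
      then show ?thesis using False ab c by (auto simp: winding_number_rectpath_outside z)
    qed
    \<comment> \<open>Cauchy's formula in the convex strip covers both cases of the conclusion at
      once: p only has to lie off the rectangle, and the winding number is 1 or 0.\<close>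
    have "(h has_contour_integral (of_real (2 * pi) * \<i> * winding_number (rectpath z1 z3) (of_real p) * f (of_real p)))
        (rectpath z1 z3)"
      unfolding h_def
      by (rule Cauchy_integral_formula_convex_simple[OF S(2)])
         (use holo S p pim in \<open>auto simp: S_def interior_open\<close>)
    moreover have "of_real (2 * pi) * \<i> * winding_number (rectpath z1 z3) (of_real p) * f (of_real p) = \<i> * res"
      by (simp add: wn res_def)
    ultimately have "contour_integral (rectpath z1 z3) h = \<i> * res"
      by (simp add: contour_integral_unique)
    moreover have "contour_integral (rectpath z1 z3) h =
        I1 + (I2 + (contour_integral (linepath z3 z4) h + contour_integral (linepath z4 z1) h))"
      unfolding rp I using cont
      by (simp add: contour_integrable_join contour_integrable_continuous_linepath)
    moreover have "contour_integral (linepath z3 z4) h = - I3" "contour_integral (linepath z4 z1) h = - I4"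
      using cont unfolding I by (simp_all add: contour_integral_reverse_linepath)
    ultimately have "\<i> * res = I1 + I2 - I3 - I4" by (simp add: algebra_simps)
    moreover have "I2 = \<i> * integral {a..b} (\<lambda>t. h (Complex c2 t))" "I4 = \<i> * integral {a..b} (\<lambda>t. h (Complex c1 t))"
      unfolding I using ab by (auto intro!: contour_integral_linepath_same_Re simp: z)
    ultimately have "\<i> * (J a b - res)
        = I3 - I1" by (simp add: J_def algebra_simps)
    then have eq: "cmod (J a b - res) = cmod (I3 - I1)"
      by (metis mult_1 norm_ii norm_mult)
    have hb: "cmod (h (Complex x t)) \<le> C / \<bar>t\<bar>" if "c1 \<le> x" "x \<le> c2" "t \<noteq> 0" for x t
    proof -
      have "\<bar>t\<bar> \<le> cmod (Complex x t - of_real p)" using abs_Im_le_cmod[of "Complex x t - of_real p"] by simp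
      then show ?thesis unfolding h_def norm_divide using that bd[of "Complex x t"] C0
        by (intro frac_le) auto
    qed
    have "cmod I1 \<le> C / \<bar>a\<bar> * (c2 - c1)" unfolding I z
      by (rule rect_integral_bound) (use cont(1) c ab hb[of _ a] in \<open>auto simp: z\<close>)
    moreover have "cmod I3 \<le> C / \<bar>b\<bar> * (c2 - c1)" unfolding I z
      by (rule rect_integral_bound) (use cont(3) c ab hb[of _ b] in \<open>auto simp: z closed_segment_commute\<close>)
    ultimately show ?thesis using eq norm_triangle_ineq4[of I3 I1] by linarith
  qed
  have "((\<lambda>x::real \<times> real. C / \<bar>fst x\<bar> * (c2 - c1) + C / \<bar>snd x\<bar> * (c2 - c1)) \<longlongrightarrow> 0) (at_bot \<times>\<^sub>F at_top)"
  proof -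
    have "((\<lambda>x::real. C / \<bar>x\<bar> * (c2 - c1)) \<longlongrightarrow> 0) at_bot" "((\<lambda>x::real. C / \<bar>x\<bar> * (c2 - c1)) \<longlongrightarrow> 0) at_top"
      by real_asymp+
    then have "((\<lambda>x::real\<times>real. C / \<bar>fst x\<bar> * (c2 - c1)) \<longlongrightarrow> 0) (at_bot \<times>\<^sub>F at_top)"
       "((\<lambda>x::real\<times>real. C / \<bar>snd x\<bar> * (c2 - c1)) \<longlongrightarrow> 0) (at_bot \<times>\<^sub>F at_top)"
      by (auto intro: filterlim_compose filterlim_fst filterlim_snd)
    then show ?thesis using tendsto_add by fastforce
  qed
  moreover have "eventually (\<lambda>x. norm (J (fst x) (snd x) - res)
     \<le> C / \<bar>fst x\<bar> * (c2 - c1) + C / \<bar>snd x\<bar> * (c2 - c1)) (at_bot \<times>\<^sub>F at_top)"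
    using eventually_prodI[OF eventually_gt_at_bot[of 0] eventually_gt_at_top[of 0]]
    by eventually_elim (use key in auto)
  ultimately show ?thesis
    unfolding res_def[symmetric] J_def case_prod_unfold by (rule Lim_null_comparison[THEN LIM_zero_cancel, rotated])
qed

section \<open>The inverse Mellin transform as a hypergeometric series\<close>

lemma has_integral_inverse_1_plus_square: "((\<lambda>t::real. 1 / (1 + t\<^sup>2)) has_integral pi) UNIV"
proof -
  have nz: "1 + t\<^sup>2 \<noteq> 0" for t :: real by (smt (verit) zero_le_power2)
  have "continuous_on UNIV (\<lambda>t::real. 1 / (1 + t\<^sup>2))"
    using nz by (intro continuous_intros) auto
  moreover have "((\<lambda>(a, b). integral {a..b} (\<lambda>t::real. 1 / (1 + t\<^sup>2))) \<longlongrightarrow> pi) (at_bot \<times>\<^sub>F at_top)"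
  proof (rule Lim_transform_eventually)
    have "((\<lambda>x. arctan (snd x) - arctan (fst x)) \<longlongrightarrow> pi/2 - (- (pi/2))) (at_bot \<times>\<^sub>F at_top)"
      by (intro tendsto_intros filterlim_compose[OF tendsto_arctan_at_top] filterlim_compose[OF tendsto_arctan_at_bot]
            filterlim_fst filterlim_snd)
    then show "((\<lambda>x. arctan (snd x) - arctan (fst x)) \<longlongrightarrow> pi) (at_bot \<times>\<^sub>F at_top)" by simp
    show "eventually (\<lambda>x. arctan (snd x) - arctan (fst x) = (case x of (a, b) \<Rightarrow> integral {a..b} (\<lambda>t. 1 / (1 + t\<^sup>2))))
        (at_bot \<times>\<^sub>F at_top)"
      using eventually_prodI[OF eventually_gt_at_bot[of 0] eventually_gt_at_top[of 0]]
    proof eventually_elim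
      case (elim x)
      have "((\<lambda>t. 1 / (1 + t\<^sup>2)) has_integral arctan (snd x) - arctan (fst x)) {fst x..snd x}"
        by (rule fundamental_theorem_of_calculus)
           (use elim in \<open>auto intro!: has_field_derivative_at_within DERIV_arctan[unfolded inverse_eq_divide]
              simp: has_real_derivative_iff_has_vector_derivative[symmetric]\<close>)
      then show ?case by (simp add: case_prod_unfold integral_unique)
    qed
  qed
  ultimately show ?thesis using has_integral_UNIV_iff_tendsto by blast
qed

text \<open>The coefficients of 2F1(1/4 - K/2, 1/4 + K/2; 1/2; x^2), the even solution of Legendre's
  equation of degree K - 1/2.\<close>

definition legendre_coeff :: "real \<Rightarrow> nat \<Rightarrow> real" where
  "legendre_coeff K j = (\<Prod>l<j. ((2 * real l + 1/2)\<^sup>2 - K\<^sup>2) / ((2 * real l + 1) * (2 * real l + 2)))"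

text \<open>Four times the factor that the kernel, with its pole included, picks up under w -> w +
  2. At v = 2 l + 1/2 it is the quotient of consecutive values of
  \<open>legendre_coeff\<close>.\<close>

definition shift_ratio :: "real \<Rightarrow> complex \<Rightarrow> complex" where
  "shift_ratio K v = (v\<^sup>2 - (of_real K)\<^sup>2) / ((v + 1/2) * (v + 3/2))"

lemma shift_ratio_norm_le:
  assumes "Re v \<ge> 0"
  shows "cmod (shift_ratio K v) \<le> 1 + K\<^sup>2 / ((Re v + 1/2) * (Re v + 3/2))"
proof -
  have 1: "cmod v \<le> cmod (v + 1/2)" "cmod v \<le> cmod (v + 3/2)"
    using assms by (auto simp: cmod_def power2_eq_square algebra_simps)
  have 2: "Re v + 1/2 \<le> cmod (v + 1/2)" "Re v + 3/2 \<le> cmod (v + 3/2)"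
    using complex_Re_le_cmod[of "v + 1/2"] complex_Re_le_cmod[of "v + 3/2"] by simp_all
  have p: "0 < (Re v + 1/2) * (Re v + 3/2)" using assms by simp
  have p2: "(Re v + 1/2) * (Re v + 3/2) \<le> cmod ((v + 1/2) * (v + 3/2))"
    unfolding norm_mult using 2 assms by (intro mult_mono) auto
  have "cmod (v\<^sup>2 - (of_real K)\<^sup>2) \<le> cmod (v\<^sup>2) + cmod ((of_real K)\<^sup>2)" by (rule norm_triangle_ineq4)
  also have "\<dots> = cmod v * cmod v + K\<^sup>2" by (simp add: norm_power power2_eq_square norm_mult)
  finally have "cmod (shift_ratio K v) \<le> (cmod v * cmod v + K\<^sup>2) / cmod ((v + 1/2) * (v + 3/2))"
    unfolding shift_ratio_def norm_divide by (rule divide_right_mono) auto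
  also have "\<dots> = cmod v * cmod v / cmod ((v + 1/2) * (v + 3/2)) + K\<^sup>2 / cmod ((v + 1/2) * (v + 3/2))"
    by (simp add: add_divide_distrib)
  also have "\<dots> \<le> 1 + K\<^sup>2 / ((Re v + 1/2) * (Re v + 3/2))"
  proof (intro add_mono)
    have "cmod v * cmod v \<le> cmod ((v + 1/2) * (v + 3/2))" unfolding norm_mult using 1 by (intro mult_mono) auto
    then show "cmod v * cmod v / cmod ((v + 1/2) * (v + 3/2)) \<le> 1" using p p2 by (simp add: divide_le_eq)
    show "K\<^sup>2 / cmod ((v + 1/2) * (v + 3/2)) \<le> K\<^sup>2 / ((Re v + 1/2) * (Re v + 3/2))"
      using p p2 by (intro divide_left_mono) (auto intro!: mult_pos_pos)
  qed
  finally show ?thesis .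
qed

text \<open>The leading terms of numerator and denominator cancel. The factor 1/|v| gained here is
  what makes the remainder \<open>E\<close> in \<open>inverse_mellin_sums\<close> absolutely
  integrable.\<close>

lemma shift_ratio_minus_1_norm_le:
  assumes "Re v \<ge> 0"
  shows "cmod (shift_ratio K v - 1) \<le> (2 + 2 * (K\<^sup>2 + 1)) / cmod (v + 3/2)"
proof -
  define c where "c = complex_of_real (K\<^sup>2 - 1/4)"
  have nz: "v + 1/2 \<noteq> 0" "v + 3/2 \<noteq> 0" using assms by (auto simp: complex_eq_iff)
  have "shift_ratio K v - 1 = (- 2 * (v + 1/2) - c) / ((v + 1/2) * (v + 3/2))"
    using nz unfolding shift_ratio_def c_def
    by (simp add: divide_simps) (simp add: power2_eq_square algebra_simps)
  also have "\<dots> = - 2 / (v + 3/2) - c / ((v + 1/2) * (v + 3/2))"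
  proof -
    have "(- 2 * a - c) / (a * b) = - 2 / b - c / (a * b)" if "a \<noteq> 0" "b \<noteq> 0" for a b
      using that by (simp add: diff_divide_distrib)
    then show ?thesis using nz by blast
  qed
  also have "cmod \<dots> \<le> cmod (- 2 / (v + 3/2)) + cmod (c / ((v + 1/2) * (v + 3/2)))"
    by (rule norm_triangle_ineq4)
  also have "\<dots> = 2 / cmod (v + 3/2) + cmod c / cmod (v + 1/2) / cmod (v + 3/2)"
    by (simp add: norm_divide norm_mult)
  also have "cmod c / cmod (v + 1/2) \<le> (K\<^sup>2 + 1) / (1/2)"
  proof (rule frac_le)
    show "cmod c \<le> K\<^sup>2 + 1" unfolding c_def norm_of_real by (simp add: abs_le_iff)
    show "1/2 \<le> cmod (v + 1/2)" using complex_Re_le_cmod[of "v + 1/2"] assms by simp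
  qed auto
  then have "2 / cmod (v + 3/2) + cmod c / cmod (v + 1/2) / cmod (v + 3/2)
      \<le> 2 / cmod (v + 3/2) + (K\<^sup>2 + 1) / (1/2) / cmod (v + 3/2)"
    by (intro add_left_mono divide_right_mono) auto
  finally show ?thesis by (simp add: add_divide_distrib mult.commute)
qed

lemma at_bot_prod_at_top_nontrivial: "(at_bot :: real filter) \<times>\<^sub>F (at_top :: real filter) \<noteq> bot"
  by (simp add: prod_filter_eq_bot)

text \<open>
  Let \<open>A j\<close> be the truncated integral over the line \<open>Re w = 2 j\<close>. Then \<open>A (Suc j) - A j\<close> tends to a
  residue, while the recurrence of the kernel under \<open>w \<mapsto> w + 2\<close> writes \<open>A (Suc j)\<close> as \<open>y\<^sup>2/4 * A j\<close> plus
  an absolutely convergent integral. As \<open>y\<^sup>2/4 < 1\<close>, this forces the conditionally convergent \<open>A j\<close>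
  to converge, and its limit vanishes as \<open>j \<rightarrow> \<infinity>\<close>.
\<close>
lemma inverse_mellin_sums:
  fixes m :: nat and y :: real
  assumes m: "m \<ge> 1" and y: "0 < y" "y < 2"
  defines "K \<equiv> 2 * real m - 1"
  defines "res \<equiv> \<lambda>j. 2 * of_real pi * reg_kernel m (1/2) * of_real (legendre_coeff K j) *
    of_real y powr (1/2) * of_real ((y/2) ^ (2*j))"
  obtains L where
    "((\<lambda>(a, b). integral {a..b} (\<lambda>t. reg_kernel m (Complex 0 t) * of_real y powr Complex 0 t
        / (Complex 0 t - 1/2))) \<longlongrightarrow> L) (at_bot \<times>\<^sub>F at_top)"
    "res sums (- L)"
proof -
  define F where "F = (at_bot :: real filter) \<times>\<^sub>F (at_top :: real filter)"
  define P where "P = (\<lambda>j w. \<Prod>l<j. shift_ratio K (w + 2 * of_nat l) / 4)"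
  \<comment> \<open>\<open>h j\<close> is the integrand at w + 2 j, rewritten by the recurrence. All
    shifted lines are thus studied in the fixed strip 0 \<le> Re w \<le> 2, where w = 1/2 is always
    the only pole.\<close>
  define f where "f = (\<lambda>j w. reg_kernel m w * P j w * (of_real y powr w * of_real (y ^ (2*j))))"
  define h where "h = (\<lambda>j w. f j w / (w - of_real (1/2)))"
  define b where "b = (\<lambda>l. 1 + K\<^sup>2 / ((2 * real l + 1/2) * (2 * real l + 3/2)))"
  \<comment> \<open>The size of \<open>f j\<close> up to a constant. It tends to 0 because b l tends
    to 1 while y^2/4 < 1.\<close>
  define X where "X = (\<lambda>j. (\<Prod>l<j. b l) * (y\<^sup>2/4) ^ j)"
  define q where "q = y\<^sup>2 / 4"
  have q: "0 < q" "q < 1"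
  proof -
    show "0 < q" using y by (simp add: q_def)
    have "y\<^sup>2 < 2\<^sup>2" using y by (intro power_strict_mono) auto
    then show "q < 1" by (simp add: q_def)
  qed
  have b1: "b l \<ge> 1" for l by (simp add: b_def)
  have Xpos: "X j > 0" for j unfolding X_def using b1 q by (intro mult_pos_pos prod_pos) (auto simp: q_def intro: less_le_trans[OF zero_less_one])
  have X0: "X \<longlonglongrightarrow> 0"
  proof -
    have "b \<longlonglongrightarrow> 1" unfolding b_def by real_asymp
    then have "(\<lambda>l. b l * q) \<longlonglongrightarrow> 1 * q" by (intro tendsto_intros)
    then have "eventually (\<lambda>l. b l * q < (1 + q) / 2) sequentially"
      using q by (intro order_tendstoD(2)[of _ "1 * q"]) auto
    then obtain N where N: "\<And>l. l \<ge> N \<Longrightarrow> b l * q < (1 + q) / 2" by (auto simp: eventually_sequentially)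
    have "summable X"
    proof (rule summable_ratio_test[of "(1 + q)/2" N])
      fix l assume "l \<ge> N"
      have "X (Suc l) = (b l * q) * X l" by (simp add: X_def q_def)
      also have "\<dots> \<le> (1 + q)/2 * X l" using N[OF \<open>l \<ge> N\<close>] Xpos[of l] by (intro mult_right_mono) auto
      finally show "norm (X (Suc l)) \<le> (1 + q) / 2 * norm (X l)" using Xpos by (simp add: less_imp_le)
    qed (use q in auto)
    then show ?thesis by (rule summable_LIMSEQ_zero)
  qed
  obtain C0 where C0: "C0 > 0" "\<And>w. 0 \<le> Re w \<Longrightarrow> Re w \<le> 2 \<Longrightarrow> cmod (reg_kernel m w) \<le> C0"
    using reg_kernel_bounded[OF m, of 0 2] m by auto
  define C where "C = C0 * max 1 (y\<^sup>2)"
  have Cpos: "C > 0" using C0 by (simp add: C_def)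
  have P_le: "cmod (P j w) \<le> (\<Prod>l<j. b l / 4)" if "Re w \<ge> 0" for j w
  proof -
    have "cmod (shift_ratio K (w + 2 * of_nat l) / 4) \<le> b l / 4" for l
    proof -
      have "cmod (shift_ratio K (w + 2 * of_nat l)) \<le> 1 + K\<^sup>2 / ((Re w + 2 * real l + 1/2) * (Re w + 2 * real l + 3/2))"
        using shift_ratio_norm_le[of "w + 2 * of_nat l" K] that by simp
      also have "\<dots> \<le> b l"
        unfolding b_def using that by (intro add_left_mono divide_left_mono mult_mono mult_pos_pos) auto
      finally show ?thesis by (simp add: norm_divide)
    qed
    then show ?thesis unfolding P_def prod_norm[symmetric] by (intro prod_mono) auto
  qed
  have f_le: "cmod (f j w) \<le> C * X j" if w: "0 \<le> Re w" "Re w \<le> 2" for j w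
  proof -
    have yw: "cmod (of_real y powr w) \<le> max 1 (y\<^sup>2)"
    proof -
      have "cmod (of_real y powr w) = y powr Re w" using y by (simp add: norm_powr_real_powr)
      also have "\<dots> \<le> max 1 (y\<^sup>2)"
      proof (cases "y \<le> 1")
        case True
        then have "y powr Re w \<le> y powr 0" using y w by (intro powr_mono') auto
        then show ?thesis using y by simp
      next
        case False
        then have "y powr Re w \<le> y powr 2" using y w by (intro powr_mono) auto
        then show ?thesis using y by (simp add: powr_numeral)
      qed
      finally show ?thesis .
    qed
    have "cmod (f j w) = cmod (reg_kernel m w) * cmod (P j w) * (cmod (of_real y powr w) * y ^ (2*j))"
      using y unfolding f_def norm_mult by (simp add: norm_power)
    also have "\<dots> \<le> C0 * (\<Prod>l<j. b l / 4) * (max 1 (y\<^sup>2) * y ^ (2*j))"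
      using C0 P_le[OF w(1), of j] yw w y order_trans[OF norm_ge_zero P_le[OF w(1), of j]]
      by (intro mult_mono mult_nonneg_nonneg) auto
    also have "(\<Prod>l<j. b l / 4) = (\<Prod>l<j. b l) / 4 ^ j" by (simp add: prod_dividef)
    also have "C0 * ((\<Prod>l<j. b l) / 4 ^ j) * (max 1 (y\<^sup>2) * y ^ (2*j)) = C * X j"
      by (simp add: C_def X_def power_divide power_mult)
    finally show ?thesis .
  qed
  have P_holo: "P j holomorphic_on {w. -1/2 < Re w \<and> Re w < 5/2}" for j
  proof -
    have nz: "w + 2 * of_nat l + of_real c \<noteq> 0" if "-1/2 < Re w" "c \<ge> 1/2" for w l c
    proof
      assume "w + 2 * of_nat l + of_real c = 0"
      then have "Re (w + 2 * of_nat l + of_real c) = 0" by (simp only: zero_complex.sel)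
      with that show False by simp
    qed
    have "(\<lambda>w. shift_ratio K (w + 2 * of_nat l) / 4) holomorphic_on {w. -1/2 < Re w \<and> Re w < 5/2}" for l
      unfolding shift_ratio_def
      by (intro holomorphic_intros) (use nz[of _ "1/2"] nz[of _ "3/2"] in auto)
    then show ?thesis unfolding P_def by (rule holomorphic_on_prod)
  qed
  have f_holo: "f j holomorphic_on {w. -1/2 < Re w \<and> Re w < 5/2}" for j
  proof -
    have "reg_kernel m holomorphic_on {w. -1/2 < Re w \<and> Re w < 5/2}"
      by (rule holomorphic_on_subset[OF reg_kernel_holomorphic]) (use m in auto)
    then show ?thesis unfolding f_def using P_holo y by (intro holomorphic_intros) auto
  qed
  define A where "A = (\<lambda>j (a, b). integral {a..b} (\<lambda>t. h j (Complex 0 t)))"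
  define R where "R = (\<lambda>j. 2 * of_real pi * f j (of_real (1/2)))"
  have shift: "h j (Complex 2 t) = h (Suc j) (Complex 0 t)" for j t
  proof -
    define w where "w = Complex 0 t"
    have w: "Complex 2 t = w + 2" "Re w = 0" by (simp_all add: w_def complex_eq_iff)
    have nz: "w - 1/2 \<noteq> 0" "w + 1/2 \<noteq> 0" "w + 3/2 \<noteq> 0" using w(2) by (auto simp: complex_eq_iff)
    have 1: "reg_kernel m (w + 2) / (w + 3/2) = shift_ratio K w / 4 * reg_kernel m w / (w - 1/2)"
      using reg_kernel_shift[of w m] m w(2) nz unfolding shift_ratio_def K_def
      by (simp add: divide_simps) (simp add: algebra_simps)
    have 2: "P (Suc j) w = shift_ratio K w / 4 * P j (w + 2)"
      unfolding P_def by (subst prod.lessThan_Suc_shift) (simp add: algebra_simps)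
    have 3: "of_real y powr (w + 2) = of_real y powr w * of_real (y\<^sup>2)"
      using y by (simp add: powr_add power2_eq_square powr_numeral)
    have "h j (Complex 2 t) = (reg_kernel m (w + 2) / (w + 3/2)) * (P j (w + 2) * (of_real y powr (w + 2) * of_real (y ^ (2*j))))"
      unfolding h_def f_def w(1) by (simp add: add.commute mult.assoc)
    also have "\<dots> = h (Suc j) w" unfolding 1 3 h_def f_def 2 by (simp add: power2_eq_square)
    finally show ?thesis by (simp add: w_def)
  qed
  have step: "((\<lambda>x. A (Suc j) x - A j x) \<longlongrightarrow> R j) F" for j
  proof -
    have "((\<lambda>(a, b). integral {a..b} (\<lambda>t. h j (Complex 2 t)) - integral {a..b} (\<lambda>t. h j (Complex 0 t)))
        \<longlongrightarrow> (if 0 < (1/2 :: real) \<and> 1/2 < (2 :: real) then 2 * of_real pi * f j (of_real (1/2)) else 0))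
        (at_bot \<times>\<^sub>F at_top)"
      unfolding h_def by (rule vertical_shift_tendsto[OF f_holo, where C = "C * X j"]) (use f_le in auto)
    then show ?thesis by (simp add: shift F_def A_def R_def case_prod_unfold)
  qed
  define E where "E = (\<lambda>j t. of_real q * (shift_ratio K (Complex 0 t + 2 * of_nat j) - 1) * h j (Complex 0 t))"
  have hE: "h (Suc j) (Complex 0 t) = of_real q * h j (Complex 0 t) + E j t" for j t
  proof -
    have "h (Suc j) (Complex 0 t) = shift_ratio K (Complex 0 t + 2 * of_nat j) * of_real q * h j (Complex 0 t)"
      by (simp add: h_def f_def P_def q_def power2_eq_square)
    then show ?thesis by (simp add: E_def algebra_simps)
  qed
  have h_cont: "continuous_on UNIV (\<lambda>t. h j (Complex 0 t))" for j
  proof -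
    have "continuous_on {w. Re w = 0} (h j)"
    proof -
      have "continuous_on {w. Re w = 0} (f j)"
        by (rule continuous_on_subset[OF holomorphic_on_imp_continuous_on[OF f_holo]]) auto
      then show ?thesis unfolding h_def by (intro continuous_intros) (auto simp: complex_eq_iff)
    qed
    then show ?thesis by (rule continuous_on_compose2) (auto intro!: continuous_intros)
  qed
  have E_cont: "continuous_on UNIV (E j)" for j
  proof -
    have "E j = (\<lambda>t. h (Suc j) (Complex 0 t) - of_real q * h j (Complex 0 t))" by (simp add: hE fun_eq_iff)
    then show ?thesis using h_cont by (simp add: continuous_intros)
  qed
  define D where "D = C * (2 + 2 * (K\<^sup>2 + 1)) * 4"
  have E_le: "cmod (E j t) \<le> D * X j * (1 / (1 + t\<^sup>2))" for j t
  proof -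
    define w where "w = Complex 0 t"
    have r: "cmod (w - 1/2) = sqrt (1/4 + t\<^sup>2)" by (simp add: w_def cmod_def power2_eq_square)
    have pos: "0 < 1/4 + t\<^sup>2" by (simp add: add_pos_nonneg)
    have le: "cmod (w - 1/2) \<le> cmod (w + 2 * of_nat j + 3/2)"
      unfolding cmod_def by (rule real_sqrt_le_mono) (auto simp: w_def intro!: add_mono power_mono)
    have "cmod (E j t) = q * cmod (shift_ratio K (w + 2 * of_nat j) - 1) * cmod (h j w)"
      using q by (simp add: E_def norm_mult w_def)
    \<comment> \<open>Both \<open>shift_ratio - 1\<close> and \<open>h j\<close> contribute a factor
      1 / |w - 1/2|; together they give the integrable majorant 1 / (1 + t^2).\<close>
    also have "\<dots> \<le> 1 * ((2 + 2 * (K\<^sup>2 + 1)) / cmod (w - 1/2)) * (C * X j / cmod (w - 1/2))"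
    proof (intro mult_mono mult_nonneg_nonneg)
      have "cmod (shift_ratio K (w + 2 * of_nat j) - 1) \<le> (2 + 2 * (K\<^sup>2 + 1)) / cmod (w + 2 * of_nat j + 3/2)"
        by (rule shift_ratio_minus_1_norm_le) (simp add: w_def)
      also have "\<dots> \<le> (2 + 2 * (K\<^sup>2 + 1)) / cmod (w - 1/2)"
        using le pos r by (intro divide_left_mono mult_pos_pos) (auto intro: less_le_trans)
      finally show "cmod (shift_ratio K (w + 2 * of_nat j) - 1) \<le> (2 + 2 * (K\<^sup>2 + 1)) / cmod (w - 1/2)" .
      show "cmod (h j w) \<le> C * X j / cmod (w - 1/2)"
        unfolding h_def norm_divide using f_le[of w j] by (intro frac_le) (use r pos Cpos Xpos[of j] in \<open>auto simp: w_def\<close>)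
    qed (use q Cpos Xpos[of j] in auto)
    also have "\<dots> = (2 + 2 * (K\<^sup>2 + 1)) * C * X j / (1/4 + t\<^sup>2)"
      using pos by (simp add: r)
    also have "\<dots> \<le> (2 + 2 * (K\<^sup>2 + 1)) * C * X j / ((1 + t\<^sup>2) / 4)"
      using Cpos Xpos[of j] by (intro divide_left_mono mult_nonneg_nonneg) (auto intro!: mult_pos_pos add_pos_nonneg)
    also have "\<dots> = D * X j * (1 / (1 + t\<^sup>2))" by (simp add: D_def mult_ac)
    finally show ?thesis .
  qed
  have bint: "((\<lambda>t. D * X j * (1 / (1 + t\<^sup>2))) has_integral (D * X j * pi)) UNIV" for j
    by (rule has_integral_mult_right[OF has_integral_inverse_1_plus_square])
  have E_int: "E j integrable_on UNIV" for j
  proof -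
    have "E j absolutely_integrable_on UNIV"
      by (rule measurable_bounded_by_integrable_imp_absolutely_integrable[OF _ _ has_integral_integrable[OF bint] E_le])
         (auto intro!: continuous_imp_measurable_on_sets_lebesgue E_cont)
    then show ?thesis using set_lebesgue_integral_eq_integral(1) by blast
  qed
  define e where "e = (\<lambda>j. integral UNIV (E j))"
  have e_lim: "((\<lambda>x. integral {fst x..snd x} (E j)) \<longlongrightarrow> e j) F" for j
    using has_integral_UNIV_iff_tendsto[OF E_cont] integrable_integral[OF E_int]
    by (simp add: e_def F_def case_prod_unfold)
  have e_le: "cmod (e j) \<le> D * X j * pi" for j
    unfolding e_def using integral_norm_bound_integral[OF E_int has_integral_integrable[OF bint] E_le] integral_unique[OF bint]
    by simp
  have A_split: "A (Suc j) x = of_real q * A j x + integral {fst x..snd x} (E j)" for j x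
  proof -
    have 1: "(\<lambda>t. h j (Complex 0 t)) integrable_on {fst x..snd x}" "E j integrable_on {fst x..snd x}"
      by (rule integrable_continuous_real, rule continuous_on_subset[OF h_cont] continuous_on_subset[OF E_cont], simp)+
    have "integral {fst x..snd x} (\<lambda>t. of_real q * h j (Complex 0 t) + E j t) =
        integral {fst x..snd x} (\<lambda>t. of_real q * h j (Complex 0 t)) + integral {fst x..snd x} (E j)"
      by (rule integral_add[OF integrable_on_mult_right[OF 1(1)] 1(2)])
    then show ?thesis by (simp add: A_def hE case_prod_unfold)
  qed
  \<comment> \<open>The solution for \<open>A j\<close> of the two limiting relations A (Suc j) - A
    j = R j and A (Suc j) = q * A j + e j.\<close>
  define L where "L = (\<lambda>j. (e j - R j) / (1 - of_real q))"
  have q1: "1 - of_real q \<noteq> (0::complex)" using q by (metis eq_iff_diff_eq_0 of_real_eq_1_iff less_irrefl)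
  have A_lim: "(A j \<longlongrightarrow> L j) F" for j
  proof -
    have "A j x = (integral {fst x..snd x} (E j) - (A (Suc j) x - A j x)) / (1 - of_real q)" for x
      using q1 unfolding A_split by (simp add: field_simps)
    then have "A j = (\<lambda>x. (integral {fst x..snd x} (E j) - (A (Suc j) x - A j x)) / (1 - of_real q))" by blast
    moreover have "((\<lambda>x. (integral {fst x..snd x} (E j) - (A (Suc j) x - A j x)) / (1 - of_real q)) \<longlongrightarrow> L j) F"
      unfolding L_def using e_lim step q1 by (intro tendsto_intros)
    ultimately show ?thesis by simp
  qed
  have LR: "L (Suc j) - L j = R j" for j
    using tendsto_unique[OF _ tendsto_diff[OF A_lim[of "Suc j"] A_lim[of j]] step[of j]] at_bot_prod_at_top_nontrivial
    by (simp add: F_def)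
  have "L \<longlonglongrightarrow> 0"
  proof (rule Lim_null_comparison)
    show "eventually (\<lambda>j. norm (L j) \<le> (D * X j * pi + 2 * pi * (C * X j)) / (1 - q)) sequentially"
    proof (intro always_eventually allI)
      fix j
      have "cmod (R j) \<le> 2 * pi * (C * X j)" unfolding R_def norm_mult using f_le[of "of_real (1/2)" j] by simp
      then have "cmod (e j - R j) \<le> D * X j * pi + 2 * pi * (C * X j)"
        using e_le[of j] norm_triangle_ineq4[of "e j" "R j"] by linarith
      moreover have "cmod (1 - of_real q) = 1 - q" using q by (metis norm_of_real of_real_1 of_real_diff abs_of_pos diff_gt_0_iff_gt)
      ultimately show "norm (L j) \<le> (D * X j * pi + 2 * pi * (C * X j)) / (1 - q)"
        unfolding L_def norm_divide using q by (simp add: divide_right_mono)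
    qed
    have "(\<lambda>j. (D * X j * pi + 2 * pi * (C * X j)) / (1 - q)) \<longlonglongrightarrow> (D * 0 * pi + 2 * pi * (C * 0)) / (1 - q)"
      using q by (intro tendsto_intros X0) auto
    then show "(\<lambda>j. (D * X j * pi + 2 * pi * (C * X j)) / (1 - q)) \<longlonglongrightarrow> 0" by simp
  qed
  then have "(\<lambda>j. L (Suc j) - L j) sums (0 - L 0)" by (rule telescope_sums)
  then have sums: "R sums (- L 0)" by (simp add: LR)
  have "R j = res j" for j
  proof -
    have "P j (of_real (1/2)) = of_real (legendre_coeff K j / 4 ^ j)"
    proof -
      have "P j (of_real (1/2)) = (\<Prod>l<j. of_real (((2 * real l + 1/2)\<^sup>2 - K\<^sup>2) / ((2 * real l + 1) * (2 * real l + 2)) / 4))"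
        unfolding P_def shift_ratio_def by (intro prod.cong refl) (simp add: algebra_simps)
      also have "\<dots> = of_real (legendre_coeff K j / 4 ^ j)"
      proof -
        have "(\<Prod>l<j. x l / 4) = (\<Prod>l<j. x l) / 4 ^ j" for x :: "nat \<Rightarrow> real"
          by (simp add: prod_dividef)
        then show ?thesis unfolding legendre_coeff_def of_real_prod[symmetric] by (simp only:)
      qed
      finally show ?thesis .
    qed
    then show ?thesis
      by (simp add: R_def res_def f_def power_divide power_mult)
  qed
  then have R: "R = res"
    by blast
  show thesis
  proof (rule that)
    show "((\<lambda>(a, b). integral {a..b} (\<lambda>t. reg_kernel m (Complex 0 t) * of_real y powr Complex 0 t
        / (Complex 0 t - 1/2))) \<longlongrightarrow> L 0) (at_bot \<times>\<^sub>F at_top)"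
      using A_lim[of 0] by (simp add: A_def h_def f_def P_def F_def)
    show "res sums (- L 0)" using sums by (simp only: R)
  qed
qed

text \<open>The series is obtained on the line Re w = 0. Moving that line to \<Delta> costs no
  residue: both lie to the left of the pole 1/2 and to the right of 1 - 2m, where the poles of
  Gamma(m - 1/2 + w/2) begin.\<close>

lemma I_fun_eq:
  fixes m :: nat and y \<Delta> :: real
  assumes m: "m \<ge> 1" and y: "0 < y" "y < 2" and \<Delta>: "1 - 2 * real m < \<Delta>" "\<Delta> < 1/2"
  defines "a \<equiv> \<lambda>j. legendre_coeff (2 * real m - 1) j * (y/2) ^ (2*j)"
  shows "I_fun \<Delta> m 0 y = of_real (Gamma (real m - 1/4) / Gamma (real m + 1/4) * sqrt y * (\<Sum>j. a j))"
proof -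
  have "real m \<ge> 1" using m by simp
  define c where "c = Gamma (real m - 1/4) / Gamma (real m + 1/4)"
  have pos: "Gamma (real m - 1/4) > 0" "Gamma (real m + 1/4) > 0" using m by (auto intro!: Gamma_real_pos)
  obtain L where L: "((\<lambda>(a, b). integral {a..b} (\<lambda>t. reg_kernel m (Complex 0 t) * of_real y powr Complex 0 t
        / (Complex 0 t - 1/2))) \<longlongrightarrow> L) (at_bot \<times>\<^sub>F at_top)"
    and sums: "(\<lambda>j. 2 * of_real pi * reg_kernel m (1/2) * of_real (legendre_coeff (2 * real m - 1) j) *
        of_real y powr (1/2) * of_real ((y/2) ^ (2*j))) sums (- L)"
    using inverse_mellin_sums[OF m y] by blast
  have half: "reg_kernel m (1/2) = - of_real c"
  proof -
    have "Gamma (complex_of_nat m - 1/2 + 1/2/2) = of_real (Gamma (real m - 1/4))"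
      by (simp flip: Gamma_complex_of_real add: field_simps)
    moreover have "rGamma (complex_of_nat m + 1/2 - 1/2/2) = of_real (1 / Gamma (real m + 1/4))"
      by (simp add: rGamma_inverse_Gamma inverse_eq_divide add.commute flip: Gamma_complex_of_real)
    moreover have "exp (- (1/2 + 1/2) * of_real (ln 2)) = (1/2 :: complex)"
      by (simp add: exp_minus exp_of_real)
    moreover have "Gamma (5/4 - 1/2/2 :: complex) = 1" by simp
    moreover have "rGamma (1/4 + 1/2/2 :: complex) = 1 / of_real (sqrt pi)"
      using Gamma_one_half_complex by (simp add: rGamma_inverse_Gamma inverse_eq_divide)
    ultimately show ?thesis unfolding reg_kernel_def by (simp only:) (simp add: c_def)
  qed
  have yh: "complex_of_real y powr (1/2) = of_real (sqrt y)"
    using powr_of_real[of y "1/2"] y by (simp add: powr_half_sqrt)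
  define B where "B = 2 * pi * c * sqrt y"
  have B: "B > 0" using y pos by (simp add: B_def c_def)
  have eq: "2 * of_real pi * reg_kernel m (1/2) * of_real (legendre_coeff (2 * real m - 1) j) *
        of_real y powr (1/2) * of_real ((y/2) ^ (2*j)) = of_real (- B * a j)" for j
    by (simp add: half yh a_def B_def)
  have sums': "(\<lambda>j. complex_of_real (- B * a j)) sums (- L)" using sums unfolding eq .
  then have "summable (\<lambda>j. complex_of_real (- B * a j))" by (rule sums_summable)
  then have "summable (\<lambda>j. - B * a j)" unfolding summable_complex_of_real .
  then have "summable (\<lambda>j. - B * a j / - B)" by (rule summable_divide)
  then have "summable a" using B by simp
  then have "(\<lambda>j. complex_of_real (- B * a j)) sums of_real (- B * (\<Sum>j. a j))"
    by (intro sums_of_real sums_mult summable_sums)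
  then have L_eq: "L = of_real (B * (\<Sum>j. a j))" using sums_unique2[OF sums'] by fastforce
  define G where "G = (\<lambda>w. reg_kernel m w * of_real y powr w / (w - of_real (1/2)))"
  have fh: "(\<lambda>w. reg_kernel m w * of_real y powr w) holomorphic_on {w. 1 - 2 * real m < Re w \<and> Re w < 5/2}"
    using y by (intro holomorphic_intros reg_kernel_holomorphic) auto
  have G_holo: "G holomorphic_on {w. 1 - 2 * real m < Re w \<and> Re w < 1/2}"
  proof -
    have "w - of_real (1/2) \<noteq> 0" if "Re w < 1/2" for w :: complex
    proof
      assume "w - of_real (1/2) = 0"
      then have "Re (w - of_real (1/2)) = 0" by (simp only: zero_complex.sel)
      with that show False by simp
    qed
    moreover have "(\<lambda>w. reg_kernel m w * of_real y powr w) holomorphic_on {w. 1 - 2 * real m < Re w \<and> Re w < 1/2}"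
      by (rule holomorphic_on_subset[OF fh]) auto
    ultimately show ?thesis unfolding G_def
      by (intro holomorphic_on_divide holomorphic_on_diff holomorphic_on_ident holomorphic_on_const) blast+
  qed
  have lim0: "((\<lambda>(a, b). integral {a..b} (\<lambda>t. G (Complex 0 t))) \<longlongrightarrow> L) (at_bot \<times>\<^sub>F at_top)"
    using L by (simp add: G_def)
  have diff: "((\<lambda>(a, b). integral {a..b} (\<lambda>t. G (Complex c2 t)) - integral {a..b} (\<lambda>t. G (Complex c1 t)))
    \<longlongrightarrow> 0) (at_bot \<times>\<^sub>F at_top)" if c: "1 - 2 * real m < c1" "c1 < c2" "c2 < 1/2" for c1 c2
  proof -
    obtain C where C: "C > 0" "\<And>w. c1 \<le> Re w \<Longrightarrow> Re w \<le> c2 \<Longrightarrow> cmod (reg_kernel m w) \<le> C"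
      using reg_kernel_bounded[OF m, of c1 c2] c by auto
    define Y where "Y = max (y powr c1) (y powr c2)"
    have "cmod (reg_kernel m w * of_real y powr w) \<le> C * Y" if w: "c1 \<le> Re w" "Re w \<le> c2" for w
    proof -
      have "cmod (of_real y powr w) = y powr Re w" using y by (simp add: norm_powr_real_powr)
      also have "\<dots> \<le> Y"
      proof (cases "y \<le> 1")
        case True
        then have "y powr Re w \<le> y powr c1" using y w by (intro powr_mono') auto
        then show ?thesis by (simp add: Y_def)
      next
        case False
        then have "y powr Re w \<le> y powr c2" using y w by (intro powr_mono) auto
        then show ?thesis by (simp add: Y_def)
      qed
      finally show ?thesis unfolding norm_mult using C w by (intro mult_mono) auto
    qed
    from vertical_shift_tendsto[OF fh, of c1 c2 "1/2", OF _ _ _ _ _ _ _ this]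
    show ?thesis using c by (simp add: G_def)
  qed
  have "((\<lambda>(a, b). integral {a..b} (\<lambda>t. G (Complex \<Delta> t))) \<longlongrightarrow> L) (at_bot \<times>\<^sub>F at_top)"
  proof -
    consider "\<Delta> = 0" | "\<Delta> < 0" | "\<Delta> > 0" by linarith
    then show ?thesis
    proof cases
      case 1
      then show ?thesis using lim0 by simp
    next
      case 2
      have d: "((\<lambda>(a, b). integral {a..b} (\<lambda>t. G (Complex 0 t)) - integral {a..b} (\<lambda>t. G (Complex \<Delta> t)))
          \<longlongrightarrow> 0) (at_bot \<times>\<^sub>F at_top)"
        using 2 \<Delta> by (intro diff) auto
      show ?thesis using tendsto_diff[OF lim0 d] by (simp add: case_prod_unfold)
    next
      case 3
      have d: "((\<lambda>(a, b). integral {a..b} (\<lambda>t. G (Complex \<Delta> t)) - integral {a..b} (\<lambda>t. G (Complex 0 t)))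
          \<longlongrightarrow> 0) (at_bot \<times>\<^sub>F at_top)"
        by (intro diff) (use 3 \<open>real m \<ge> 1\<close> \<Delta> in linarith)+
      show ?thesis using tendsto_add[OF lim0 d] by (simp add: case_prod_unfold)
    qed
  qed
  moreover have "continuous_on UNIV (\<lambda>t. G (Complex \<Delta> t))"
    using \<Delta> by (intro continuous_on_compose2[OF holomorphic_on_imp_continuous_on[OF G_holo]])
      (auto intro!: continuous_intros)
  ultimately have "((\<lambda>t. G (Complex \<Delta> t)) has_integral L) UNIV"
    by (simp add: has_integral_UNIV_iff_tendsto)
  moreover have "G (Complex \<Delta> t) = mellin_kernel m (Complex \<Delta> t) * of_real y powr Complex \<Delta> t" for t
    using mellin_kernel_eq[of "Complex \<Delta> t" m] \<Delta> by (simp add: G_def)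
  ultimately have "integral UNIV (\<lambda>t. mellin_kernel m (Complex \<Delta> t) * of_real y powr Complex \<Delta> t) = L"
    by (simp add: integral_unique)
  then have "I_fun \<Delta> m 0 y = 1 / (2 * of_real pi * \<i>) * (\<i> * L)"
    unfolding I_fun_def vertical_line_integral_def mellin_kernel_def by simp
  also have "\<dots> = of_real (c * sqrt y * (\<Sum>j. a j))"
    by (simp add: L_eq B_def)
  finally show "I_fun \<Delta> m 0 y = of_real (Gamma (real m - 1/4) / Gamma (real m + 1/4) * sqrt y * (\<Sum>j. a j))"
    by (simp add: c_def)
qed

section \<open>The even Legendre function\<close>

text \<open>As a formal power series the solution is differentiated termwise by algebra alone, and
  the differential equation becomes an identity of coefficients.\<close>

definition legendre_fps :: "real \<Rightarrow> real fps" where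
  "legendre_fps K = Abs_fps (\<lambda>n. if even n then legendre_coeff K (n div 2) else 0)"

lemma legendre_coeff_summable:
  assumes "\<bar>x\<bar> < 1"
  shows "summable (\<lambda>j. legendre_coeff K j * x ^ (2 * j))"
proof -
  define \<rho> where "\<rho> = (\<lambda>l. \<bar>((2 * real l + 1/2)\<^sup>2 - K\<^sup>2) / ((2 * real l + 1) * (2 * real l + 2))\<bar> * x\<^sup>2)"
  have x: "x\<^sup>2 < 1" using assms by (simp add: abs_square_less_1)
  have "(\<lambda>l. \<bar>((2 * real l + 1/2)\<^sup>2 - K\<^sup>2) / ((2 * real l + 1) * (2 * real l + 2))\<bar>) \<longlonglongrightarrow> \<bar>1\<bar>"
    by (intro tendsto_rabs) real_asymp
  then have "\<rho> \<longlonglongrightarrow> 1 * x\<^sup>2" unfolding \<rho>_def by (intro tendsto_intros) auto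
  then have "eventually (\<lambda>l. \<rho> l < (1 + x\<^sup>2) / 2) sequentially"
    using x by (intro order_tendstoD(2)[of _ "1 * x\<^sup>2"]) auto
  then obtain N where N: "\<And>l. l \<ge> N \<Longrightarrow> \<rho> l < (1 + x\<^sup>2) / 2" by (auto simp: eventually_sequentially)
  show ?thesis
  proof (rule summable_ratio_test[of "(1 + x\<^sup>2) / 2" N])
    fix l assume "l \<ge> N"
    have "norm (legendre_coeff K (Suc l) * x ^ (2 * Suc l)) = \<rho> l * norm (legendre_coeff K l * x ^ (2 * l))"
      by (simp add: legendre_coeff_def \<rho>_def abs_mult power2_eq_square abs_divide)
    also have "\<dots> \<le> (1 + x\<^sup>2) / 2 * norm (legendre_coeff K l * x ^ (2 * l))"
      using N[OF \<open>l \<ge> N\<close>] by (intro mult_right_mono) auto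
    finally show "norm (legendre_coeff K (Suc l) * x ^ (2 * Suc l)) \<le> (1 + x\<^sup>2) / 2 * norm (legendre_coeff K l * x ^ (2 * l))" .
  qed (use x in auto)
qed

lemma
  assumes "\<bar>x\<bar> < 1"
  shows summable_legendre_fps: "summable (\<lambda>n. fps_nth (legendre_fps K) n * x ^ n)"
    and eval_legendre_fps: "eval_fps (legendre_fps K) x = (\<Sum>j. legendre_coeff K j * x ^ (2 * j))"
proof -
  have sm: "strict_mono (\<lambda>j::nat. 2 * j)" by (auto simp: strict_mono_def)
  have z: "fps_nth (legendre_fps K) n * x ^ n = 0" if "n \<notin> range (\<lambda>j. 2 * j)" for n
    using that by (auto simp: legendre_fps_def elim!: evenE)
  have e: "fps_nth (legendre_fps K) (2 * j) * x ^ (2 * j) = legendre_coeff K j * x ^ (2 * j)" for j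
    by (simp add: legendre_fps_def)
  show "summable (\<lambda>n. fps_nth (legendre_fps K) n * x ^ n)"
  proof -
    have "summable (\<lambda>j. fps_nth (legendre_fps K) (2 * j) * x ^ (2 * j)) \<longleftrightarrow>
        summable (\<lambda>n. fps_nth (legendre_fps K) n * x ^ n)"
      using sm z by (rule summable_mono_reindex)
    then show ?thesis using legendre_coeff_summable[OF assms, of K] by (simp only: e)
  qed
  show "eval_fps (legendre_fps K) x = (\<Sum>j. legendre_coeff K j * x ^ (2 * j))"
  proof -
    have "(\<Sum>j. fps_nth (legendre_fps K) (2 * j) * x ^ (2 * j)) = (\<Sum>n. fps_nth (legendre_fps K) n * x ^ n)"
      using sm z by (rule suminf_mono_reindex)
    then show ?thesis by (simp only: e eval_fps_def)
  qed
qed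

lemma fps_conv_radius_legendre: "fps_conv_radius (legendre_fps K) \<ge> 1"
  unfolding fps_conv_radius_def
proof (rule conv_radius_geI_ex)
  fix r :: real assume "0 < r" "ereal r < 1"
  then show "\<exists>z. norm z = r \<and> summable (\<lambda>n. fps_nth (legendre_fps K) n * z ^ n)"
    by (intro exI[of _ r]) (auto intro!: summable_legendre_fps)
qed

text \<open>Legendre's equation with nu (nu + 1) = K^2 - 1/4, that is nu = K - 1/2, solved for the
  pure second derivative. Comparing coefficients leaves the two-step recurrence of
  \<open>legendre_coeff\<close>.\<close>

lemma legendre_fps_ode:
  "fps_deriv (fps_deriv (legendre_fps K)) =
     fps_X ^ 2 * fps_deriv (fps_deriv (legendre_fps K)) +
     (fps_const 2 * (fps_X * fps_deriv (legendre_fps K)) - fps_const (K\<^sup>2 - 1/4) * legendre_fps K)"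
    (is "?l = ?r")
proof (rule fps_ext)
  fix n
  define c where "c = fps_nth (legendre_fps K)"
  have rec: "c (n + 2) * ((real n + 1) * (real n + 2)) = (real n * (real n + 1) - (K\<^sup>2 - 1/4)) * c n" for n
  proof (cases "even n")
    case True
    then obtain l where n: "n = 2 * l" by (elim evenE)
    have "legendre_coeff K (Suc l) * ((2 * real l + 1) * (2 * real l + 2)) = ((2 * real l + 1/2)\<^sup>2 - K\<^sup>2) * legendre_coeff K l"
      by (simp add: legendre_coeff_def)
    then show ?thesis
      by (simp add: c_def legendre_fps_def n power2_eq_square algebra_simps)
  next
    case False
    then show ?thesis by (simp add: c_def legendre_fps_def)
  qed
  have "fps_nth ?l n = c (n + 2) * ((real n + 1) * (real n + 2))"
    by (simp add: c_def algebra_simps)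
  moreover have "fps_nth ?r n = (real n * (real n - 1) + 2 * real n - (K\<^sup>2 - 1/4)) * c n"
  proof (cases n)
    case 0
    then show ?thesis by (simp add: c_def fps_X_power_mult_nth algebra_simps)
  next
    case (Suc k)
    show ?thesis
    proof (cases k)
      case 0
      then show ?thesis using Suc by (simp add: c_def fps_X_power_mult_nth algebra_simps)
    next
      case (Suc i)
      then show ?thesis using \<open>n = Suc k\<close>
        by (simp add: c_def fps_X_power_mult_nth fps_X_power_mult_right_nth algebra_simps)
    qed
  qed
  ultimately show "fps_nth ?l n = fps_nth ?r n" using rec[of n] by (simp add: algebra_simps)
qed

lemma legendre_ode:
  fixes x K :: real
  assumes "\<bar>x\<bar> < 1"
  defines "p \<equiv> legendre_fps K"
  shows "(1 - x\<^sup>2) * eval_fps (fps_deriv (fps_deriv p)) x - 2 * x * eval_fps (fps_deriv p) x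
     + (K\<^sup>2 - 1/4) * eval_fps p x = 0"
proof -
  have "ereal (norm x) < 1" using assms by simp
  then have r0: "ereal (norm x) < fps_conv_radius p" unfolding p_def by (rule less_le_trans[OF _ fps_conv_radius_legendre])
  then have r1: "ereal (norm x) < fps_conv_radius (fps_deriv p)" by (rule less_le_trans[OF _ fps_conv_radius_deriv])
  then have r2: "ereal (norm x) < fps_conv_radius (fps_deriv (fps_deriv p))" by (rule less_le_trans[OF _ fps_conv_radius_deriv])
  have m: "ereal (norm x) < fps_conv_radius (f * g)" if "ereal (norm x) < fps_conv_radius f" "ereal (norm x) < fps_conv_radius g" for f g :: "real fps"
    by (rule less_le_trans[OF _ fps_conv_radius_mult]) (use that in simp)
  have d: "ereal (norm x) < fps_conv_radius (f - g)" if "ereal (norm x) < fps_conv_radius f" "ereal (norm x) < fps_conv_radius g" for f g :: "real fps"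
    by (rule less_le_trans[OF _ fps_conv_radius_diff]) (use that in simp)
  have "eval_fps (fps_deriv (fps_deriv p)) x = eval_fps (fps_X ^ 2 * fps_deriv (fps_deriv p) +
     (fps_const 2 * (fps_X * fps_deriv p) - fps_const (K\<^sup>2 - 1/4) * p)) x"
    using legendre_fps_ode[of K] unfolding p_def by simp
  also have "\<dots> = x\<^sup>2 * eval_fps (fps_deriv (fps_deriv p)) x + (2 * (x * eval_fps (fps_deriv p) x) - (K\<^sup>2 - 1/4) * eval_fps p x)"
    using r0 r1 r2 by (subst eval_fps_add eval_fps_diff eval_fps_mult; (intro m d)?; simp?)+
  finally show ?thesis by (simp add: algebra_simps)
qed

section \<open>Liouville's normal form and uniform bounds for U\<close>

definition legF :: "real \<Rightarrow> real \<Rightarrow> real" where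
  "legF K \<phi> = eval_fps (legendre_fps K) (sin \<phi>)"

text \<open>The quasi-derivative (1 - xi^2) f'(xi) at xi = sin \<phi>. In the system F' = G / cos,
  G' = - (K^2 - 1/4) cos F the equation for G has no singularity at pi/2, which makes G the right
  quantity near that end.\<close>

definition legG :: "real \<Rightarrow> real \<Rightarrow> real" where
  "legG K \<phi> = (cos \<phi>)\<^sup>2 * eval_fps (fps_deriv (legendre_fps K)) (sin \<phi>)"

text \<open>The square root removes the first-order term of F'' - tan \<phi> F' + (K^2 - 1/4) F =
  0.\<close>

definition legU :: "real \<Rightarrow> real \<Rightarrow> real" where
  "legU K \<phi> = sqrt (cos \<phi>) * legF K \<phi>"

text \<open>This is U' in terms of F and G; see \<open>legU_deriv\<close>.\<close>

definition legV :: "real \<Rightarrow> real \<Rightarrow> real" where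
  "legV K \<phi> = legG K \<phi> / sqrt (cos \<phi>) - sin \<phi> / (2 * cos \<phi>) * legU K \<phi>"

lemma cos_pos_sin_lt_1:
  assumes "-(pi/2) < \<phi>" "\<phi> < pi/2"
  shows "cos \<phi> > 0" "\<bar>sin \<phi>\<bar> < 1"
proof -
  show c: "cos \<phi> > 0" using assms by (intro cos_gt_zero_pi) auto
  have "(sin \<phi>)\<^sup>2 < 1" using c by (simp add: sin_squared_eq)
  then show "\<bar>sin \<phi>\<bar> < 1" by (simp add: abs_square_less_1)
qed

context
  fixes K \<phi> :: real
  assumes \<phi>: "-(pi/2) < \<phi>" "\<phi> < pi/2"
begin

lemma legF_deriv: "(legF K has_real_derivative legG K \<phi> / cos \<phi>) (at \<phi>)"
proof -
  note c = cos_pos_sin_lt_1[OF \<phi>]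
  have r0: "ereal (norm (sin \<phi>)) < fps_conv_radius (legendre_fps K)"
    using c by (intro less_le_trans[OF _ fps_conv_radius_legendre]) auto
  have "((\<lambda>\<phi>. eval_fps (legendre_fps K) (sin \<phi>)) has_real_derivative
      eval_fps (fps_deriv (legendre_fps K)) (sin \<phi>) * cos \<phi>) (at \<phi>)"
    by (rule DERIV_chain2[OF has_field_derivative_eval_fps[OF r0] DERIV_sin])
  then show ?thesis using c by (simp add: legF_def[abs_def] legG_def power2_eq_square mult.commute)
qed

lemma legG_deriv: "(legG K has_real_derivative - (K\<^sup>2 - 1/4) * cos \<phi> * legF K \<phi>) (at \<phi>)"
proof -
  note c = cos_pos_sin_lt_1[OF \<phi>]
  define p where "p = legendre_fps K"
  have "ereal (norm (sin \<phi>)) < fps_conv_radius (legendre_fps K)"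
    using c by (intro less_le_trans[OF _ fps_conv_radius_legendre]) auto
  then have r1: "ereal (norm (sin \<phi>)) < fps_conv_radius (fps_deriv p)"
    unfolding p_def by (rule less_le_trans[OF _ fps_conv_radius_deriv])
  define f0 f1 f2 where "f0 = eval_fps p (sin \<phi>)" "f1 = eval_fps (fps_deriv p) (sin \<phi>)" "f2 = eval_fps (fps_deriv (fps_deriv p)) (sin \<phi>)"
  have d1: "((\<lambda>\<phi>. eval_fps (fps_deriv p) (sin \<phi>)) has_real_derivative f2 * cos \<phi>) (at \<phi>)"
    unfolding f0_f1_f2_def by (rule DERIV_chain2[OF has_field_derivative_eval_fps[OF r1] DERIV_sin])
  have "((\<lambda>\<phi>. (cos \<phi>)\<^sup>2 * eval_fps (fps_deriv p) (sin \<phi>)) has_real_derivative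
      (2 * cos \<phi> * (- sin \<phi>) * f1 + f2 * cos \<phi> * (cos \<phi>)\<^sup>2)) (at \<phi>)"
    by (rule DERIV_cong[OF DERIV_mult[OF DERIV_power[OF DERIV_cos] d1]])
       (simp add: f0_f1_f2_def)
  moreover have "2 * cos \<phi> * (- sin \<phi>) * f1 + f2 * cos \<phi> * (cos \<phi>)\<^sup>2 = - (K\<^sup>2 - 1/4) * cos \<phi> * f0"
  proof -
    have ode: "(1 - (sin \<phi>)\<^sup>2) * f2 - 2 * sin \<phi> * f1 + (K\<^sup>2 - 1/4) * f0 = 0"
      using legendre_ode[OF c(2)] unfolding f0_f1_f2_def p_def .
    have "2 * cos \<phi> * (- sin \<phi>) * f1 + f2 * cos \<phi> * (cos \<phi>)\<^sup>2 + (K\<^sup>2 - 1/4) * cos \<phi> * f0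
       = cos \<phi> * ((1 - (sin \<phi>)\<^sup>2) * f2 - 2 * sin \<phi> * f1 + (K\<^sup>2 - 1/4) * f0)"
      unfolding cos_squared_eq by (simp add: algebra_simps)
    then show ?thesis unfolding ode by (simp add: algebra_simps)
  qed
  ultimately show ?thesis unfolding legG_def[abs_def] legF_def f0_f1_f2_def p_def by simp
qed

lemma legU_deriv: "(legU K has_real_derivative legV K \<phi>) (at \<phi>)"
proof -
  note c = cos_pos_sin_lt_1[OF \<phi>]
  define w where "w = sqrt (cos \<phi>)"
  have w: "w > 0" "cos \<phi> = w\<^sup>2" using c by (simp_all add: w_def)
  have "(legU K has_real_derivative (- sin \<phi> * (inverse (sqrt (cos \<phi>)) / 2)) * legF K \<phi> + legG K \<phi> / cos \<phi> * sqrt (cos \<phi>)) (at \<phi>)"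
    unfolding legU_def[abs_def] using c
    by (auto intro!: derivative_eq_intros legF_deriv)
  moreover have "(- sin \<phi> * (inverse (sqrt (cos \<phi>)) / 2)) * legF K \<phi> + legG K \<phi> / cos \<phi> * sqrt (cos \<phi>) = legV K \<phi>"
    unfolding legV_def legU_def w_def[symmetric] w(2) using w(1) by (simp add: field_simps power2_eq_square)
  ultimately show ?thesis by simp
qed

lemma legV_deriv: "(legV K has_real_derivative - (K\<^sup>2 + 1 / (4 * (cos \<phi>)\<^sup>2)) * legU K \<phi>) (at \<phi>)"
proof -
  note c = cos_pos_sin_lt_1[OF \<phi>]
  define w where "w = sqrt (cos \<phi>)"
  define s where "s = sin \<phi>"
  have w: "w > 0" "cos \<phi> = w\<^sup>2" using c by (simp_all add: w_def)
  define U G where UG: "U = legU K \<phi>" "G = legG K \<phi>"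
  have F: "legF K \<phi> = U / w" unfolding UG legU_def w_def[symmetric] using w(1) by simp
  have V: "legV K \<phi> = G / w - s / (2 * w\<^sup>2) * U" 
    unfolding legV_def UG w_def[symmetric] s_def[symmetric] w(2) using w(1) by simp
  define D where "D = ((- (K\<^sup>2 - 1/4) * w\<^sup>2 * (U / w)) * w - G * (- s * (inverse w / 2))) / (w * w)
     - ((w\<^sup>2 * (2 * w\<^sup>2) - s * (2 * (- s))) / (2 * w\<^sup>2 * (2 * w\<^sup>2)) * U + (G / w - s / (2 * w\<^sup>2) * U) * (s / (2 * w\<^sup>2)))"
  have dw: "((\<lambda>x. sqrt (cos x)) has_real_derivative - s * (inverse w / 2)) (at \<phi>)"
    unfolding s_def w_def using c by (auto intro!: derivative_eq_intros)
  have "((\<lambda>x. legG K x / sqrt (cos x)) has_real_derivative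
      ((- (K\<^sup>2 - 1/4) * w\<^sup>2 * (U / w)) * w - G * (- s * (inverse w / 2))) / (w * w)) (at \<phi>)"
    using w(1) by (intro DERIV_cong[OF DERIV_divide[OF legG_deriv dw]])
      (simp_all add: F UG(2)[symmetric] w(2)[symmetric] w_def[symmetric])
  moreover have "((\<lambda>x. sin x / (2 * cos x) * legU K x) has_real_derivative
     ((w\<^sup>2 * (2 * w\<^sup>2) - s * (2 * (- s))) / (2 * w\<^sup>2 * (2 * w\<^sup>2)) * U + (G / w - s / (2 * w\<^sup>2) * U) * (s / (2 * w\<^sup>2)))) (at \<phi>)"
    unfolding V[symmetric] unfolding w(2)[symmetric] s_def UG using c
    by (intro DERIV_cong[OF DERIV_mult[OF DERIV_divide[OF DERIV_sin DERIV_cmult[OF DERIV_cos]] legU_deriv]]) simp_all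
  ultimately have "(legV K has_real_derivative D) (at \<phi>)"
    unfolding legV_def[abs_def] D_def by (rule DERIV_diff)
  moreover have "D = - (K\<^sup>2 + 1 / (4 * (cos \<phi>)\<^sup>2)) * U"
  proof -
    have s2: "s * s = 1 - w ^ 4" using sin_squared_eq[of \<phi>] by (simp add: s_def w(2) power2_eq_square power4_eq_xxxx)
    have "D = - (K\<^sup>2 - 1/4) * U - U / 2 - (s * s) * U / (4 * w ^ 4)"
      unfolding D_def using w(1) by (simp add: field_simps power2_eq_square power4_eq_xxxx)
    also have "\<dots> = - (K\<^sup>2 + 1 / (4 * (cos \<phi>)\<^sup>2)) * U"
      unfolding s2 w(2) using w(1) by (simp add: field_simps power2_eq_square power4_eq_xxxx)
    finally show ?thesis .
  qed
  ultimately show ?thesis by (simp add: UG)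
qed

end

lemma leg_at_0 [simp]: "legF K 0 = 1" "legG K 0 = 0" "legU K 0 = 1" "legV K 0 = 0"
  by (simp_all add: legF_def legG_def legU_def legV_def eval_fps_at_0 legendre_fps_def legendre_coeff_def)

lemma DERIV_tan': "cos x \<noteq> 0 \<Longrightarrow> (tan has_real_derivative 1 / (cos x)\<^sup>2) (at x)" for x :: real
  using DERIV_tan[of x] by (simp add: inverse_eq_divide)

text \<open>Gronwall for the energy \<open>U\<^sup>2 + U'\<^sup>2 / K\<^sup>2\<close>, whose derivative only sees the perturbation \<open>1 / (4 cos\<^sup>2)\<close>.\<close>
lemma leg_energy:
  assumes K: "K > 0" and \<phi>: "0 \<le> \<phi>" "\<phi> < pi/2"
  shows "(legU K \<phi>)\<^sup>2 + (legV K \<phi>)\<^sup>2 / K\<^sup>2 \<le> exp (tan \<phi> / (4 * K))"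
proof -
  define W where "W = (\<lambda>x. ((legU K x)\<^sup>2 + (legV K x)\<^sup>2 / K\<^sup>2) * exp (- (tan x / (4 * K))))"
  have "W \<phi> \<le> W 0"
  proof (rule DERIV_nonpos_imp_nonincreasing[OF \<phi>(1)])
    fix x assume x: "0 \<le> x" "x \<le> \<phi>"
    then have x': "-(pi/2) < x" "x < pi/2" using \<phi> by auto
    note c = cos_pos_sin_lt_1[OF x']
    define U V E where UV: "U = legU K x" "V = legV K x" "E = exp (- (tan x / (4 * K)))"
    define c where "c = cos x"
    have c0: "c > 0" using c by (simp add: c_def)
    define y where "y = (2 * U * V + 2 * V * (- (K\<^sup>2 + 1 / (4 * c\<^sup>2)) * U) / K\<^sup>2) * E + (- (1 / c\<^sup>2 / (4 * K)) * E) * (U\<^sup>2 + V\<^sup>2 / K\<^sup>2)"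
    have dU: "((\<lambda>x. (legU K x)\<^sup>2) has_real_derivative 2 * U * V) (at x)"
      unfolding UV by (rule DERIV_cong[OF DERIV_power[OF legU_deriv[OF x']]]) simp
    have dV: "((\<lambda>x. (legV K x)\<^sup>2 / K\<^sup>2) has_real_derivative 2 * V * (- (K\<^sup>2 + 1 / (4 * c\<^sup>2)) * U) / K\<^sup>2) (at x)"
      unfolding UV c_def by (rule DERIV_cong[OF DERIV_cdivide[OF DERIV_power[OF legV_deriv[OF x']]]]) simp
    have dE: "((\<lambda>x. exp (- (tan x / (4 * K)))) has_real_derivative - (1 / c\<^sup>2 / (4 * K)) * E) (at x)"
      unfolding UV c_def using c(1) K by (auto intro!: derivative_eq_intros DERIV_tan' simp: divide_simps)
    have "(W has_real_derivative y) (at x)"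
      unfolding W_def y_def by (rule DERIV_cong[OF DERIV_mult[OF DERIV_add[OF dU dV] dE]]) (simp add: UV)
    moreover have "y \<le> 0"
    proof -
      \<comment> \<open>The principal parts of the two energy terms cancel. The cross term left by 1
        / (4 cos^2) and the derivative of the exponential weight combine to a perfect
        square.\<close>
      have "y = - (E / (4 * c\<^sup>2 * K ^ 3)) * (K * U + V)\<^sup>2"
        unfolding y_def using K c0 by (simp add: field_simps power2_eq_square power3_eq_cube)
      also have "\<dots> \<le> 0" using K by (simp add: UV)
      finally show ?thesis .
    qed
    ultimately show "\<exists>y. (W has_real_derivative y) (at x) \<and> y \<le> 0" by blast
  qed
  then have "((legU K \<phi>)\<^sup>2 + (legV K \<phi>)\<^sup>2 / K\<^sup>2) * exp (- (tan \<phi> / (4 * K))) \<le> 1"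
    by (simp add: W_def)
  then show ?thesis by (simp add: exp_minus field_simps)
qed

text \<open>Up to \<open>arctan K\<close> the exponent tan \<phi> / (4 K) is at most 1/4, so the
  energy stays below exp(1/4) \<le> 2, uniformly in K.\<close>

lemma leg_bounds_initial:
  assumes K: "K \<ge> 1" and \<phi>: "0 \<le> \<phi>" "\<phi> \<le> arctan K"
  shows "(legU K \<phi>)\<^sup>2 + (legV K \<phi>)\<^sup>2 / K\<^sup>2 \<le> 2" "(legU K \<phi>)\<^sup>2 \<le> 2" "\<bar>legU K \<phi>\<bar> \<le> 2" "\<bar>legV K \<phi>\<bar> \<le> 2 * K"
proof -
  have lt: "\<phi> < pi/2" using \<phi> arctan_ubound[of K] by linarith
  have "tan \<phi> \<le> tan (arctan K)" using \<phi> arctan_ubound[of K] by (intro tan_mono_le) auto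
  also have "\<dots> = K" by (rule tan_arctan)
  finally have "tan \<phi> \<le> K" .
  then have "tan \<phi> / (4 * K) \<le> 1/4" using K by (simp add: field_simps)
  moreover have "exp (1/4 :: real) \<le> 2"
  proof -
    have "exp (1/4 :: real) \<le> 1 + 1/4 + (1/4)\<^sup>2" by (rule exp_bound) auto
    then show ?thesis by (simp add: power2_eq_square)
  qed
  ultimately show E: "(legU K \<phi>)\<^sup>2 + (legV K \<phi>)\<^sup>2 / K\<^sup>2 \<le> 2"
    using leg_energy[of K \<phi>] K \<phi>(1) lt by (smt (verit) exp_le_cancel_iff)
  then show U: "(legU K \<phi>)\<^sup>2 \<le> 2" by (smt (verit) divide_nonneg_nonneg zero_le_power2)
  then show "\<bar>legU K \<phi>\<bar> \<le> 2" by (intro abs_le_square_iff[THEN iffD2, of _ "2::real", simplified]) simp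
  have "(legV K \<phi>)\<^sup>2 \<le> 2 * K\<^sup>2"
    using E K zero_le_power2[of "legU K \<phi>"] by (simp add: field_simps) (smt (verit) mult_nonneg_nonneg zero_le_power2)
  then have "(legV K \<phi>)\<^sup>2 \<le> (2 * K)\<^sup>2" by (simp add: power_mult_distrib) (smt (verit) zero_le_power2)
  then show "\<bar>legV K \<phi>\<bar> \<le> 2 * K" using K abs_le_square_iff[of "legV K \<phi>" "2 * K"] by simp
qed

text \<open>Near \<open>\<pi>/2\<close> the second energy \<open>G\<^sup>2 + \<lambda> cos\<^sup>2 F\<^sup>2\<close> decreases, which controls \<open>F' = G / cos\<close>.\<close>
lemma legU_bound_tail:
  assumes K: "K \<ge> 1" and \<phi>: "arctan K \<le> \<phi>" "\<phi> < pi/2"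
  shows "\<bar>legU K \<phi>\<bar> \<le> 22"
proof -
  define a where "a = arctan K"
  define l where "l = K\<^sup>2 - 1/4"
  have "1 \<le> K\<^sup>2" using K by simp
  then have lam: "l > 0" "l \<le> K\<^sup>2" by (simp_all add: l_def)
  have a: "0 \<le> a" "a < pi/2" using K arctan_ubound[of K] by (simp_all add: a_def)
  have ca: "cos a = 1 / sqrt (1 + K\<^sup>2)" and sa: "sin a = K / sqrt (1 + K\<^sup>2)"
    by (simp_all add: a_def cos_arctan sin_arctan)
  have "1 + K\<^sup>2 \<le> (2 * K)\<^sup>2" unfolding power_mult_distrib power2_eq_square[of 2] using \<open>1 \<le> K\<^sup>2\<close> by linarith
  then have sq: "K \<le> sqrt (1 + K\<^sup>2)" "sqrt (1 + K\<^sup>2) \<le> 2 * K"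
    using K by (auto intro!: real_le_rsqrt intro: real_le_lsqrt)
  have ca': "0 < cos a" "cos a \<le> 1 / K" "1 / (2 * K) \<le> cos a" "1/2 \<le> sin a"
  proof -
    define R where "R = sqrt (1 + K\<^sup>2)"
    have "0 < R" "K \<le> R" "R \<le> 2 * K" using sq K by (simp_all add: R_def add_pos_nonneg)
    then show "0 < cos a" "cos a \<le> 1 / K" "1 / (2 * K) \<le> cos a" "1/2 \<le> sin a"
      unfolding ca sa R_def[symmetric] using K by (simp_all add: field_simps)
  qed
  have cmono: "cos x \<le> cos a" "sin a \<le> sin x" "cos x > 0" if "a \<le> x" "x < pi/2" for x
    using that a cos_pos_sin_lt_1[of x] by (auto intro!: cos_monotone_0_pi_le sin_monotone_2pi_le)
  note init = leg_bounds_initial[OF K a(1), unfolded a_def, OF order_refl, folded a_def]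
  define E where "E = (\<lambda>x. (legG K x)\<^sup>2 + l * (cos x)\<^sup>2 * (legF K x)\<^sup>2)"
  have Emono: "E x \<le> E a" if x: "a \<le> x" "x < pi/2" for x
  proof (rule DERIV_nonpos_imp_nonincreasing[OF x(1)])
    fix t assume t: "a \<le> t" "t \<le> x"
    then have t': "-(pi/2) < t" "t < pi/2" using a x by auto
    have ct: "cos t > 0" "sin t > 0" using cmono[of t] t x ca'(4) by auto
    have dG: "((\<lambda>x. (legG K x)\<^sup>2) has_real_derivative 2 * legG K t * (- l * cos t * legF K t)) (at t)"
      unfolding l_def by (rule DERIV_cong[OF DERIV_power[OF legG_deriv[OF t']]]) simp
    have dc: "((\<lambda>x. l * (cos x)\<^sup>2) has_real_derivative l * (- 2 * cos t * sin t)) (at t)"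
      by (rule DERIV_cong[OF DERIV_cmult[OF DERIV_power[OF DERIV_cos]]]) simp
    have dF: "((\<lambda>x. (legF K x)\<^sup>2) has_real_derivative 2 * legF K t * (legG K t / cos t)) (at t)"
      by (rule DERIV_cong[OF DERIV_power[OF legF_deriv[OF t']]]) simp
    have "(E has_real_derivative - 2 * l * cos t * sin t * (legF K t)\<^sup>2) (at t)"
      unfolding E_def using ct
      by (intro DERIV_cong[OF DERIV_add[OF dG DERIV_mult[OF dc dF]]]) (simp add: field_simps power2_eq_square)
    moreover have "- 2 * l * cos t * sin t * (legF K t)\<^sup>2 \<le> 0" using lam ct by simp
    ultimately show "\<exists>y. (E has_real_derivative y) (at t) \<and> y \<le> 0" by blast
  qed
  define w where "w = sqrt (cos a)"
  have w: "w > 0" "w\<^sup>2 = cos a" "w * w = cos a" using ca' by (simp_all add: w_def)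
  have Fa: "legF K a = legU K a / w" using w(1) by (simp add: legU_def w_def)
  have Ga: "legG K a = w * legV K a + sin a / (2 * w) * legU K a"
  proof -
    have "legV K a = legG K a / w - sin a / (2 * (w * w)) * legU K a" unfolding w(3) by (simp add: legV_def w_def)
    then show ?thesis using w(1) by (simp add: field_simps)
  qed
  \<comment> \<open>At the cut cos a lies between 1/(2K) and 1/K, so the bounds for U and V give G^2
    \<le> 10 K and a second term of at most 2 K.\<close>
  have Ea: "E a \<le> (5 * sqrt K)\<^sup>2"
  proof -
    have "\<bar>legG K a\<bar> \<le> w * \<bar>legV K a\<bar> + 1 / (2 * w) * \<bar>legU K a\<bar>"
    proof -
      have "\<bar>legG K a\<bar> \<le> w * \<bar>legV K a\<bar> + \<bar>sin a\<bar> / (2 * w) * \<bar>legU K a\<bar>"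
        unfolding Ga using w(1) abs_triangle_ineq[of "w * legV K a" "sin a / (2 * w) * legU K a"] by (simp add: abs_mult)
      also have "\<bar>sin a\<bar> / (2 * w) * \<bar>legU K a\<bar> \<le> 1 / (2 * w) * \<bar>legU K a\<bar>"
        using w(1) by (intro mult_right_mono divide_right_mono) auto
      finally show ?thesis by simp
    qed
    also have "\<dots> \<le> w * (2 * K) + 1 / (2 * w) * 2"
      using w(1) init by (intro add_mono mult_left_mono) auto
    also have "\<dots> = 2 * K * w + 1 / w" by simp
    finally have "(legG K a)\<^sup>2 \<le> (2 * K * w + 1 / w)\<^sup>2"
      using w(1) K by (intro abs_le_square_iff[THEN iffD1]) simp
    also have "\<dots> = 4 * K * (K * cos a) + 4 * K + 1 / cos a"
      using w(1) unfolding w(2)[symmetric] by (simp add: power2_eq_square field_simps)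
    also have "\<dots> \<le> 4 * K * 1 + 4 * K + 2 * K"
      using ca' K by (intro add_mono mult_left_mono order_refl) (auto simp: field_simps)
    finally have 1: "(legG K a)\<^sup>2 \<le> 10 * K" by simp
    have "l * (cos a)\<^sup>2 * (legF K a)\<^sup>2 = l * cos a * (legU K a)\<^sup>2"
      unfolding Fa w(2)[symmetric] using w(1) by (simp add: power2_eq_square field_simps)
    also have "\<dots> \<le> K\<^sup>2 * (1 / K) * 2"
      using lam ca' init K by (intro mult_mono) auto
    also have "\<dots> = 2 * K" using K by (simp add: power2_eq_square)
    finally show ?thesis using 1 K by (simp add: E_def power_mult_distrib)
  qed
  have Gle: "\<bar>legG K x\<bar> \<le> 5 * sqrt K" if "a \<le> x" "x < pi/2" for x
  proof -
    have "(legG K x)\<^sup>2 \<le> E x" using lam by (simp add: E_def)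
    also have "\<dots> \<le> (5 * sqrt K)\<^sup>2" using Emono[OF that] Ea by linarith
    finally show ?thesis using K abs_le_square_iff[of "legG K x" "5 * sqrt K"] by simp
  qed
  \<comment> \<open>A majorant for the growth of F: beyond the cut sqrt(K cos) \<le> 1 and sin \<ge>
    1/2, hence |F'| \<le> 5 sqrt K / cos \<le> B'. Since sqrt(cos) * B = 20 is constant, U stays
    below 2 + 20.\<close>
  define B where "B = (\<lambda>x. 20 / sqrt (cos x))"
  have dB: "(B has_real_derivative 10 * sin x / (cos x * sqrt (cos x))) (at x)"
    and Bge: "\<bar>legG K x / cos x\<bar> \<le> 10 * sin x / (cos x * sqrt (cos x))" if x: "a \<le> x" "x < pi/2" for x
  proof -
    note cm = cmono[OF x]
    show "(B has_real_derivative 10 * sin x / (cos x * sqrt (cos x))) (at x)"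
      unfolding B_def using cm by (auto intro!: derivative_eq_intros simp: field_simps)
    have sK: "sqrt K * sqrt (cos x) \<le> 1"
    proof -
      have "K * cos x \<le> 1" using cm(1) ca'(2) K by (simp add: field_simps) (smt (verit) mult_left_mono)
      then show ?thesis by (simp flip: real_sqrt_mult)
    qed
    have "\<bar>legG K x / cos x\<bar> \<le> 5 * sqrt K / cos x"
      using Gle[OF x] cm by (simp add: abs_divide divide_right_mono)
    also have "\<dots> = 5 * (sqrt K * sqrt (cos x)) / (cos x * sqrt (cos x))" using cm by simp
    also have "\<dots> \<le> 10 * sin x / (cos x * sqrt (cos x))"
      using sK cm ca' by (intro divide_right_mono) auto
    finally show "\<bar>legG K x / cos x\<bar> \<le> 10 * sin x / (cos x * sqrt (cos x))" .
  qed
  have \<phi>': "a \<le> \<phi>" using \<phi> by (simp add: a_def)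
  have "legF K \<phi> - B \<phi> \<le> legF K a - B a"
  proof (rule DERIV_nonpos_imp_nonincreasing[OF \<phi>'])
    fix x assume "a \<le> x" "x \<le> \<phi>"
    then have x: "a \<le> x" "x < pi/2" "-(pi/2) < x" using \<phi> a by auto
    show "\<exists>y. ((\<lambda>x. legF K x - B x) has_real_derivative y) (at x) \<and> y \<le> 0"
    proof (intro exI conjI)
      show "((\<lambda>x. legF K x - B x) has_real_derivative legG K x / cos x - 10 * sin x / (cos x * sqrt (cos x))) (at x)"
        by (rule DERIV_diff[OF legF_deriv[OF x(3,2)] dB[OF x(1,2)]])
      show "legG K x / cos x - 10 * sin x / (cos x * sqrt (cos x)) \<le> 0" using Bge[OF x(1,2)] by linarith
    qed
  qed
  moreover have "legF K a + B a \<le> legF K \<phi> + B \<phi>"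
  proof (rule DERIV_nonneg_imp_nondecreasing[OF \<phi>'])
    fix x assume "a \<le> x" "x \<le> \<phi>"
    then have x: "a \<le> x" "x < pi/2" "-(pi/2) < x" using \<phi> a by auto
    show "\<exists>y. ((\<lambda>x. legF K x + B x) has_real_derivative y) (at x) \<and> y \<ge> 0"
    proof (intro exI conjI)
      show "((\<lambda>x. legF K x + B x) has_real_derivative legG K x / cos x + 10 * sin x / (cos x * sqrt (cos x))) (at x)"
        by (rule DERIV_add[OF legF_deriv[OF x(3,2)] dB[OF x(1,2)]])
      show "0 \<le> legG K x / cos x + 10 * sin x / (cos x * sqrt (cos x))" using Bge[OF x(1,2)] by linarith
    qed
  qed
  moreover have "B a \<ge> 0" using ca' by (simp add: B_def)
  ultimately have absF: "\<bar>legF K \<phi>\<bar> \<le> \<bar>legF K a\<bar> + B \<phi>" by linarith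
  note cm = cmono[OF \<phi>' \<phi>(2)]
  have "\<bar>legU K \<phi>\<bar> = sqrt (cos \<phi>) * \<bar>legF K \<phi>\<bar>" using cm by (simp add: legU_def abs_mult)
  also have "\<dots> \<le> sqrt (cos \<phi>) * (\<bar>legF K a\<bar> + B \<phi>)"
    using absF cm by (intro mult_left_mono) auto
  also have "\<dots> = sqrt (cos \<phi>) * \<bar>legF K a\<bar> + 20" using cm by (simp add: B_def algebra_simps)
  also have "sqrt (cos \<phi>) * \<bar>legF K a\<bar> \<le> w * \<bar>legF K a\<bar>"
    using cm by (intro mult_right_mono) (auto simp: w_def)
  also have "w * \<bar>legF K a\<bar> = \<bar>legU K a\<bar>" using w(1) by (simp add: Fa)
  also have "\<dots> \<le> 2" by (rule init)
  finally show ?thesis by simp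
qed

section \<open>Oscillatory integrals\<close>

text \<open>Integration by parts: d * cis \<theta> is - i times the derivative of cis \<theta>. The
  increment of Q dominates the variation of p, so a monotone p can serve as its own Q, and other
  choices remain possible when p is not monotone.\<close>

lemma oscillatory_integral_le:
  fixes p p' Q Q' \<theta> d :: "real \<Rightarrow> real"
  assumes ab: "a \<le> b"
    and p: "\<And>x. x \<in> {a..b} \<Longrightarrow> (p has_real_derivative p' x) (at x)"
    and Q: "\<And>x. x \<in> {a..b} \<Longrightarrow> (Q has_real_derivative Q' x) (at x)"
    and th: "\<And>x. x \<in> {a..b} \<Longrightarrow> (\<theta> has_real_derivative d x) (at x)"
    and le: "\<And>x. x \<in> {a..b} \<Longrightarrow> \<bar>p' x\<bar> \<le> Q' x"
    and cont: "continuous_on {a..b} p'"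
  shows "cmod (integral {a..b} (\<lambda>x. of_real (p x * d x) * cis (\<theta> x))) \<le> \<bar>p a\<bar> + \<bar>p b\<bar> + (Q b - Q a)"
proof -
  have "continuous_on {a..b} \<theta>"
    by (intro continuous_at_imp_continuous_on ballI DERIV_isCont[OF th])
  define u where "u = (\<lambda>x. of_real (p' x) * cis (\<theta> x))"
  have cont': "continuous_on {a..b} u"
    unfolding u_def by (intro continuous_intros cont \<open>continuous_on {a..b} \<theta>\<close>)
  have dcis: "((\<lambda>x. cis (\<theta> x)) has_vector_derivative of_real (d x) * (\<i> * cis (\<theta> x))) (at x within {a..b})" if "x \<in> {a..b}" for x
  proof -
    have "(cis has_vector_derivative \<i> * cis (\<theta> x)) (at (\<theta> x) within UNIV)"
    proof -
      have "((\<lambda>t. exp (\<i> * of_real t)) has_vector_derivative \<i> * exp (\<i> * of_real (\<theta> x))) (at (\<theta> x))"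
        by (rule has_vector_derivative_real_field) (auto intro!: derivative_eq_intros)
      then show ?thesis by (simp add: cis_conv_exp[abs_def])
    qed
    then have "(cis \<circ> \<theta> has_vector_derivative d x *\<^sub>R (\<i> * cis (\<theta> x))) (at x within {a..b})"
      using th[OF that]
      by (intro vector_diff_chain_within) (auto simp: has_real_derivative_iff_has_vector_derivative
          intro: has_vector_derivative_at_within has_vector_derivative_within_subset)
    then show ?thesis by (simp add: o_def scaleR_conv_of_real)
  qed
  have I1: "((\<lambda>x. u x + of_real (p x) * (of_real (d x) * (\<i> * cis (\<theta> x)))) has_integral
      of_real (p b) * cis (\<theta> b) - of_real (p a) * cis (\<theta> a)) {a..b}"
  proof (rule fundamental_theorem_of_calculus[OF ab])
    fix x assume x: "x \<in> {a..b}"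
    have "((\<lambda>x. complex_of_real (p x)) has_vector_derivative of_real (p' x)) (at x within {a..b})"
      using p[OF x] by (intro has_vector_derivative_of_real)
         (simp add: has_real_derivative_iff_has_vector_derivative has_vector_derivative_at_within)
    from has_vector_derivative_mult[OF this dcis[OF x]]
    show "((\<lambda>x. of_real (p x) * cis (\<theta> x)) has_vector_derivative
        u x + of_real (p x) * (of_real (d x) * (\<i> * cis (\<theta> x)))) (at x within {a..b})"
      by (simp add: u_def add.commute)
  qed
  have I2: "(u has_integral integral {a..b} u) {a..b}"
    by (intro integrable_integral integrable_continuous_real cont')
  have "((\<lambda>x. of_real (p x) * (of_real (d x) * (\<i> * cis (\<theta> x)))) has_integral
      of_real (p b) * cis (\<theta> b) - of_real (p a) * cis (\<theta> a) - integral {a..b} u) {a..b}"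
    using has_integral_diff[OF I1 I2] by simp
  then have "((\<lambda>x. - \<i> * (of_real (p x) * (of_real (d x) * (\<i> * cis (\<theta> x))))) has_integral
      - \<i> * (of_real (p b) * cis (\<theta> b) - of_real (p a) * cis (\<theta> a) - integral {a..b} u)) {a..b}"
    by (rule has_integral_mult_right)
  then have eq: "integral {a..b} (\<lambda>x. of_real (p x * d x) * cis (\<theta> x)) =
     - \<i> * (of_real (p b) * cis (\<theta> b) - of_real (p a) * cis (\<theta> a) - integral {a..b} u)"
    by (intro integral_unique) (simp add: mult_ac)
  have "cmod (integral {a..b} u) \<le> integral {a..b} Q'"
  proof (rule integral_norm_bound_integral)
    show "u integrable_on {a..b}" by (intro integrable_continuous_real cont')
    have "(Q' has_integral Q b - Q a) {a..b}"
      using Q by (intro fundamental_theorem_of_calculus ab)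
        (auto simp: has_real_derivative_iff_has_vector_derivative intro: has_vector_derivative_at_within)
    then show "Q' integrable_on {a..b}" by blast
  qed (use le in \<open>auto simp: u_def norm_mult\<close>)
  also have "integral {a..b} Q' = Q b - Q a"
    using Q by (intro integral_unique fundamental_theorem_of_calculus ab)
        (auto simp: has_real_derivative_iff_has_vector_derivative intro: has_vector_derivative_at_within)
  finally have I: "cmod (integral {a..b} u) \<le> Q b - Q a" .
  have "cmod (integral {a..b} (\<lambda>x. of_real (p x * d x) * cis (\<theta> x)))
      = cmod (of_real (p b) * cis (\<theta> b) - of_real (p a) * cis (\<theta> a) - integral {a..b} u)"
    unfolding eq by (simp add: norm_mult)
  also have "\<dots> \<le> cmod (of_real (p b) * cis (\<theta> b)) + cmod (of_real (p a) * cis (\<theta> a)) + cmod (integral {a..b} u)"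
    by (intro order_trans[OF norm_triangle_ineq4] add_mono norm_triangle_ineq4 order_refl)
  finally show ?thesis using I by (simp add: norm_mult)
qed

section \<open>Amplitude and phase on (0, pi/2)\<close>

definition amp :: "real \<Rightarrow> real" where
  "amp x = 1 / sqrt (sin x * cos x)"

text \<open>The logarithm carries the factor (cot x)^(2 i r). Both signs of the linear term are
  covered by passing K or - K.\<close>

definition phase :: "real \<Rightarrow> real \<Rightarrow> real \<Rightarrow> real" where
  "phase K r x = K * x + 2 * r * ln (cos x / sin x)"

definition osc :: "real \<Rightarrow> real \<Rightarrow> real \<Rightarrow> real \<Rightarrow> complex" where
  "osc K r a b = integral {a..b} (\<lambda>x. of_real (amp x) * cis (phase K r x))"

lemma sin_cos_pos: "0 < x \<Longrightarrow> x < pi/2 \<Longrightarrow> 0 < sin x \<and> 0 < cos x" for x :: real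
  by (auto intro: sin_gt_zero2 cos_gt_zero)

lemma amp_pos: "0 < x \<Longrightarrow> x < pi/2 \<Longrightarrow> amp x > 0"
  using sin_cos_pos[of x] by (simp add: amp_def)

lemma amp_square: "0 < x \<Longrightarrow> x < pi/2 \<Longrightarrow> (amp x)\<^sup>2 = 1 / (sin x * cos x)"
  using sin_cos_pos[of x] by (simp add: amp_def power_divide)

text \<open>The derivative of \<open>amp\<close>, in a form that exhibits its sign change at
  pi/4.\<close>

definition amp_slope :: "real \<Rightarrow> real" where
  "amp_slope x = - (amp x ^ 3 * cos (2 * x) / 2)"

lemma amp_deriv:
  assumes "0 < x" "x < pi/2"
  shows "(amp has_real_derivative amp_slope x) (at x)"
proof -
  note sc = sin_cos_pos[OF assms]
  define w where "w = sqrt (sin x * cos x)"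
  have w: "w > 0" "w * w = sin x * cos x" using sc by (simp_all add: w_def)
  have "(amp has_real_derivative - ((cos x * cos x - sin x * sin x) * (inverse w / 2)) / (w * w)) (at x)"
    unfolding amp_def[abs_def] w_def using sc
    by (auto intro!: derivative_eq_intros simp: mult_less_0_iff)
  moreover have "- ((cos x * cos x - sin x * sin x) * (inverse w / 2)) / (w * w) = amp_slope x"
    using w(1) by (simp add: amp_slope_def amp_def cos_double power2_eq_square power3_eq_cube divide_simps flip: w_def)
  ultimately show ?thesis by (rule DERIV_cong)
qed

lemma phase_deriv:
  assumes "0 < x" "x < pi/2"
  shows "(phase K r has_real_derivative K - 2 * r * (amp x)\<^sup>2) (at x)"
proof -
  note sc = sin_cos_pos[OF assms]
  have "((\<lambda>x. ln (cos x / sin x)) has_real_derivative - (1 / (sin x * cos x))) (at x)"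
  proof -
    have "((\<lambda>x. ln (cos x / sin x)) has_real_derivative
       1 / (cos x / sin x) * ((- sin x * sin x - cos x * cos x) / (sin x * sin x))) (at x)"
      using sc by (auto intro!: derivative_eq_intros)
    moreover have n: "- sin x * sin x - cos x * cos x = - 1"
      using sin_cos_squared_add[of x] by (simp add: power2_eq_square)
    moreover have "1 / (cos x / sin x) * (- 1 / (sin x * sin x)) = - (1 / (sin x * cos x))"
      using sc by (simp add: field_simps)
    ultimately show ?thesis unfolding n by simp
  qed
  from DERIV_add[OF DERIV_cmult_Id[of K] DERIV_cmult[OF this, of "2 * r"]]
  show ?thesis unfolding phase_def[abs_def] amp_square[OF assms] by simp
qed

lemma continuous_on_osc:
  assumes "0 < a" "b < pi/2"
  shows "continuous_on {a..b} amp" "continuous_on {a..b} (\<lambda>x. complex_of_real (amp x) * cis (phase K r x))"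
proof -
  show c: "continuous_on {a..b} amp"
    using assms by (intro continuous_at_imp_continuous_on ballI DERIV_isCont[OF amp_deriv]) auto
  have "continuous_on {a..b} (phase K r)"
    using assms by (intro continuous_at_imp_continuous_on ballI DERIV_isCont[OF phase_deriv]) auto
  then show "continuous_on {a..b} (\<lambda>x. complex_of_real (amp x) * cis (phase K r x))"
    by (intro continuous_intros c)
qed

lemma osc_combine:
  assumes "0 < a" "a \<le> c" "c \<le> b" "b < pi/2"
  shows "osc K r a b = osc K r a c + osc K r c b"
  unfolding osc_def using assms
  by (intro sym[OF Henstock_Kurzweil_Integration.integral_combine] integrable_continuous_real continuous_on_osc) auto

lemma osc_le_amp_integral:
  assumes "0 < a" "b < pi/2"
  shows "cmod (osc K r a b) \<le> integral {a..b} amp"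
  unfolding osc_def using assms
  by (intro integral_norm_bound_integral integrable_continuous_real continuous_on_osc)
     (auto simp: norm_mult intro!: less_imp_le[OF amp_pos])

text \<open>To the right of pi/4 one has sin^(3/2) \<ge> 1/2, so the amplitude is at most 2 sin /
  sqrt(cos), which has the primitive - 4 sqrt(cos).\<close>

lemma amp_integral_le:
  assumes "pi/4 \<le> a" "a \<le> b" "b < pi/2"
  shows "integral {a..b} amp \<le> 4 * (sqrt (cos a) - sqrt (cos b))"
proof -
  have a0: "0 < a" using assms pi_gt_zero by linarith
  define f where "f = (\<lambda>x. 2 * sin x / sqrt (cos x))"
  have "(f has_integral (- 4 * sqrt (cos b)) - (- 4 * sqrt (cos a))) {a..b}"
  proof (rule fundamental_theorem_of_calculus[OF assms(2)])
    fix x assume "x \<in> {a..b}"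
    then have "cos x > 0" using sin_cos_pos[of x] assms a0 by auto
    then have "((\<lambda>x. - 4 * sqrt (cos x)) has_real_derivative f x) (at x within {a..b})"
      unfolding f_def by (auto intro!: derivative_eq_intros simp: divide_simps)
    then show "((\<lambda>x. - 4 * sqrt (cos x)) has_vector_derivative f x) (at x within {a..b})"
      by (simp add: has_real_derivative_iff_has_vector_derivative)
  qed
  moreover have "integral {a..b} amp \<le> integral {a..b} f"
  proof (rule integral_le)
    show "amp integrable_on {a..b}" using assms a0 by (intro integrable_continuous_real continuous_on_osc) auto
    show "f integrable_on {a..b}" using calculation by blast
    fix x assume x: "x \<in> {a..b}"
    then have sc: "0 < sin x \<and> 0 < cos x" using sin_cos_pos[of x] assms a0 by auto
    have "sin (pi/4) \<le> sin x" using x assms by (intro sin_monotone_2pi_le) auto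
    have "1/2 \<le> sin x * sqrt (sin x)"
    proof -
      have "sqrt 2 / 2 \<le> sin x" using \<open>sin (pi/4) \<le> sin x\<close> by (simp add: sin_45)
      moreover have "(7/10 :: real) \<le> sqrt 2 / 2" using real_le_rsqrt[of "7/5" 2] by (simp add: power2_eq_square)
      ultimately have s3: "7/10 \<le> sin x" by linarith
      then have "8/10 \<le> sqrt (sin x)" by (intro real_le_rsqrt) (simp add: power2_eq_square)
      then have "7/10 * (8/10) \<le> sin x * sqrt (sin x)" using s3 by (intro mult_mono) auto
      then show ?thesis by simp
    qed
    then have "1 / (sqrt (sin x) * sqrt (cos x)) \<le> 2 * sin x / sqrt (cos x)"
      using sc by (simp add: field_simps)
    then show "amp x \<le> f x" by (simp add: amp_def f_def real_sqrt_mult)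
  qed
  ultimately show ?thesis by (simp add: integral_unique algebra_simps)
qed

lemma amp_deriv_nonneg:
  assumes "pi/4 \<le> x" "x < pi/2"
  shows "0 \<le> amp_slope x"
proof -
  have "cos (2 * x) \<le> cos (pi/2)" using assms by (intro cos_monotone_0_pi_le) auto
  then have "cos (2 * x) \<le> 0" by simp
  moreover have "amp x > 0" using assms pi_gt_zero by (intro amp_pos) linarith+
  ultimately show ?thesis by (simp add: amp_slope_def mult_nonneg_nonpos)
qed

lemma amp_mono:
  assumes "pi/4 \<le> x" "x \<le> y" "y < pi/2"
  shows "amp x \<le> amp y"
proof (rule DERIV_nonneg_imp_nondecreasing[OF assms(2)])
  fix t assume t: "x \<le> t" "t \<le> y"
  then have "0 < t" using assms pi_gt_zero by linarith
  then show "\<exists>d. (amp has_real_derivative d) (at t) \<and> 0 \<le> d"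
    using amp_deriv[of t] amp_deriv_nonneg[of t] t assms by (intro exI[of _ "amp_slope t"]) auto
qed

lemma amp_ge_sqrt2:
  assumes "0 < x" "x < pi/2"
  shows "2 \<le> (amp x)\<^sup>2" "sqrt 2 \<le> amp x"
proof -
  note sc = sin_cos_pos[OF assms]
  have "0 \<le> (sin x - cos x)\<^sup>2" by simp
  also have "\<dots> = 1 - 2 * (sin x * cos x)" using sin_cos_squared_add[of x] by (simp add: power2_diff)
  finally have "sin x * cos x \<le> 1/2" by simp
  moreover have "0 < sin x * cos x" using sc by simp
  ultimately show 1: "2 \<le> (amp x)\<^sup>2" by (simp add: amp_square[OF assms] field_simps)
  then show "sqrt 2 \<le> amp x" using amp_pos[OF assms] by (intro real_le_lsqrt) auto
qed

text \<open>Since sin(2x) = 2 / q^2 for q = amp x, the slope is a function of q alone up to sign: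
  q'^2 = q^2 (q^4 - 4) / 4.\<close>

lemma cos_double_amp:
  assumes "0 < x" "x < pi/2"
  shows "(amp x) ^ 4 * (cos (2 * x))\<^sup>2 = (amp x) ^ 4 - 4"
proof -
  note sc = sin_cos_pos[OF assms]
  have "(amp x) ^ 4 = ((amp x)\<^sup>2)\<^sup>2" by simp
  also have "\<dots> = 1 / (sin x * cos x)\<^sup>2" unfolding amp_square[OF assms] by (simp add: power_divide)
  finally have a: "(amp x) ^ 4 = 1 / (sin x * cos x)\<^sup>2" .
  have "(cos (2 * x))\<^sup>2 = 1 - (sin (2 * x))\<^sup>2" by (simp add: cos_squared_eq)
  also have "\<dots> = 1 - 4 * (sin x * cos x)\<^sup>2" by (simp add: sin_double power_mult_distrib)
  finally show ?thesis unfolding a using sc by (simp add: field_simps)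
qed

text \<open>To the right of pi/4 the amplitude increases, hence so does p = q / h' wherever h' has
  no zero. Its variation is p b - p a, and a pointwise bound M for |p| controls boundary terms and
  variation together.\<close>

lemma osc_outer_le:
  assumes r: "r > 0" and K: "K \<ge> 0" and ab: "pi/4 \<le> a" "a \<le> b" "b < pi/2"
    and nz: "\<And>x. x \<in> {a..b} \<Longrightarrow> K - 2 * r * (amp x)\<^sup>2 \<noteq> 0"
    and le: "\<And>x. x \<in> {a..b} \<Longrightarrow> amp x / \<bar>K - 2 * r * (amp x)\<^sup>2\<bar> \<le> M"
  shows "cmod (osc K r a b) \<le> 4 * M"
proof -
  have a0: "0 < a" using ab pi_gt_zero by linarith
  have I: "0 < x" "x < pi/2" "pi/4 \<le> x" if "x \<in> {a..b}" for x using that a0 ab by auto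
  define d where "d = (\<lambda>x. K - 2 * r * (amp x)\<^sup>2)"
  define p where "p = (\<lambda>x. amp x / d x)"
  define p' where "p' = (\<lambda>x. (K + 2 * r * (amp x)\<^sup>2) / (d x)\<^sup>2 * amp_slope x)"
  have pd: "(p has_real_derivative p' x) (at x)" if x: "x \<in> {a..b}" for x
  proof -
    define y where "y = amp_slope x"
    have dy: "(amp has_real_derivative y) (at x)" unfolding y_def by (rule amp_deriv[OF I(1,2)[OF x]])
    have dd: "(d has_real_derivative - (2 * r * (2 * amp x * y))) (at x)"
      unfolding d_def by (rule DERIV_cong[OF DERIV_diff[OF DERIV_const DERIV_cmult[OF DERIV_power[OF dy]]]]) simp
    have "d x \<noteq> 0" using nz[OF x] by (simp add: d_def)
    then show ?thesis
      unfolding p_def p'_def y_def[symmetric]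
      by (intro DERIV_cong[OF DERIV_divide[OF dy dd]]) (simp_all add: d_def power2_eq_square field_simps)
  qed
  have p'0: "0 \<le> p' x" if x: "x \<in> {a..b}" for x
    unfolding p'_def using K r amp_deriv_nonneg[OF I(3,2)[OF x]] by (intro mult_nonneg_nonneg divide_nonneg_nonneg) auto
  have cp': "continuous_on {a..b} p'"
    unfolding p'_def d_def amp_slope_def using nz ab a0
    by (intro continuous_intros continuous_on_osc) auto
  have "cmod (integral {a..b} (\<lambda>x. of_real (p x * d x) * cis (phase K r x))) \<le> \<bar>p a\<bar> + \<bar>p b\<bar> + (p b - p a)"
    by (rule oscillatory_integral_le[OF ab(2) pd pd _ _ cp'])
       (use p'0 phase_deriv I in \<open>auto simp: d_def\<close>)
  also have "integral {a..b} (\<lambda>x. of_real (p x * d x) * cis (phase K r x)) = osc K r a b"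
    unfolding osc_def using nz by (intro integral_cong) (simp add: p_def d_def)
  also have "\<bar>p a\<bar> + \<bar>p b\<bar> + (p b - p a) \<le> 2 * \<bar>p a\<bar> + 2 * \<bar>p b\<bar>" by linarith
  also have "\<bar>p x\<bar> \<le> M" if "x \<in> {a..b}" for x
    using le[OF that] amp_pos[OF I(1,2)[OF that]] by (simp add: p_def d_def abs_divide)
  from this[of a] this[of b] have "2 * \<bar>p a\<bar> + 2 * \<bar>p b\<bar> \<le> 4 * M" using ab by auto
  finally show ?thesis .
qed

text \<open>Here |h'| = K + 2 r q^2 never vanishes, but q / h' turns around at 2 r q^2 = K. Its
  variation is therefore dominated by the integral of dq / (K + 2 r q^2), an arctangent divided by s
  = sqrt(2 r K), and arctan < 2. The arithmetic-geometric mean inequality bounds the boundary values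
  by 1 / s.\<close>

lemma osc_nonstationary_le:
  assumes r: "r > 0" and K: "K > 0" and ab: "pi/4 \<le> a" "a \<le> b" "b < pi/2"
  shows "cmod (osc (- K) r a b) \<le> 4 / sqrt (2 * r * K)"
proof -
  have a0: "0 < a" using ab pi_gt_zero by linarith
  have I: "0 < x" "x < pi/2" "pi/4 \<le> x" if "x \<in> {a..b}" for x using that a0 ab by auto
  define s where "s = sqrt (2 * r * K)"
  define c where "c = s / K"
  have s: "s > 0" "s * s = 2 * r * K" using r K by (simp_all add: s_def)
  have c: "c > 0" "c * c = 2 * r / K" "s * c = 2 * r" using s K by (simp_all add: c_def)
  define d where "d = (\<lambda>x. - K - 2 * r * (amp x)\<^sup>2)"
  have dpos: "d x < 0" for x
  proof -
    have "0 \<le> 2 * r * (amp x)\<^sup>2" using r by simp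
    then show ?thesis using K by (simp add: d_def)
  qed
  define p where "p = (\<lambda>x. amp x / d x)"
  define p' where "p' = (\<lambda>x. (2 * r * (amp x)\<^sup>2 - K) / (d x)\<^sup>2 * amp_slope x)"
  define Q where "Q = (\<lambda>x. arctan (c * amp x) / s)"
  define Q' where "Q' = (\<lambda>x. 1 / (K + 2 * r * (amp x)\<^sup>2) * amp_slope x)"
  have pd: "(p has_real_derivative p' x) (at x)" and Qd: "(Q has_real_derivative Q' x) (at x)" if x: "x \<in> {a..b}" for x
  proof -
    define y where "y = amp_slope x"
    have dy: "(amp has_real_derivative y) (at x)" unfolding y_def by (rule amp_deriv[OF I(1,2)[OF x]])
    have dd: "(d has_real_derivative - (2 * r * (2 * amp x * y))) (at x)"
      unfolding d_def by (rule DERIV_cong[OF DERIV_diff[OF DERIV_const DERIV_cmult[OF DERIV_power[OF dy]]]]) simp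
    show "(p has_real_derivative p' x) (at x)"
      unfolding p_def p'_def y_def[symmetric] using dpos[of x]
      by (intro DERIV_cong[OF DERIV_divide[OF dy dd]]) (simp_all add: d_def power2_eq_square field_simps)
    have "((\<lambda>x. arctan (c * amp x)) has_real_derivative inverse (1 + (c * amp x)\<^sup>2) * (c * y)) (at x)"
      by (rule DERIV_chain2[OF DERIV_arctan DERIV_cmult[OF dy]])
    from DERIV_cdivide[OF this, of s]
    have "(Q has_real_derivative inverse (1 + (c * amp x)\<^sup>2) * (c * y) / s) (at x)" unfolding Q_def .
    moreover have "inverse (1 + (c * amp x)\<^sup>2) * (c * y) / s = Q' x"
    proof -
      have "1 + (c * amp x)\<^sup>2 = (K + 2 * r * (amp x)\<^sup>2) / K"
        using K c(2) by (simp add: power2_eq_square field_simps)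
      moreover have "c / s = 1 / K" using s K by (simp add: c_def)
      moreover have "inverse (1 + (c * amp x)\<^sup>2) * (c * y) / s = inverse (1 + (c * amp x)\<^sup>2) * y * (c / s)" by simp
      ultimately have "inverse (1 + (c * amp x)\<^sup>2) * (c * y) / s = inverse ((K + 2 * r * (amp x)\<^sup>2) / K) * y * (1 / K)"
        by (simp only:)
      also have "\<dots> = Q' x" unfolding Q'_def y_def[symmetric] using K by simp
      finally show ?thesis .
    qed
    ultimately show "(Q has_real_derivative Q' x) (at x)" by simp
  qed
  have le: "\<bar>p' x\<bar> \<le> Q' x" if x: "x \<in> {a..b}" for x
  proof -
    define y where "y = amp_slope x"
    have y: "y \<ge> 0" unfolding y_def by (rule amp_deriv_nonneg[OF I(3,2)[OF x]])
    define e where "e = K + 2 * r * (amp x)\<^sup>2"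
    have e: "e > 0" "d x = - e" using dpos[of x] by (simp_all add: d_def e_def)
    have "0 \<le> 2 * r * (amp x)\<^sup>2" using r by simp
    then have "\<bar>2 * r * (amp x)\<^sup>2 - K\<bar> \<le> e" using K by (simp add: e_def abs_le_iff)
    then have "\<bar>2 * r * (amp x)\<^sup>2 - K\<bar> / (e * e) \<le> e / (e * e)" using e by (intro divide_right_mono) auto
    then have "\<bar>2 * r * (amp x)\<^sup>2 - K\<bar> / (e * e) * y \<le> 1 / e * y" using y e by (intro mult_right_mono) auto
    then show ?thesis unfolding p'_def Q'_def y_def[symmetric] e_def[symmetric] e(2) using y
      by (simp add: abs_mult power2_eq_square)
  qed
  have cp': "continuous_on {a..b} p'"
    unfolding p'_def d_def amp_slope_def using dpos ab a0
    by (intro continuous_intros continuous_on_osc) (auto simp: d_def less_imp_neq)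
  have "cmod (integral {a..b} (\<lambda>x. of_real (p x * d x) * cis (phase (- K) r x))) \<le> \<bar>p a\<bar> + \<bar>p b\<bar> + (Q b - Q a)"
    by (rule oscillatory_integral_le[OF ab(2) pd Qd _ le cp'])
       (use phase_deriv[of _ "- K" r] I in \<open>auto simp: d_def\<close>)
  also have "integral {a..b} (\<lambda>x. of_real (p x * d x) * cis (phase (- K) r x)) = osc (- K) r a b"
    unfolding osc_def using dpos by (intro integral_cong) (simp add: p_def less_imp_neq)
  also have "\<bar>p x\<bar> \<le> 1 / s" if x: "x \<in> {a..b}" for x
  proof -
    have "amp x > 0" using amp_pos[OF I(1,2)[OF x]] .
    have "0 \<le> (K - s * amp x)\<^sup>2 + K * (s * amp x)" using K s \<open>amp x > 0\<close> by simp
    also have "\<dots> = K * (K + (s * s / K) * (amp x)\<^sup>2 - s * amp x)"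
      using K by (simp add: power2_eq_square field_simps)
    also have "s * s / K = 2 * r" using K s by simp
    finally have "s * amp x \<le> K + 2 * r * (amp x)\<^sup>2" using K by (simp add: zero_le_mult_iff)
    then have "s * amp x \<le> \<bar>d x\<bar>" using dpos[of x] by (simp add: d_def)
    then show ?thesis using s \<open>amp x > 0\<close> dpos[of x] by (simp add: p_def abs_divide field_simps)
  qed
  from this[of a] this[of b] ab have "\<bar>p a\<bar> \<le> 1 / s" "\<bar>p b\<bar> \<le> 1 / s" by auto
  moreover have "Q b - Q a \<le> 2 / s"
  proof -
    have "arctan (c * amp b) \<le> 2" using arctan_ubound[of "c * amp b"] pi_less_4 by linarith
    moreover have "0 \<le> arctan (c * amp a)" using c amp_pos[of a] ab a0 by simp
    ultimately have "arctan (c * amp b) - arctan (c * amp a) \<le> 2" by linarith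
    then have "(arctan (c * amp b) - arctan (c * amp a)) / s \<le> 2 / s" using s by (intro divide_right_mono) auto
    then show ?thesis by (simp add: Q_def diff_divide_distrib)
  qed
  ultimately show ?thesis unfolding s_def[symmetric] by simp
qed

text \<open>Reflection in \<open>\<pi>/4\<close> conjugates the integrand up to a constant factor of modulus one.\<close>
lemma norm_osc_reflect:
  assumes "0 < a" "a \<le> b" "b < pi/2"
  shows "cmod (osc K r a b) = cmod (osc K r (pi/2 - b) (pi/2 - a))"
proof -
  define f where "f = (\<lambda>x. complex_of_real (amp x) * cis (phase K r x))"
  have f: "f (pi/2 - x) = cis (K * pi/2) * cnj (f x)" if "x \<in> {a..b}" for x
  proof -
    have sc: "0 < sin x" "0 < cos x" using sin_cos_pos[of x] that assms by auto
    have "amp (pi/2 - x) = amp x" by (simp add: amp_def sin_diff cos_diff mult.commute)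
    moreover have "phase K r (pi/2 - x) = K * pi/2 - phase K r x"
      using sc by (simp add: phase_def sin_diff cos_diff ln_div algebra_simps)
    moreover have "cis (K * pi/2 - t) = cis (K * pi/2) * cis (- t)" for t by (simp add: cis_mult)
    ultimately show ?thesis by (simp add: f_def cis_cnj del: cis_divide)
  qed
  have int: "(f has_integral osc K r (pi/2 - b) (pi/2 - a)) {pi/2 - b..pi/2 - a}"
    unfolding osc_def f_def using assms by (intro integrable_integral integrable_continuous_real continuous_on_osc) auto
  have "((\<lambda>x. f ((-1) *\<^sub>R x + pi/2)) has_integral (1 / (\<bar>-1::real\<bar> ^ DIM(real))) *\<^sub>R osc K r (pi/2 - b) (pi/2 - a))
     ((\<lambda>x. (1 / (-1)) *\<^sub>R x + - ((1 / (-1)) *\<^sub>R (pi/2))) ` cbox (pi/2 - b) (pi/2 - a))"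
    using int by (intro has_integral_affinity) (auto simp: cbox_interval)
  moreover have "(\<lambda>x::real. (1 / (-1)) *\<^sub>R x + - ((1 / (-1)) *\<^sub>R (pi/2))) ` cbox (pi/2 - b) (pi/2 - a) = {a..b}"
  proof -
    have "x \<in> (\<lambda>x. pi/2 - x) ` {pi/2 - b..pi/2 - a}" if "x \<in> {a..b}" for x
      by (rule image_eqI[of _ _ "pi/2 - x"]) (use that in auto)
    then have "(\<lambda>x. pi/2 - x) ` {pi/2 - b..pi/2 - a} = {a..b}" by auto
    then show ?thesis by (simp add: cbox_interval algebra_simps)
  qed
  ultimately have "((\<lambda>x. f (pi/2 - x)) has_integral osc K r (pi/2 - b) (pi/2 - a)) {a..b}" by simp
  then have "((\<lambda>x. cis (K * pi/2) * cnj (f x)) has_integral osc K r (pi/2 - b) (pi/2 - a)) {a..b}"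
    by (rule has_integral_eq[rotated]) (simp add: f)
  moreover have "((\<lambda>x. cis (K * pi/2) * cnj (f x)) has_integral cis (K * pi/2) * cnj (osc K r a b)) {a..b}"
  proof (intro has_integral_mult_right)
    have "(f has_integral osc K r a b) {a..b}"
      unfolding osc_def f_def using assms by (intro integrable_integral integrable_continuous_real continuous_on_osc) auto
    then show "((\<lambda>x. cnj (f x)) has_integral cnj (osc K r a b)) {a..b}"
      by (simp only: has_integral_cnj[unfolded o_def])
  qed
  ultimately have "osc K r (pi/2 - b) (pi/2 - a) = cis (K * pi/2) * cnj (osc K r a b)"
    by (rule has_integral_unique)
  then show ?thesis by (simp add: norm_mult)
qed

lemma norm_osc_le_of_right_half:
  assumes "\<And>a b. pi/4 \<le> a \<Longrightarrow> a \<le> b \<Longrightarrow> b < pi/2 \<Longrightarrow> cmod (osc K r a b) \<le> M"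
    and ab: "0 < a" "a \<le> b" "b < pi/2"
  shows "cmod (osc K r a b) \<le> 2 * M"
proof -
  have p4: "0 < pi/4" "pi/4 < pi/2" by auto
  have M: "0 \<le> M" using order_trans[OF norm_ge_zero assms(1)[of "pi/4" "pi/4"]] by auto
  have left: "cmod (osc K r a b) \<le> M" if "0 < a" "a \<le> b" "b \<le> pi/4" for a b
  proof -
    have "cmod (osc K r a b) = cmod (osc K r (pi/2 - b) (pi/2 - a))" using that p4 by (intro norm_osc_reflect) auto
    also have "\<dots> \<le> M" using that by (intro assms(1)) auto
    finally show ?thesis .
  qed
  consider "b \<le> pi/4" | "pi/4 \<le> a" | "a < pi/4" "pi/4 < b" by linarith
  then show ?thesis
  proof cases
    case 1
    then show ?thesis using left[of a b] ab M by linarith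
  next
    case 2
    then show ?thesis using assms(1)[of a b] ab M by linarith
  next
    case 3
    have "osc K r a b = osc K r a (pi/4) + osc K r (pi/4) b" using 3 ab by (intro osc_combine) auto
    then have "cmod (osc K r a b) \<le> cmod (osc K r a (pi/4)) + cmod (osc K r (pi/4) b)" by (simp add: norm_triangle_ineq)
    moreover have "cmod (osc K r a (pi/4)) \<le> M" using 3 ab by (intro left) auto
    moreover have "cmod (osc K r (pi/4) b) \<le> M" using 3 ab by (intro assms(1)) auto
    ultimately show ?thesis by linarith
  qed
qed

text \<open>For K < 4r the stationary value K / (2r) lies below the minimum 2 of q^2, so there is no
  stationary point, and q / (2 r q^2 - K) is largest at q = sqrt 2.\<close>

lemma osc_right_of_transition:
  assumes r: "r > 0" and K: "K \<ge> 0" and D: "K < 4 * r" and ab: "pi/4 \<le> a" "a \<le> b" "b < pi/2"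
  shows "cmod (osc K r a b) \<le> 4 * (sqrt 2 / (4 * r - K))"
proof (rule osc_outer_le[OF r K ab])
  fix x assume x: "x \<in> {a..b}"
  have x': "0 < x" "x < pi/2" using x ab pi_gt_zero by (auto intro: less_le_trans[of 0 "pi/4"])
  define q where "q = amp x"
  have q: "sqrt 2 \<le> q" "2 \<le> q\<^sup>2" using amp_ge_sqrt2[OF x'] by (simp_all add: q_def)
  have "2 * r * 2 \<le> 2 * r * q\<^sup>2" using r q by (intro mult_left_mono) auto
  then have neg: "0 < 2 * r * q\<^sup>2 - K" using D by linarith
  then show "K - 2 * r * (amp x)\<^sup>2 \<noteq> 0" by (simp add: q_def)
  have "(4 * r - K) * (q - sqrt 2) \<le> (sqrt 2 * 2 * r * (q + sqrt 2)) * (q - sqrt 2)"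
  proof (intro mult_right_mono)
    have "sqrt 2 * (2 * sqrt 2) \<le> sqrt 2 * (q + sqrt 2)" using q by (intro mult_left_mono) auto
    moreover have "sqrt 2 * (2 * sqrt 2) = 4" by simp
    ultimately have "4 \<le> sqrt 2 * (q + sqrt 2)" by linarith
    then have "r * 4 \<le> r * (sqrt 2 * (q + sqrt 2))" using r by (intro mult_left_mono) auto
    moreover have "sqrt 2 * 2 * r * (q + sqrt 2) = 2 * (r * (sqrt 2 * (q + sqrt 2)))" by simp
    ultimately show "4 * r - K \<le> sqrt 2 * 2 * r * (q + sqrt 2)" using K r by linarith
  qed (use q in auto)
  also have "\<dots> = sqrt 2 * (2 * r * q\<^sup>2 - 4 * r)" by (simp add: algebra_simps power2_eq_square)
  finally have "q * (4 * r - K) \<le> sqrt 2 * (2 * r * q\<^sup>2 - K)" by (simp add: algebra_simps)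
  then have "q / (2 * r * q\<^sup>2 - K) \<le> sqrt 2 / (4 * r - K)" using neg D by (simp add: field_simps)
  then show "amp x / \<bar>K - 2 * r * (amp x)\<^sup>2\<bar> \<le> sqrt 2 / (4 * r - K)" using neg by (simp add: q_def)
qed

lemma sin_ge_half:
  assumes "0 \<le> x" "x \<le> pi/4"
  shows "x / 2 \<le> sin x"
proof -
  have "sin 0 - 0 / 2 \<le> sin x - x / 2"
  proof (rule DERIV_nonneg_imp_nondecreasing[OF assms(1)])
    fix t assume t: "0 \<le> t" "t \<le> x"
    have "cos (pi/3) \<le> cos t" using t assms by (intro cos_monotone_0_pi_le) auto
    then show "\<exists>y. ((\<lambda>t. sin t - t / 2) has_real_derivative y) (at t) \<and> 0 \<le> y"
      by (intro exI[of _ "cos t - 1/2"]) (auto intro!: derivative_eq_intros simp: cos_60)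
  qed
  then show ?thesis by simp
qed

text \<open>With t = x - pi/4 one has (amp x)^2 = 2 / cos(2t), which has a quadratic minimum at t =
  0.\<close>

lemma amp_square_minus_2_ge:
  assumes "pi/4 \<le> x" "x < pi/2"
  shows "(x - pi/4)\<^sup>2 \<le> (amp x)\<^sup>2 - 2"
proof -
  define t where "t = x - pi/4"
  have t: "0 \<le> t" "t \<le> pi/4" using assms by (simp_all add: t_def)
  have x0: "0 < x" using assms pi_gt_zero by linarith
  have sc: "0 < sin x * cos x" using sin_cos_pos[OF x0 assms(2)] by simp
  have e: "2 * (sin x * cos x) = 1 - 2 * (sin t)\<^sup>2"
  proof -
    have "2 * (sin x * cos x) = sin (2 * x)" by (simp add: sin_double)
    also have "2 * x = 2 * t + pi/2" by (simp add: t_def)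
    also have "sin (2 * t + pi/2) = cos (2 * t)" by (simp add: sin_add)
    also have "\<dots> = 1 - 2 * (sin t)\<^sup>2" by (simp add: cos_double_sin)
    finally show ?thesis .
  qed
  have "(t / 2)\<^sup>2 \<le> (sin t)\<^sup>2" using sin_ge_half[OF t] t by (intro power_mono) auto
  then have s: "t\<^sup>2 \<le> 4 * (sin t)\<^sup>2" by (simp add: power_divide)
  have "(2 + 4 * (sin t)\<^sup>2) * (sin x * cos x) \<le> 1"
  proof -
    have "(2 + 4 * (sin t)\<^sup>2) * (sin x * cos x) = (1 + 2 * (sin t)\<^sup>2) * (2 * (sin x * cos x))" by simp
    also have "\<dots> = 1 - 4 * ((sin t)\<^sup>2)\<^sup>2" unfolding e by (simp add: power2_eq_square algebra_simps)
    finally show ?thesis by simp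
  qed
  then have "2 + 4 * (sin t)\<^sup>2 \<le> (amp x)\<^sup>2" unfolding amp_square[OF x0 assms(2)] using sc by (simp add: field_simps)
  then show ?thesis using s by (simp add: t_def)
qed

text \<open>The degenerate case. Within \<rho> of pi/4 the integral is estimated trivially by
  O(\<rho>). Beyond that, q^2 - 2 \<ge> \<rho>^2 makes |h'| at least of order K \<rho>^2. Both costs
  are 1 / c for \<rho> of order K^(-1/3).\<close>

lemma osc_transition:
  assumes c: "c > 0" "c ^ 3 = K" and K: "K \<ge> 3" and D: "\<bar>K - 4 * r\<bar> \<le> c" and ab: "pi/4 \<le> a" "a \<le> b" "b < pi/2"
  shows "cmod (osc K r a b) \<le> 52 / c"
proof -
  have c2: "2 \<le> c\<^sup>2"
  proof (rule ccontr)
    assume "\<not> 2 \<le> c\<^sup>2"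
    then have "(c\<^sup>2) ^ 3 \<le> 2 ^ 3" by (intro power_mono) auto
    moreover have "(c\<^sup>2) ^ 3 = K * K" unfolding c(2)[symmetric] by (simp add: power_mult[symmetric] power_add[symmetric])
    moreover have "3 * 3 \<le> K * K" using K by (intro mult_mono) auto
    ultimately show False by simp
  qed
  have "c * 2 \<le> c * c\<^sup>2" using c c2 by (intro mult_left_mono) auto
  then have "2 * c \<le> K" unfolding c(2)[symmetric] by (simp add: power2_eq_square power3_eq_cube)
  then have r: "K / 8 \<le> r" "r > 0" using D K by linarith+
  \<comment> \<open>With r \<ge> K/8 the 3 yields r (q^2 - 2) \<ge> (c^3 / 8) (9 / c^2) \<ge> c
    outside the removed interval, which absorbs |K - 4r| \<le> c.\<close>
  define \<rho> where "\<rho> = 3 / c"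
  define x1 where "x1 = pi/4 + \<rho>"
  have \<rho>: "\<rho> > 0" using c by (simp add: \<rho>_def)
  have inner: "cmod (osc K r a b) \<le> 20 / c" if ab: "pi/4 \<le> a" "a \<le> b" "b < pi/2" "b \<le> x1" for a b
  proof -
    have p4: "0 < pi/4" by simp
    have a0: "0 < a" using ab p4 by linarith
    have cb: "0 < cos b" using ab a0 by (intro cos_gt_zero) auto
    have "cmod (osc K r a b) \<le> integral {a..b} amp" using ab a0 by (intro osc_le_amp_integral) auto
    also have "\<dots> \<le> 4 * (sqrt (cos a) - sqrt (cos b))" using ab by (intro amp_integral_le) auto
    also have "sqrt (cos a) \<le> sqrt (cos (pi/4))" using ab by (intro real_sqrt_le_mono cos_monotone_0_pi_le) auto
    then have "4 * (sqrt (cos a) - sqrt (cos b)) \<le> 4 * (sqrt (cos (pi/4)) - sqrt (cos b))" by simp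
    also have "\<dots> \<le> 4 * (5/3 * \<rho>)"
    proof -
      define u v where "u = sqrt (cos (pi/4))" "v = sqrt (cos b)"
      have uv: "u * u = cos (pi/4)" "v * v = cos b" "v \<ge> 0" using cb by (simp_all add: u_v_def cos_45)
      have "(7/10 :: real) \<le> cos (pi/4)" using real_le_rsqrt[of "7/5" 2] by (simp add: cos_45 power2_eq_square)
      then have u: "3/5 \<le> u" unfolding u_v_def by (intro real_le_rsqrt) (simp add: power2_eq_square)
      have "u * u - v * v \<le> b - pi/4"
      proof -
        have "pi/4 \<le> b" using ab by simp
        then have "cos (pi/4) - (b - pi/4) \<le> cos b - 0"
        proof -
          have "cos (pi/4) + pi/4 \<le> cos b + b"
            by (rule DERIV_nonneg_imp_nondecreasing[OF \<open>pi/4 \<le> b\<close>])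
               (auto intro!: exI derivative_eq_intros)
          then show ?thesis by simp
        qed
        then show ?thesis by (simp add: uv)
      qed
      also have "\<dots> \<le> \<rho>" using ab by (simp add: x1_def)
      finally have "(u - v) * (u + v) \<le> \<rho>" by (simp add: algebra_simps)
      show ?thesis
      proof (cases "u \<le> v")
        case True
        then show ?thesis using \<rho> by (simp add: u_v_def[symmetric])
      next
        case False
        then have "(u - v) * (3/5) \<le> (u - v) * (u + v)" using u uv by (intro mult_left_mono) auto
        then have "(u - v) * (3/5) \<le> \<rho>" using \<open>(u - v) * (u + v) \<le> \<rho>\<close> by (rule order_trans)
        then have "u - v \<le> 5/3 * \<rho>" by simp
        then show ?thesis by (simp add: u_v_def)
      qed
    qed
    also have "\<dots> = 20 / c" by (simp add: \<rho>_def)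
    finally show ?thesis .
  qed
  have outer: "cmod (osc K r a b) \<le> 4 * (8 / c)" if ab: "pi/4 \<le> a" "a \<le> b" "b < pi/2" "x1 \<le> a" for a b
  proof (rule osc_outer_le[OF r(2) _ ab(1-3)])
    show "0 \<le> K" using K by simp
    fix x assume x: "x \<in> {a..b}"
    define q where "q = amp x"
    have p4: "0 < pi/4" by simp
    have x': "pi/4 \<le> x" "x < pi/2" "0 < x" using x ab p4 by auto
    have q0: "q > 0" using amp_pos[of x] x' by (simp add: q_def)
    have "\<rho>\<^sup>2 \<le> (x - pi/4)\<^sup>2" using x ab \<rho> by (intro power_mono) (auto simp: x1_def)
    also have "\<dots> \<le> q\<^sup>2 - 2" using amp_square_minus_2_ge[OF x'(1,2)] by (simp add: q_def)
    finally have q2: "9 / c\<^sup>2 \<le> q\<^sup>2 - 2" by (simp add: \<rho>_def power_divide)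
    have "c \<le> (c ^ 3 / 8) * (9 / c\<^sup>2)" using c(1) by (simp add: power2_eq_square power3_eq_cube)
    also have "\<dots> \<le> r * (q\<^sup>2 - 2)" using r q2 c by (intro mult_mono) auto
    finally have rq: "c \<le> r * (q\<^sup>2 - 2)" .
    have big: "r * (q\<^sup>2 - 2) \<le> 2 * r * q\<^sup>2 - K"
    proof -
      have "2 * r * q\<^sup>2 - K = 2 * (r * (q\<^sup>2 - 2)) - (K - 4 * r)" by (simp add: algebra_simps)
      then show ?thesis using rq D by linarith
    qed
    then have pos: "0 < 2 * r * q\<^sup>2 - K" using rq c by linarith
    then show "K - 2 * r * (amp x)\<^sup>2 \<noteq> 0" by (simp add: q_def)
    have "q / (2 * r * q\<^sup>2 - K) \<le> q / (r * (q\<^sup>2 - 2))"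
    proof (intro divide_left_mono[OF big] mult_pos_pos pos)
      have "0 < 9 / c\<^sup>2" using c by simp
      then show "0 < q\<^sup>2 - 2" using q2 by linarith
    qed (use q0 r in auto)
    also have "\<dots> \<le> 8 / c"
    \<comment> \<open>For bounded q the lower bound c for the denominator suffices; for q > 2 its
      quadratic growth already exceeds q.\<close>
    proof (cases "q \<le> 2")
      case True
      have "q * c \<le> 2 * (r * (q\<^sup>2 - 2))" using True rq c by (intro mult_mono) auto
      then show ?thesis using rq c by (simp add: divide_le_eq) (simp add: field_simps)
    next
      case False
      then have "q * 2 \<le> q * q" by (intro mult_left_mono) auto
      then have "q \<le> q\<^sup>2 - 2" using False unfolding power2_eq_square by linarith
      then have "c * q \<le> (8 * r) * (q\<^sup>2 - 2)"
        using r \<open>2 * c \<le> K\<close> c q0 by (intro mult_mono) auto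
      then show ?thesis using rq c by (simp add: divide_le_eq) (simp add: field_simps)
    qed
    finally show "amp x / \<bar>K - 2 * r * (amp x)\<^sup>2\<bar> \<le> 8 / c" using pos by (simp add: q_def)
  qed
  have cc: "20 / c \<le> 52 / c" "4 * (8 / c) \<le> 52 / c" "20 / c + 4 * (8 / c) = 52 / c" using c by (simp_all add: field_simps)
  consider "b \<le> x1" | "x1 \<le> a" | "a < x1" "x1 < b" by linarith
  then show ?thesis
  proof cases
    case 1
    then show ?thesis using inner[OF ab] cc by linarith
  next
    case 2
    then show ?thesis using outer[OF ab] cc by linarith
  next
    case 3
    have x1: "pi/4 \<le> x1" using \<rho> by (simp add: x1_def)
    have "osc K r a b = osc K r a x1 + osc K r x1 b"
      using 3 ab pi_gt_zero by (intro osc_combine) linarith+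
    then have "cmod (osc K r a b) \<le> cmod (osc K r a x1) + cmod (osc K r x1 b)" by (simp add: norm_triangle_ineq)
    also have "\<dots> \<le> 20 / c + 4 * (8 / c)"
      using 3 ab x1 by (intro add_mono inner outer) auto
    finally show ?thesis using cc by simp
  qed
qed

text \<open>The level t need not be attained on [a, b]; in that case c is an end point. The last two
  clauses supply the inequality at c itself except when the corresponding side has shrunk to a
  point.\<close>

lemma monotone_split:
  fixes f :: "real \<Rightarrow> real"
  assumes "a \<le> b" "continuous_on {a..b} f" and mono: "\<And>x y. a \<le> x \<Longrightarrow> x \<le> y \<Longrightarrow> y \<le> b \<Longrightarrow> f x \<le> f y"
  obtains c where "a \<le> c" "c \<le> b" "\<And>x. a \<le> x \<Longrightarrow> x < c \<Longrightarrow> f x \<le> t" "\<And>x. c < x \<Longrightarrow> x \<le> b \<Longrightarrow> t \<le> f x"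
     "c = a \<or> f c \<le> t" "c = b \<or> t \<le> f c"
proof -
  consider "f b \<le> t" | "t \<le> f a" | "f a < t" "t < f b" by linarith
  then show thesis
  proof cases
    case 1
    show ?thesis by (rule that[of b]) (use assms(1) 1 in \<open>auto intro: order_trans[OF mono 1]\<close>)
  next
    case 2
    show ?thesis by (rule that[of a]) (use assms(1) 2 in \<open>auto intro: order_trans[OF 2 mono]\<close>)
  next
    case 3
    then obtain c where c: "a \<le> c" "c \<le> b" "f c = t" using IVT'[of f a t b] assms by auto
    show ?thesis by (rule that[of c]) (use c mono[of _ c] mono[of c] in auto)
  qed
qed

text \<open>
  Removing \<open>|q - q0| < \<eta>\<close> around the stationary value \<open>q0\<close> of \<open>q = amp x\<close> costs \<open>\<eta> r / T\<^sup>2\<close>, and the first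
  derivative test outside costs \<open>1 / (r \<eta>)\<close>; the choice \<open>\<eta> = T / (16 r)\<close> balances the two.
\<close>
lemma osc_stationary:
  assumes T: "T > 0" "T ^ 4 = (K - 4 * r) * K" and r: "r > 0" and D: "4 * r < K"
    and big: "K ^ 3 \<le> 64 * r\<^sup>2 * (K - 4 * r) ^ 3" and ab: "pi/4 \<le> a" "a \<le> b" "b < pi/2"
  shows "cmod (osc K r a b) \<le> 66 / T"
proof -
  define D where "D = K - 4 * r"
  have D0: "D > 0" "K > 0" using D r by (simp_all add: D_def)
  define q0 where "q0 = sqrt (K / (2 * r))"
  define \<eta> where "\<eta> = T / (16 * r)"
  have q0: "q0 > 0" "q0\<^sup>2 = K / (2 * r)" using D0 r by (simp_all add: q0_def)
  have q02: "q0\<^sup>2 - 2 = D / (2 * r)" using r unfolding q0(2) D_def by (simp add: field_simps)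
  have "0 < D / (2 * r)" using D0 r by simp
  then have "2 < q0\<^sup>2" using q02 by linarith
  then have q0s: "sqrt 2 < q0" using q0 by (intro real_less_lsqrt) auto
  have \<eta>: "\<eta> > 0" using T r by (simp add: \<eta>_def)
  \<comment> \<open>The hypothesis \<open>big\<close> says exactly that T * q0 \<le> 2 * D. It keeps
    the removed zone in the upper half of the gap between q0 and sqrt 2, the value at which the
    slope of the amplitude vanishes.\<close>
  have "\<eta> \<le> (q0 - sqrt 2) / 2"
  proof -
    have "(T * q0) ^ 4 \<le> (2 * D) ^ 4"
    proof -
      have "(T * q0) ^ 4 = T ^ 4 * (q0\<^sup>2)\<^sup>2" by (simp add: power_mult_distrib)
      also have "\<dots> = D * K ^ 3 / (4 * r\<^sup>2)" unfolding T(2) q0(2) by (simp add: D_def power_divide power2_eq_square power3_eq_cube)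
      also have "\<dots> \<le> D * (64 * r\<^sup>2 * D ^ 3) / (4 * r\<^sup>2)"
        using big D0 by (intro divide_right_mono mult_left_mono) (auto simp: D_def)
      also have "\<dots> = (2 * D) ^ 4" using r by (simp add: power_mult_distrib eval_nat_numeral)
      finally show ?thesis .
    qed
    then have "T * q0 \<le> 2 * D" by (rule power_le_imp_le_base[of _ 3, simplified]) (use D0 in auto)
    then have 1: "T / (16 * r) \<le> 2 * D / q0 / (16 * r)" using q0 r by (intro divide_right_mono) (auto simp: field_simps)
    have "(q0 - sqrt 2) * (q0 + sqrt 2) = D / (2 * r)" unfolding q02[symmetric] by (simp add: power2_eq_square algebra_simps)
    moreover have "(q0 - sqrt 2) * (q0 + sqrt 2) \<le> (q0 - sqrt 2) * (2 * q0)" using q0s by (intro mult_left_mono) auto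
    ultimately have "D / (2 * r) \<le> (q0 - sqrt 2) * (2 * q0)" by linarith
    then have "D / (2 * r) / (4 * q0) \<le> (q0 - sqrt 2) * (2 * q0) / (4 * q0)" using q0 by (intro divide_right_mono) auto
    also have "\<dots> = (q0 - sqrt 2) / 2" using q0 by simp
    also have "D / (2 * r) / (4 * q0) = 2 * D / q0 / (16 * r)" by simp
    finally show ?thesis using 1 by (simp add: \<eta>_def)
  qed
  then have q1: "(q0 + sqrt 2) / 2 \<le> q0 - \<eta>" by (simp add: field_simps)
  have a0: "0 < a" using ab pi_gt_zero by linarith
  have amon: "amp x \<le> amp y" if "a \<le> x" "x \<le> y" "y \<le> b" for x y using that ab by (intro amp_mono) auto
  have acont: "continuous_on {a..b} amp" using ab a0 by (intro continuous_on_osc) auto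
  obtain c1 where c1: "a \<le> c1" "c1 \<le> b" "\<And>x. a \<le> x \<Longrightarrow> x < c1 \<Longrightarrow> amp x \<le> q0 - \<eta>" "\<And>x. c1 < x \<Longrightarrow> x \<le> b \<Longrightarrow> q0 - \<eta> \<le> amp x"
     "c1 = a \<or> amp c1 \<le> q0 - \<eta>" "c1 = b \<or> q0 - \<eta> \<le> amp c1"
    using monotone_split[of a b amp "q0 - \<eta>"] ab acont amon by blast
  obtain c2 where c2: "c1 \<le> c2" "c2 \<le> b" "\<And>x. c1 \<le> x \<Longrightarrow> x < c2 \<Longrightarrow> amp x \<le> q0 + \<eta>" "\<And>x. c2 < x \<Longrightarrow> x \<le> b \<Longrightarrow> q0 + \<eta> \<le> amp x"
     "c2 = c1 \<or> amp c2 \<le> q0 + \<eta>" "c2 = b \<or> q0 + \<eta> \<le> amp c2"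
    using monotone_split[of c1 b amp "q0 + \<eta>"] c1 amon continuous_on_subset[OF acont, of "{c1..b}"] by auto
  have outer: "cmod (osc K r x y) \<le> 4 * (8 / T)"
    if xy: "a \<le> x" "x \<le> y" "y \<le> b" and far: "\<And>t. t \<in> {x..y} \<Longrightarrow> \<eta> \<le> \<bar>q0 - amp t\<bar>" for x y
  proof (rule osc_outer_le)
    show "r > 0" "0 \<le> K" "pi/4 \<le> x" "x \<le> y" "y < pi/2" using r D0 xy ab by auto
    fix t assume t: "t \<in> {x..y}"
    define q where "q = amp t"
    have q: "q > 0" using amp_pos[of t] t xy ab a0 by (simp add: q_def)
    have eq: "K - 2 * r * q\<^sup>2 = 2 * r * (q0 - q) * (q0 + q)"
    proof -
      have "2 * r * (q0 - q) * (q0 + q) = 2 * r * (q0\<^sup>2 - q\<^sup>2)" by (simp add: power2_eq_square algebra_simps)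
      then show ?thesis unfolding q0(2) using r by (simp add: algebra_simps)
    qed
    have f: "\<eta> \<le> \<bar>q0 - q\<bar>" using far[OF t] by (simp add: q_def)
    have abs: "\<bar>K - 2 * r * q\<^sup>2\<bar> = 2 * r * \<bar>q0 - q\<bar> * (q0 + q)" unfolding eq abs_mult using r q0 q by simp
    have ge: "2 * r * \<eta> * q \<le> \<bar>K - 2 * r * q\<^sup>2\<bar>"
      unfolding abs using f r q q0 \<eta> by (intro mult_mono) auto
    have "0 < 2 * r * \<eta> * q" using r \<eta> q by simp
    then have pos: "0 < \<bar>K - 2 * r * q\<^sup>2\<bar>" using ge by (rule less_le_trans)
    then show "K - 2 * r * (amp t)\<^sup>2 \<noteq> 0" by (simp add: q_def)
    have "q / \<bar>K - 2 * r * q\<^sup>2\<bar> \<le> q / (2 * r * \<eta> * q)"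
      using mult_pos_pos[OF pos \<open>0 < 2 * r * \<eta> * q\<close>] q by (intro divide_left_mono[OF ge]) simp_all
    also have "\<dots> = 8 / T" using q r T by (simp add: \<eta>_def)
    finally show "amp t / \<bar>K - 2 * r * (amp t)\<^sup>2\<bar> \<le> 8 / T" by (simp add: q_def)
  qed
  have left: "cmod (osc K r a c1) \<le> 32 / T"
  proof (cases "c1 = a")
    case True
    then show ?thesis using T by (simp add: osc_def)
  next
    case False
    then show ?thesis using outer[of a c1] c1(1,2,3,5) \<eta> by (force simp: le_less)
  qed
  have right: "cmod (osc K r c2 b) \<le> 32 / T"
  proof (cases "c2 = b")
    case True
    then show ?thesis using T by (simp add: osc_def)
  next
    case False
    then show ?thesis using outer[of c2 b] c1(1) c2(1,2,4,6) \<eta> by (force simp: le_less)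
  qed
  have mid: "cmod (osc K r c1 c2) \<le> 2 / T"
  proof (cases "c1 = c2")
    case True
    then show ?thesis using T by (simp add: osc_def)
  next
    case False
    then have lt: "c1 < c2" using c2 by simp
    define \<kappa> where "\<kappa> = 16 * r / T\<^sup>2"
    define y where "y = (\<lambda>x. amp_slope x)"
    have I: "0 < x" "x < pi/2" "pi/4 \<le> x" "q0 - \<eta> \<le> amp x" if "x \<in> {c1..c2}" for x
    proof -
      show "0 < x" "x < pi/2" "pi/4 \<le> x" using that c1 c2 ab a0 by auto
      show "q0 - \<eta> \<le> amp x" using that c1(4)[of x] c1(6) c2 lt by (cases "x = c1") auto
    qed
    have "(y has_integral amp c2 - amp c1) {c1..c2}"
    proof (rule fundamental_theorem_of_calculus[OF c2(1)])
      fix x assume x: "x \<in> {c1..c2}"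
      have "(amp has_real_derivative y x) (at x within {c1..c2})"
        unfolding y_def by (rule has_field_derivative_at_within[OF amp_deriv[OF I(1,2)[OF x]]])
      then show "(amp has_vector_derivative y x) (at x within {c1..c2})"
        by (simp add: has_real_derivative_iff_has_vector_derivative)
    qed
    then have hy: "((\<lambda>x. \<kappa> * y x) has_integral \<kappa> * (amp c2 - amp c1)) {c1..c2}"
      by (rule has_integral_mult_right)
    have le: "amp x \<le> \<kappa> * y x" if x: "x \<in> {c1..c2}" for x
    proof -
      define q where "q = amp x"
      have q: "(q0 + sqrt 2) / 2 \<le> q" using I(4)[OF x] q1 by (simp add: q_def)
      have qpos: "q > 0" using amp_pos[OF I(1,2)[OF x]] by (simp add: q_def)
      have "T ^ 4 / (64 * r\<^sup>2) \<le> q ^ 4 - 4"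
      proof -
        have s2: "sqrt 2 * sqrt 2 = 2" by simp
        have qs: "sqrt 2 \<le> q" using q q0s by (simp add: field_simps)
        \<comment> \<open>The divisor 16 = 2 * 2 * 4 pays for replacing q0 by q in the three
          factors: q is at least the midpoint of sqrt 2 and q0, so q - sqrt 2 \<ge> (q0 - sqrt 2) /
          2.\<close>
        have "T ^ 4 / (64 * r\<^sup>2) \<le> (q0\<^sup>2 - 2) * (q0\<^sup>2 + 2) / 16"
        proof -
          have e: "(q0\<^sup>2 - 2) * (q0\<^sup>2 + 2) = D * (K + 4 * r) / (4 * r\<^sup>2)"
            unfolding q02 unfolding q0(2) using r by (simp add: field_simps power2_eq_square)
          have "D * K \<le> D * (K + 4 * r)" using D0 r by (intro mult_left_mono) auto
          then have "D * K / (64 * r\<^sup>2) \<le> D * (K + 4 * r) / (64 * r\<^sup>2)" by (intro divide_right_mono) auto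
          then show ?thesis unfolding e T(2) by (simp add: D_def)
        qed
        also have "\<dots> = ((q0 - sqrt 2) / 2) * ((q0 + sqrt 2) / 2) * ((q0\<^sup>2 + 2) / 4)"
          using s2 by (simp add: power2_eq_square algebra_simps)
        also have "\<dots> \<le> (q - sqrt 2) * (q + sqrt 2) * (q\<^sup>2 + 2)"
        proof (intro mult_mono mult_nonneg_nonneg)
          have "q0 / 2 \<le> (q0 + sqrt 2) / 2" by simp
          then have "q0 / 2 \<le> q" using q by (rule order_trans)
          then have "(q0 / 2)\<^sup>2 \<le> q\<^sup>2" using q0 by (intro power_mono) auto
          then show "(q0\<^sup>2 + 2) / 4 \<le> q\<^sup>2 + 2" by (simp add: power_divide)
          show "(q0 - sqrt 2) / 2 \<le> q - sqrt 2" using q by (simp add: field_simps)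
          show "(q0 + sqrt 2) / 2 \<le> q + sqrt 2" using q by (rule order_trans) simp
          show "0 \<le> (q0\<^sup>2 + 2) / 4" by simp
        qed (use q0 q0s qpos qs in auto)
        also have "\<dots> = q ^ 4 - 4"
        proof -
          have "(q - sqrt 2) * (q + sqrt 2) = q\<^sup>2 - 2" by (simp add: power2_eq_square algebra_simps)
          then show ?thesis by (simp add: algebra_simps flip: power_add)
        qed
        finally show ?thesis .
      qed
      also have "\<dots> = (q\<^sup>2 * cos (2 * x))\<^sup>2"
        using cos_double_amp[OF I(1,2)[OF x]] by (simp add: q_def power_mult_distrib)
      finally have le2: "(T\<^sup>2 / (8 * r))\<^sup>2 \<le> (q\<^sup>2 * (- cos (2 * x)))\<^sup>2"
        by (simp add: power_divide power_mult_distrib)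
      have cneg: "0 \<le> - cos (2 * x)"
      proof -
        have "cos (2 * x) \<le> cos (pi/2)" using I[OF x] by (intro cos_monotone_0_pi_le) auto
        then show ?thesis by simp
      qed
      have "T\<^sup>2 / (8 * r) \<le> q\<^sup>2 * (- cos (2 * x))"
        by (rule power2_le_imp_le[OF le2 mult_nonneg_nonneg[OF zero_le_power2 cneg]])
      then have "q / 2 * (T\<^sup>2 / (8 * r)) \<le> q / 2 * (q\<^sup>2 * (- cos (2 * x)))" using qpos by (intro mult_left_mono) simp_all
      then have "q * T\<^sup>2 / (16 * r) \<le> y x" by (simp add: y_def amp_slope_def q_def power2_eq_square power3_eq_cube mult_ac)
      then have "\<kappa> * (q * T\<^sup>2 / (16 * r)) \<le> \<kappa> * y x" using r by (intro mult_left_mono) (auto simp: \<kappa>_def)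
      then show ?thesis using T r by (simp add: \<kappa>_def q_def)
    qed
    have "cmod (osc K r c1 c2) \<le> integral {c1..c2} amp"
      using c1 c2 a0 ab by (intro osc_le_amp_integral) auto
    also have "\<dots> \<le> \<kappa> * (amp c2 - amp c1)"
    proof -
      have "amp integrable_on {c1..c2}" using c1 c2 a0 ab by (intro integrable_continuous_real continuous_on_osc) auto
      then have "integral {c1..c2} amp \<le> integral {c1..c2} (\<lambda>x. \<kappa> * y x)"
        by (rule integral_le[OF _ has_integral_integrable[OF hy] le])
      then show ?thesis unfolding integral_unique[OF hy] .
    qed
    also have "\<dots> \<le> \<kappa> * (2 * \<eta>)"
    proof (intro mult_left_mono)
      show "amp c2 - amp c1 \<le> 2 * \<eta>" using c1(6) c2(5) lt c2(2) by auto
    qed (use r in \<open>simp add: \<kappa>_def\<close>)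
    also have "\<dots> = 2 / T" using T r by (simp add: \<kappa>_def \<eta>_def power2_eq_square)
    finally show ?thesis .
  qed
  have "osc K r a b = osc K r a c1 + (osc K r c1 c2 + osc K r c2 b)"
    using osc_combine[of a c1 b K r] osc_combine[of c1 c2 b K r] a0 ab c1 c2 by simp
  also have "cmod \<dots> \<le> cmod (osc K r a c1) + (cmod (osc K r c1 c2) + cmod (osc K r c2 b))"
    by (intro order_trans[OF norm_triangle_ineq] add_left_mono norm_triangle_ineq)
  also have "\<dots> \<le> 32 / T + (2 / T + 32 / T)" by (intro add_mono left mid right)
  finally show ?thesis by simp
qed

section \<open>The Mellin transform\<close>

text \<open>For K > 0 this is the reciprocal of the larger of K^(1/3) and (|K - 4r| K)^(1/4), as the
  next two lemmas show. In this form it matches the outcomes of the three regimes.\<close>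

definition transition_bound :: "real \<Rightarrow> real \<Rightarrow> real" where
  "transition_bound K r = K powr (- (1/3)) *
     (if K = 4 * r then 1 else min 1 (K powr (1/12) / \<bar>K - 4 * r\<bar> powr (1/4)))"

lemma transition_bound_near:
  assumes "K > 0" "\<bar>K - 4 * r\<bar> \<le> K powr (1/3)"
  shows "transition_bound K r = 1 / K powr (1/3)"
proof -
  have "\<bar>K - 4 * r\<bar> powr (1/4) \<le> (K powr (1/3)) powr (1/4)" using assms by (intro powr_mono2) auto
  then have "\<bar>K - 4 * r\<bar> powr (1/4) \<le> K powr (1/12)" by (simp add: powr_powr)
  then show ?thesis by (auto simp: transition_bound_def powr_minus divide_simps min_def)
qed

lemma transition_bound_far:
  assumes "K > 0" "K powr (1/3) < \<bar>K - 4 * r\<bar>"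
  shows "transition_bound K r = 1 / (\<bar>K - 4 * r\<bar> * K) powr (1/4)"
proof -
  have pos: "\<bar>K - 4 * r\<bar> > 0" using assms powr_ge_zero[of K "1/3"] by linarith
  have "(K powr (1/3)) powr (1/4) \<le> \<bar>K - 4 * r\<bar> powr (1/4)" using assms by (intro powr_mono2) auto
  then have "K powr (1/12) \<le> \<bar>K - 4 * r\<bar> powr (1/4)" by (simp add: powr_powr)
  then have "transition_bound K r = K powr (- (1/3)) * (K powr (1/12) / \<bar>K - 4 * r\<bar> powr (1/4))"
    using pos by (auto simp: transition_bound_def min_def field_simps)
  also have "\<dots> = (K powr (- (1/3)) * K powr (1/12)) / \<bar>K - 4 * r\<bar> powr (1/4)" by simp
  also have "K powr (- (1/3)) * K powr (1/12) = K powr (- (1/4))" by (simp flip: powr_add)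
  finally show ?thesis using assms pos by (simp add: powr_mult powr_minus field_simps)
qed

lemma powr_third_cubed: "K > 0 \<Longrightarrow> (K powr (1/3)) ^ 3 = K" for K :: real
  by (simp add: powr_powr flip: powr_numeral)

lemma powr_fourth_pow4: "K > 0 \<Longrightarrow> (K powr (1/4)) ^ 4 = K" for K :: real
  by (simp add: powr_powr flip: powr_numeral)

text \<open>Since |K - 4r| \<le> 16 K, the bound never falls below 1 / (2 sqrt K). It therefore
  absorbs the contributions of order K^(-1/2), namely the non-stationary phase and the tail near
  pi/2. The 16 is taken for its fourth root 2.\<close>

lemma inverse_sqrt_le_transition_bound:
  assumes K: "K \<ge> 1" and r: "0 < r" "r \<le> K"
  shows "1 / sqrt K \<le> 2 * transition_bound K r"
proof -
  have K0: "K > 0" using K by simp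
  define m where "m = (if K = 4 * r then 1 else min 1 (K powr (1/12) / \<bar>K - 4 * r\<bar> powr (1/4)))"
  have 1: "K powr (- (1/6)) \<le> 1" using powr_mono[of "- (1/6)" 0 K] K by simp
  have 2: "K powr (- (1/6)) \<le> 2 * (K powr (1/12) / \<bar>K - 4 * r\<bar> powr (1/4))" if "K \<noteq> 4 * r"
  proof -
    have "\<bar>K - 4 * r\<bar> powr (1/4) \<le> (16 * K) powr (1/4)" using r K by (intro powr_mono2) auto
    also have "\<dots> = 16 powr (1/4) * K powr (1/4)" by (rule powr_mult)
    also have "16 powr (1/4) = (2 powr 4) powr (1/4 :: real)" by simp
    also have "\<dots> = 2" by (simp only: powr_powr) simp
    finally have le: "\<bar>K - 4 * r\<bar> powr (1/4) \<le> 2 * K powr (1/4)" .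
    have "K powr (- (1/6)) = K powr (1/12) / K powr (1/4)" by (simp flip: powr_diff)
    also have "\<dots> = 2 * (K powr (1/12) / (2 * K powr (1/4)))" by simp
    also have "\<dots> \<le> 2 * (K powr (1/12) / \<bar>K - 4 * r\<bar> powr (1/4))"
      using le K that by (intro mult_left_mono divide_left_mono) auto
    finally show ?thesis .
  qed
  have "K powr (- (1/6)) \<le> 2 * m"
  proof (cases "K = 4 * r")
    case True
    show ?thesis unfolding m_def if_P[OF True] using 1 by linarith
  next
    case False
    show ?thesis unfolding m_def if_not_P[OF False] using 1 2[OF False] by linarith
  qed
  then have "K powr (- (1/3)) * K powr (- (1/6)) \<le> K powr (- (1/3)) * (2 * m)" by (intro mult_left_mono) auto
  moreover have "K powr (- (1/3)) * K powr (- (1/6)) = 1 / sqrt K"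
    using K0 by (simp add: powr_half_sqrt[symmetric] powr_minus_divide flip: powr_add)
  ultimately show ?thesis by (simp add: transition_bound_def m_def)
qed

text \<open>The regimes meet at D = |K - 4r| = K^(1/3). Beyond it K \<le> D^3, hence T = (D K)^(1/4)
  \<le> D, so the bound 1 / D available for K < 4r is at least as good as 1 / T.\<close>

lemma norm_osc_le_transition_bound:
  assumes K: "K \<ge> 3" and r: "1 \<le> r" "r \<le> K" and ab: "0 < a" "a \<le> b" "b < pi/2"
  shows "cmod (osc K r a b) \<le> 132 * transition_bound K r" "cmod (osc (- K) r a b) \<le> 132 * transition_bound K r"
proof -
  have r0: "r > 0" and K0: "K > 0" using r K by linarith+
  have B0: "0 \<le> transition_bound K r" by (simp add: transition_bound_def)
  have "cmod (osc K r a b) \<le> 66 * transition_bound K r" if ab: "pi/4 \<le> a" "a \<le> b" "b < pi/2" for a b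
  proof -
    define c where "c = K powr (1/3)"
    have c: "c > 0" "c ^ 3 = K" using K0 by (simp_all add: c_def powr_third_cubed)
    consider "\<bar>K - 4 * r\<bar> \<le> c" | "K < 4 * r" "c < \<bar>K - 4 * r\<bar>" | "4 * r < K" "c < \<bar>K - 4 * r\<bar>"
      using c(1) by linarith
    then show ?thesis
    proof cases
      case 1
      have "cmod (osc K r a b) \<le> 52 / c" by (rule osc_transition[OF c K 1 ab])
      also have "\<dots> \<le> 66 * transition_bound K r"
        using transition_bound_near[OF K0, of r] 1 c by (simp add: c_def divide_right_mono)
      finally show ?thesis .
    next
      case 2
      define D T where "D = \<bar>K - 4 * r\<bar>" "T = (D * K) powr (1/4)"
      have D: "D > 0" "D = 4 * r - K" using 2 c by (simp_all add: D_T_def)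
      have T: "T > 0" "T ^ 4 = D * K" using D K0 by (simp_all add: D_T_def(2) powr_fourth_pow4)
      have "K \<le> D ^ 3" unfolding c(2)[symmetric] using 2 c by (intro power_mono) (auto simp: D_T_def)
      then have "D * K \<le> D * D ^ 3" using D by (intro mult_left_mono) auto
      then have "T ^ 4 \<le> D ^ 4" unfolding T(2) by (simp add: eval_nat_numeral)
      then have "T \<le> D" by (rule power_le_imp_le_base[of _ 3, simplified]) (use D in auto)
      have "cmod (osc K r a b) \<le> 4 * (sqrt 2 / D)" unfolding D(2) by (rule osc_right_of_transition[OF r0 _ 2(1) ab]) (use K in auto)
      also have "\<dots> \<le> 4 * (2 / T)"
      proof -
        have "sqrt 2 \<le> 2" by (rule real_le_lsqrt) auto
        then show ?thesis using \<open>T \<le> D\<close> T D by (intro mult_left_mono frac_le) auto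
      qed
      also have "\<dots> \<le> 66 / T" using T by (simp add: divide_right_mono)
      also have "\<dots> = 66 * transition_bound K r"
        using transition_bound_far[OF K0, of r] 2 by (simp add: c_def D_T_def)
      finally show ?thesis .
    next
      case 3
      define D T where "D = \<bar>K - 4 * r\<bar>" "T = (D * K) powr (1/4)"
      have D: "D > 0" "D = K - 4 * r" using 3 c by (simp_all add: D_T_def)
      have T: "T > 0" "T ^ 4 = D * K" using D K0 by (simp_all add: D_T_def(2) powr_fourth_pow4)
      have D3: "K \<le> D ^ 3" unfolding c(2)[symmetric] using 3 c by (intro power_mono) (auto simp: D_T_def)
      \<comment> \<open>The separation condition of \<open>osc_stationary\<close>. When r is
        comparable to K it follows from K \<le> D^3; otherwise D exceeds K/2 and r \<ge> 1 is
        enough.\<close>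
      have "K ^ 3 \<le> 64 * r\<^sup>2 * D ^ 3"
      proof (cases "K \<le> 8 * r")
        case True
        then have "K\<^sup>2 \<le> (8 * r)\<^sup>2" using K0 by (intro power_mono) auto
        then have "K\<^sup>2 * K \<le> (8 * r)\<^sup>2 * D ^ 3" using D3 K0 by (intro mult_mono) auto
        then show ?thesis by (simp add: power2_eq_square power3_eq_cube mult_ac)
      next
        case False
        then have "(K / 2) ^ 3 \<le> D ^ 3" using D K0 by (intro power_mono) auto
        then have "K ^ 3 \<le> 8 * D ^ 3" by (simp add: power_divide)
        also have "\<dots> \<le> (64 * r\<^sup>2) * D ^ 3"
        proof (intro mult_right_mono)
          have "1 \<le> r\<^sup>2" using r by simp
          then show "8 \<le> 64 * r\<^sup>2" by linarith
        qed (use D in auto)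
        finally show ?thesis .
      qed
      then have "cmod (osc K r a b) \<le> 66 / T"
        using T D 3(1) r0 ab by (intro osc_stationary) auto
      also have "\<dots> = 66 * transition_bound K r"
        using transition_bound_far[OF K0, of r] 3 by (simp add: c_def D_T_def)
      finally show ?thesis .
    qed
  qed
  then have "cmod (osc K r a b) \<le> 2 * (66 * transition_bound K r)" by (rule norm_osc_le_of_right_half[OF _ ab])
  then show "cmod (osc K r a b) \<le> 132 * transition_bound K r" by simp
  have "cmod (osc (- K) r a b) \<le> 2 * (4 / sqrt (2 * r * K))"
    by (rule norm_osc_le_of_right_half[OF osc_nonstationary_le[OF r0 K0] ab])
  also have "\<dots> \<le> 2 * (4 / sqrt K)"
    using r K0 by (intro mult_left_mono divide_left_mono) auto
  also have "\<dots> \<le> 132 * transition_bound K r"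
    using inverse_sqrt_le_transition_bound[of K r] K r r0 B0 by simp
  finally show "cmod (osc (- K) r a b) \<le> 132 * transition_bound K r" .
qed

text \<open>Abel summation for integrals. The primitive of g is started at a, so the boundary term
  there vanishes and only integrals of g over initial segments enter.\<close>

lemma norm_integral_mult_bv_le:
  fixes A A' g :: "real \<Rightarrow> complex"
  assumes ab: "a \<le> b" and g: "continuous_on {a..b} g"
    and A: "\<And>x. x \<in> {a..b} \<Longrightarrow> (A has_vector_derivative A' x) (at x)"
    and cA': "continuous_on {a..b} A'"
    and Q: "\<And>x. x \<in> {a..b} \<Longrightarrow> (Q has_real_derivative Q' x) (at x)"
    and le: "\<And>x. x \<in> {a..b} \<Longrightarrow> cmod (A' x) \<le> Q' x"
    and M: "\<And>x. x \<in> {a..b} \<Longrightarrow> cmod (integral {a..x} g) \<le> M"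
  shows "cmod (integral {a..b} (\<lambda>x. A x * g x)) \<le> M * (cmod (A b) + (Q b - Q a))"
proof -
  define G where "G = (\<lambda>x. integral {a..x} g)"
  have dG: "(G has_vector_derivative g x) (at x within {a..b})" if "x \<in> {a..b}" for x
    unfolding G_def by (rule integral_has_vector_derivative[OF g that])
  have dA: "(A has_vector_derivative A' x) (at x within {a..b})" if "x \<in> {a..b}" for x
    using A[OF that] by (rule has_vector_derivative_at_within)
  have cG: "continuous_on {a..b} G"
    by (rule continuous_on_vector_derivative[OF dG])
  have I1: "((\<lambda>x. A x * g x + A' x * G x) has_integral A b * G b - A a * G a) {a..b}"
    by (rule fundamental_theorem_of_calculus[OF ab has_vector_derivative_mult[OF dA dG]])
  have I2: "((\<lambda>x. A' x * G x) has_integral integral {a..b} (\<lambda>x. A' x * G x)) {a..b}"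
    by (intro integrable_integral integrable_continuous_real continuous_intros cA' cG)
  have "((\<lambda>x. A x * g x) has_integral A b * G b - integral {a..b} (\<lambda>x. A' x * G x)) {a..b}"
    using has_integral_diff[OF I1 I2] by (simp add: G_def)
  then have "cmod (integral {a..b} (\<lambda>x. A x * g x)) \<le> cmod (A b * G b) + cmod (integral {a..b} (\<lambda>x. A' x * G x))"
    by (simp add: integral_unique norm_triangle_ineq4)
  also have "cmod (A b * G b) \<le> cmod (A b) * M"
    unfolding norm_mult using M[of b] ab by (intro mult_left_mono) (auto simp: G_def)
  also have "cmod (integral {a..b} (\<lambda>x. A' x * G x)) \<le> M * (Q b - Q a)"
  proof -
    have hQ: "((\<lambda>x. M * Q' x) has_integral M * (Q b - Q a)) {a..b}"
    proof (intro has_integral_mult_right fundamental_theorem_of_calculus[OF ab])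
      fix x assume "x \<in> {a..b}"
      from has_field_derivative_at_within[OF Q[OF this]]
      show "(Q has_vector_derivative Q' x) (at x within {a..b})"
        by (simp add: has_real_derivative_iff_has_vector_derivative)
    qed
    have "cmod (integral {a..b} (\<lambda>x. A' x * G x)) \<le> integral {a..b} (\<lambda>x. M * Q' x)"
    proof (rule integral_norm_bound_integral)
      show "(\<lambda>x. A' x * G x) integrable_on {a..b}" using I2 by blast
      show "(\<lambda>x. M * Q' x) integrable_on {a..b}" using hQ by blast
      fix x assume x: "x \<in> {a..b}"
      have "cmod (A' x) * cmod (G x) \<le> Q' x * M"
        using le[OF x] M[OF x] order_trans[OF norm_ge_zero le[OF x]] by (intro mult_mono) (auto simp: G_def)
      then show "norm (A' x * G x) \<le> M * Q' x" by (simp add: norm_mult mult.commute)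
    qed
    then show ?thesis unfolding integral_unique[OF hQ] .
  qed
  finally show ?thesis by (simp add: algebra_simps)
qed

section \<open>The transformed integral: oscillatory part and tail\<close>

definition mellin_integrand :: "real \<Rightarrow> real \<Rightarrow> real \<Rightarrow> complex" where
  "mellin_integrand K r x = of_real (legU K x * amp x) * cis (2 * r * ln (cos x / sin x))"

lemma continuous_on_legU:
  assumes "0 < a" "b < pi/2"
  shows "continuous_on {a..b} (legU K)"
  using assms by (intro continuous_at_imp_continuous_on ballI DERIV_isCont[OF legU_deriv]) auto

lemma continuous_on_legU_osc:
  assumes "0 < a" "b < pi/2"
  shows "continuous_on {a..b} (mellin_integrand K r)"
proof -
  have sc: "sin x \<noteq> 0 \<and> cos x / sin x \<noteq> 0" if "x \<in> {a..b}" for x using sin_cos_pos[of x] that assms by auto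
  show ?thesis unfolding mellin_integrand_def[abs_def]
    using sc by (intro continuous_intros continuous_on_legU continuous_on_osc assms) blast+
qed

text \<open>Variation of constants: with A = (U - i V / K) / 2 * exp(- i K x) one has U = A exp(i K
  x) + its conjugate. In A' everything cancels except the perturbation i U exp(- i K x) / (8 K
  cos^2), so the variation of A is at most that of tan x / (4 K), hence at most 1/4. With |A b|
  \<le> 1 each of the two terms costs 5/4 * M.\<close>

lemma legU_osc_initial_le:
  assumes K: "K \<ge> 1" and ab: "0 < a" "a \<le> b" "b \<le> arctan K"
    and M: "\<And>x. x \<in> {a..b} \<Longrightarrow> cmod (osc K r a x) \<le> M" "\<And>x. x \<in> {a..b} \<Longrightarrow> cmod (osc (- K) r a x) \<le> M"
  shows "cmod (integral {a..b} (mellin_integrand K r)) \<le> 3 * M"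
proof -
  have b2: "b < pi/2" using ab arctan_ubound[of K] by linarith
  have I: "-(pi/2) < x" "x < pi/2" "0 \<le> x" "x \<le> arctan K" "cos x > 0" if "x \<in> {a..b}" for x
    using that ab b2 pi_gt_zero sin_cos_pos[of x] by auto
  have M0: "0 \<le> M" using order_trans[OF norm_ge_zero M(1)[of a]] ab by auto
  define A where "A = (\<lambda>x. Complex (legU K x / 2) (- legV K x / (2 * K)) * cis (- K * x))"
  define A' where "A' = (\<lambda>x. \<i> * of_real (legU K x / (8 * K * (cos x)\<^sup>2)) * cis (- K * x))"
  define g where "g = (\<lambda>s x. of_real (amp x) * cis (phase s r x))"
  define Q where "Q = (\<lambda>x. tan x / (4 * K))"
  define Q' where "Q' = (\<lambda>x. 1 / (cos x)\<^sup>2 / (4 * K))"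
  have dA: "(A has_vector_derivative A' x) (at x)" if x: "x \<in> {a..b}" for x
  proof -
    note x' = I(1,2)[OF x]
    have dU: "((\<lambda>x. Complex (legU K x / 2) (- legV K x / (2 * K))) has_vector_derivative
        Complex (legV K x / 2) ((K\<^sup>2 + 1 / (4 * (cos x)\<^sup>2)) * legU K x / (2 * K))) (at x)"
    proof -
      have 1: "((\<lambda>x. complex_of_real (legU K x / 2)) has_vector_derivative of_real (legV K x / 2)) (at x)"
        using DERIV_cdivide[OF legU_deriv[OF x', of K], of 2]
        by (intro has_vector_derivative_of_real) (simp add: has_real_derivative_iff_has_vector_derivative)
      have 2: "((\<lambda>x. complex_of_real (- legV K x / (2 * K))) has_vector_derivative of_real ((K\<^sup>2 + 1 / (4 * (cos x)\<^sup>2)) * legU K x / (2 * K))) (at x)"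
      proof -
        have "((\<lambda>x. - legV K x / (2 * K)) has_real_derivative (K\<^sup>2 + 1 / (4 * (cos x)\<^sup>2)) * legU K x / (2 * K)) (at x)"
          by (rule DERIV_cong[OF DERIV_cdivide[OF DERIV_minus[OF legV_deriv[OF x', of K]]]])
             (simp only: mult_minus_left minus_minus)
        then show ?thesis
          by (intro has_vector_derivative_of_real) (simp only: has_real_derivative_iff_has_vector_derivative)
      qed
      from has_vector_derivative_add[OF 1 has_vector_derivative_mult_right[OF 2, of \<i>]]
      show ?thesis by (simp add: Complex_eq)
    qed
    have dc: "((\<lambda>x. cis (- K * x)) has_vector_derivative - \<i> * of_real K * cis (- K * x)) (at x)"
    proof -
      have "((\<lambda>t. exp (- \<i> * of_real K * of_real t)) has_vector_derivative - \<i> * of_real K * exp (- \<i> * of_real K * of_real x)) (at x)"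
        by (rule has_vector_derivative_real_field) (auto intro!: derivative_eq_intros)
      then show ?thesis by (simp add: cis_conv_exp mult.assoc)
    qed
    have "Complex (legU K x / 2) (- legV K x / (2 * K)) * (- \<i> * of_real K * cis (- K * x)) +
       Complex (legV K x / 2) ((K\<^sup>2 + 1 / (4 * (cos x)\<^sup>2)) * legU K x / (2 * K)) * cis (- K * x) = A' x"
    proof -
      have "Complex (legU K x / 2) (- legV K x / (2 * K)) * (- \<i> * of_real K) +
        Complex (legV K x / 2) ((K\<^sup>2 + 1 / (4 * (cos x)\<^sup>2)) * legU K x / (2 * K)) = \<i> * of_real (legU K x / (8 * K * (cos x)\<^sup>2))"
        using K I(5)[OF x] by (simp add: complex_eq_iff field_simps power2_eq_square)
      then show ?thesis unfolding A'_def by (metis (no_types, lifting) distrib_right mult.assoc)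
    qed
    then show ?thesis using has_vector_derivative_mult[OF dU dc] unfolding A_def by simp
  qed
  have cA': "continuous_on {a..b} A'"
  proof -
    have "8 * K * (cos x)\<^sup>2 \<noteq> 0" if "x \<in> {a..b}" for x using I(5)[OF that] K by simp
    then show ?thesis unfolding A'_def by (intro continuous_intros continuous_on_legU ab b2) blast
  qed
  have dQ: "(Q has_real_derivative Q' x) (at x)" if x: "x \<in> {a..b}" for x
    unfolding Q_def Q'_def using I(5)[OF x] by (intro DERIV_cdivide DERIV_tan') auto
  have leA: "cmod (A' x) \<le> Q' x" if x: "x \<in> {a..b}" for x
  proof -
    have "cmod (A' x) = \<bar>legU K x\<bar> / (8 * K * (cos x)\<^sup>2)" 
      unfolding A'_def norm_mult norm_of_real norm_cis norm_ii using K by (simp add: abs_mult abs_divide)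
    also have "\<dots> \<le> 2 / (8 * K * (cos x)\<^sup>2)"
      using leg_bounds_initial(3)[OF K I(3,4)[OF x]] K by (intro divide_right_mono) auto
    also have "\<dots> = Q' x" by (simp add: Q'_def)
    finally show ?thesis .
  qed
  have cg: "continuous_on {a..b} (g s)" for s unfolding g_def by (rule continuous_on_osc[OF ab(1) b2])
  have Ab: "cmod (A b) \<le> 1"
  proof -
    have "(cmod (A b))\<^sup>2 = ((legU K b)\<^sup>2 + (legV K b)\<^sup>2 / K\<^sup>2) / 4"
      by (simp add: A_def norm_mult cmod_power2 power_divide power_mult_distrib)
    also have "\<dots> \<le> 1" using leg_bounds_initial(1)[OF K, of b] ab by simp
    finally show ?thesis by (simp add: power_le_one_iff)
  qed
  have Qb: "Q b - Q a \<le> 1/4"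
  proof -
    have "tan b \<le> tan (arctan K)" using ab arctan_ubound[of K] by (intro tan_mono_le) auto
    then have "tan b \<le> K" by (simp add: tan_arctan)
    moreover have "0 < tan a" using ab b2 by (intro tan_gt_zero) auto
    ultimately have "tan b - tan a \<le> K" by linarith
    then have "(tan b - tan a) / (4 * K) \<le> K / (4 * K)" using K by (intro divide_right_mono) auto
    then show ?thesis using K by (simp add: Q_def diff_divide_distrib)
  qed
  have 1: "cmod (integral {a..b} (\<lambda>x. A x * g K x)) \<le> M * (cmod (A b) + (Q b - Q a))"
    by (rule norm_integral_mult_bv_le[OF ab(2) cg dA cA' dQ leA])
       (use M(1) in \<open>auto simp: g_def osc_def\<close>)
  have dA2: "((\<lambda>x. cnj (A x)) has_vector_derivative cnj (A' x)) (at x)" if "x \<in> {a..b}" for x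
    using dA[OF that] by (rule has_vector_derivative_cnj)
  have 2: "cmod (integral {a..b} (\<lambda>x. cnj (A x) * g (- K) x)) \<le> M * (cmod (cnj (A b)) + (Q b - Q a))"
    by (rule norm_integral_mult_bv_le[OF ab(2) cg dA2 _ dQ])
       (use M(2) leA in \<open>auto simp: g_def osc_def intro!: continuous_intros cA'\<close>)
  have cA: "continuous_on {a..b} A"
    by (intro continuous_at_imp_continuous_on ballI has_vector_derivative_continuous[OF dA])
  have eq: "mellin_integrand K r x = A x * g K x + cnj (A x) * g (- K) x" for x
  proof -
    define t where "t = 2 * r * ln (cos x / sin x)"
    have ph: "cis (- K * x) * cis (phase K r x) = cis t" "cnj (cis (- K * x)) * cis (phase (- K) r x) = cis t"
      by (simp_all add: cis_mult cis_cnj phase_def t_def)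
    define z where "z = Complex (legU K x / 2) (- legV K x / (2 * K))"
    have "z + cnj z = of_real (legU K x)" by (simp add: z_def complex_eq_iff)
    have "A x * g K x + cnj (A x) * g (- K) x =
        of_real (amp x) * (z * (cis (- K * x) * cis (phase K r x)) + cnj z * (cnj (cis (- K * x)) * cis (phase (- K) r x)))"
      unfolding A_def g_def z_def[symmetric] complex_cnj_mult by (simp only: algebra_simps)
    also have "\<dots> = of_real (amp x) * ((z + cnj z) * cis t)" unfolding ph by (simp only: algebra_simps)
    finally show ?thesis unfolding \<open>z + cnj z = _\<close> t_def mellin_integrand_def by simp
  qed
  have "integral {a..b} (mellin_integrand K r) =
     integral {a..b} (\<lambda>x. A x * g K x) + integral {a..b} (\<lambda>x. cnj (A x) * g (- K) x)"
    unfolding ext[of "mellin_integrand K r", OF eq] by (rule integral_add) (intro integrable_continuous_real continuous_intros cA cg)+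
  then have "cmod (integral {a..b} (mellin_integrand K r))
     \<le> cmod (integral {a..b} (\<lambda>x. A x * g K x)) + cmod (integral {a..b} (\<lambda>x. cnj (A x) * g (- K) x))"
    by (simp add: norm_triangle_ineq)
  also have "\<dots> \<le> M * (cmod (A b) + (Q b - Q a)) + M * (cmod (A b) + (Q b - Q a))"
    using 1 2 by simp
  also have "\<dots> \<le> M * (5/4) + M * (5/4)"
    using Ab Qb M0 by (intro add_mono mult_left_mono) auto
  also have "\<dots> \<le> 3 * M" using M0 by simp
  finally show ?thesis .
qed

lemma legU_osc_tail_le:
  assumes K: "K \<ge> 1" and ab: "arctan K \<le> a" "a \<le> b" "b < pi/2"
  shows "cmod (integral {a..b} (mellin_integrand K r)) \<le> 88 / sqrt K"
proof -
  have "arctan 1 \<le> arctan K" using K by (rule arctan_monotone')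
  then have p: "pi/4 \<le> arctan K" unfolding arctan_one .
  then have a0: "0 < a" "pi/4 \<le> a" using ab pi_gt_zero by linarith+
  have "cmod (integral {a..b} (mellin_integrand K r)) \<le> integral {a..b} (\<lambda>x. 22 * amp x)"
  proof (rule integral_norm_bound_integral)
    show "mellin_integrand K r integrable_on {a..b}"
      by (rule integrable_continuous_real[OF continuous_on_legU_osc[OF a0(1) ab(3)]])
    show "(\<lambda>x. 22 * amp x) integrable_on {a..b}"
      using ab a0 by (intro integrable_continuous_real continuous_intros continuous_on_osc)
    fix x assume x: "x \<in> {a..b}"
    have "\<bar>legU K x\<bar> \<le> 22" using x ab by (intro legU_bound_tail[OF K]) auto
    moreover have "0 < amp x" using x ab a0 by (intro amp_pos) auto
    ultimately show "cmod (mellin_integrand K r x) \<le> 22 * amp x"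
      by (simp add: mellin_integrand_def norm_mult abs_mult)
  qed
  also have "\<dots> = 22 * integral {a..b} amp" by simp
  also have "\<dots> \<le> 22 * (4 * (sqrt (cos a) - sqrt (cos b)))"
    using ab a0 by (intro mult_left_mono amp_integral_le) auto
  also have "\<dots> \<le> 88 * sqrt (cos a)"
  proof -
    have "0 < cos b" using ab a0 by (intro cos_gt_zero) auto
    then show ?thesis by simp
  qed
  also have "sqrt (cos a) \<le> 1 / sqrt K"
  proof -
    have "cos a \<le> cos (arctan K)" using ab p pi_gt_zero by (intro cos_monotone_0_pi_le) linarith+
    also have "\<dots> \<le> 1 / K"
    proof -
      have "K \<le> sqrt (1 + K\<^sup>2)" using K by (intro real_le_rsqrt) auto
      then show ?thesis using K by (simp add: cos_arctan divide_left_mono frac_le)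
    qed
    finally have "sqrt (cos a) \<le> sqrt (1 / K)" by simp
    then show ?thesis by (simp add: real_sqrt_divide)
  qed
  finally show ?thesis by simp
qed

lemma legU_osc_le:
  assumes K: "K \<ge> 3" and r: "1 \<le> r" "r \<le> K" and ab: "0 < a" "a \<le> b" "b < pi/2"
  shows "cmod (integral {a..b} (mellin_integrand K r)) \<le> 572 * transition_bound K r"
proof -
  define f where "f = mellin_integrand K r"
  define B where "B = transition_bound K r"
  have B0: "0 \<le> B" by (simp add: B_def transition_bound_def)
  have K1: "K \<ge> 1" using K by linarith
  have first: "cmod (integral {a..b} f) \<le> 396 * B" if ab: "0 < a" "a \<le> b" "b \<le> arctan K" for a b
  proof -
    have "cmod (integral {a..b} f) \<le> 3 * (132 * B)"
      unfolding f_def B_def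
      by (rule legU_osc_initial_le[OF K1 ab]; rule norm_osc_le_transition_bound[OF K r])
         (use ab arctan_ubound[of K] in auto)
    then show ?thesis by simp
  qed
  have second: "cmod (integral {a..b} f) \<le> 176 * B" if ab: "arctan K \<le> a" "a \<le> b" "b < pi/2" for a b
  proof -
    have "cmod (integral {a..b} f) \<le> 88 / sqrt K" unfolding f_def by (rule legU_osc_tail_le[OF K1 ab])
    also have "\<dots> \<le> 176 * B" using inverse_sqrt_le_transition_bound[of K r] K r unfolding B_def by simp
    finally show ?thesis .
  qed
  consider "b \<le> arctan K" | "arctan K \<le> a" | "a < arctan K" "arctan K < b" by linarith
  then have "cmod (integral {a..b} f) \<le> 572 * B"
  proof cases
    case 1
    then show ?thesis using first[OF ab(1,2)] B0 by linarith
  next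
    case 2
    then show ?thesis using second[OF _ ab(2,3)] B0 by linarith
  next
    case 3
    have "f integrable_on {a..b}"
      unfolding f_def by (rule integrable_continuous_real[OF continuous_on_legU_osc[OF ab(1,3)]])
    then have "integral {a..b} f = integral {a..arctan K} f + integral {arctan K..b} f"
      using 3 by (intro sym[OF Henstock_Kurzweil_Integration.integral_combine]) auto
    then have "cmod (integral {a..b} f) \<le> cmod (integral {a..arctan K} f) + cmod (integral {arctan K..b} f)"
      by (simp add: norm_triangle_ineq)
    also have "\<dots> \<le> 396 * B + 176 * B" using 3 ab by (intro add_mono first second) auto
    finally show ?thesis by simp
  qed
  then show ?thesis by (simp add: f_def B_def)
qed

text \<open>Log-convexity at the midpoint x of x - 1/2 and x + 1/2 gives Gamma(x)^2 \<le> Gamma(x -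
  1/2) Gamma(x + 1/2), and the functional equation eliminates Gamma(x - 1/2).\<close>

lemma Gamma_half_step_le:
  fixes x :: real
  assumes "x > 1/2"
  shows "Gamma x / Gamma (x + 1/2) \<le> 1 / sqrt (x - 1/2)"
proof -
  have pos: "Gamma (x - 1/2) > 0" "Gamma x > 0" "Gamma (x + 1/2) > 0" using assms by (auto intro!: Gamma_real_pos)
  have "(ln \<circ> Gamma) ((1 - 1/2) *\<^sub>R (x - 1/2) + (1/2) *\<^sub>R (x + 1/2)) \<le> (1 - 1/2) * (ln \<circ> Gamma) (x - 1/2) + 1/2 * (ln \<circ> Gamma) (x + 1/2)"
    using assms by (intro convex_onD[OF log_convex_Gamma_real]) auto
  then have "2 * ln (Gamma x) \<le> ln (Gamma (x - 1/2)) + ln (Gamma (x + 1/2))" by (simp add: field_simps)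
  then have "ln ((Gamma x)\<^sup>2) \<le> ln (Gamma (x - 1/2) * Gamma (x + 1/2))" using pos by (simp add: ln_mult ln_realpow)
  then have le: "(Gamma x)\<^sup>2 \<le> Gamma (x - 1/2) * Gamma (x + 1/2)" using pos by simp
  have "x - 1/2 \<notin> \<int>\<^sub>\<le>\<^sub>0" using assms by (auto elim!: nonpos_Ints_cases)
  then have "Gamma (x - 1/2 + 1) = (x - 1/2) * Gamma (x - 1/2)" by (rule Gamma_plus1)
  then have "Gamma (x + 1/2) = (x - 1/2) * Gamma (x - 1/2)" by (simp add: add.commute)
  then have "(x - 1/2) * (Gamma x)\<^sup>2 \<le> (Gamma (x + 1/2))\<^sup>2"
    using mult_left_mono[OF le, of "x - 1/2"] assms by (simp add: power2_eq_square mult_ac)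
  then have "(Gamma x / Gamma (x + 1/2))\<^sup>2 \<le> (1 / sqrt (x - 1/2))\<^sup>2"
  proof -
    have "A / B \<le> 1 / d" if "d * A \<le> B" "B > 0" "d > 0" for A B d :: real
      using that by (simp add: field_simps)
    from this[OF \<open>(x - 1/2) * (Gamma x)\<^sup>2 \<le> _\<close>] show ?thesis
      using assms pos by (simp add: power_divide)
  qed
  then show ?thesis by (rule power2_le_imp_le) (use assms in simp)
qed

text \<open>For an h that is not integrable on the half-line \<open>integral\<close> has the value
  0, and B \<ge> 0 settles the claim. Otherwise the integral is a limit of integrals over compact
  intervals inside the half-line.\<close>

lemma norm_integral_greaterThan_le:
  fixes h :: "real \<Rightarrow> complex"
  assumes B: "\<And>a b. 0 < a \<Longrightarrow> a \<le> b \<Longrightarrow> cmod (integral {a..b} h) \<le> B"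
  shows "cmod (integral {0<..} h) \<le> B"
proof (cases "h integrable_on {0<..}")
  case False
  then show ?thesis using order_trans[OF norm_ge_zero B[of 1 1]] by (simp add: not_integrable_integral)
next
  case True
  \<comment> \<open>Extension by zero makes h integrable up to 0, so that the lower end point can be
    moved to 0 by continuity of the indefinite integral.\<close>
  define h0 where "h0 = (\<lambda>x. if x \<in> {0<..} then h x else 0)"
  have int: "h0 integrable_on {a..b}" for a b
  proof -
    have "h0 integrable_on cbox a b"
      using integrable_integral[OF True] unfolding has_integral_alt' h0_def by blast
    then show ?thesis by (simp add: cbox_interval)
  qed
  have pos: "cmod (integral {0..R} h0) \<le> B" if R: "R > 0" for R
  proof -
    have "continuous_on {0..R} (\<lambda>x. integral {x..R} h0)"
      by (rule indefinite_integral_continuous_1'[OF int])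
    then have "((\<lambda>x. integral {x..R} h0) \<longlongrightarrow> integral {0..R} h0) (at 0 within {0..R})"
      using R by (auto simp: continuous_on_def)
    then have lim: "((\<lambda>x. cmod (integral {x..R} h0)) \<longlongrightarrow> cmod (integral {0..R} h0)) (at 0 within {0..R})"
      by (rule tendsto_norm)
    have nb: "at 0 within {0..R} \<noteq> bot" using R by (simp add: at_within_Icc_at_right)
    have "eventually (\<lambda>x. cmod (integral {x..R} h0) \<le> B) (at 0 within {0..R})"
      unfolding eventually_at_filter
    proof (intro always_eventually allI impI)
      fix x assume "x \<noteq> 0" "x \<in> {0..R}"
      then have "0 < x" "x \<le> R" by auto
      moreover have "integral {x..R} h0 = integral {x..R} h" using \<open>0 < x\<close> by (intro integral_cong) (auto simp: h0_def)
      ultimately show "cmod (integral {x..R} h0) \<le> B" using B by simp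
    qed
    then show ?thesis by (rule tendsto_upperbound[OF lim _ nb])
  qed
  show ?thesis
  proof (rule field_le_epsilon)
    fix e :: real assume e: "e > 0"
    from integrable_integral[OF True] obtain R where R: "R > 0" "\<And>a b. ball 0 R \<subseteq> cbox a b \<Longrightarrow> cmod (integral (cbox a b) h0 - integral {0<..} h) < e"
      using e unfolding has_integral_alt' h0_def by blast
    have "ball 0 R \<subseteq> cbox (- R) R" by (auto simp: dist_norm cbox_interval)
    from R(2)[OF this] have lt: "cmod (integral {- R..R} h0 - integral {0<..} h) < e" by (simp add: cbox_interval)
    have "integral {- R..0} h0 + integral {0..R} h0 = integral {- R..R} h0"
      using R by (intro Henstock_Kurzweil_Integration.integral_combine int) auto
    moreover have "integral {- R..0} h0 = integral {- R..0} (\<lambda>x. 0 :: complex)" by (intro integral_cong) (auto simp: h0_def)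
    ultimately have "integral {- R..R} h0 = integral {0..R} h0" by simp
    then show "cmod (integral {0<..} h) \<le> B + e"
      using lt pos[OF R(1)] norm_triangle_ineq2[of "integral {0<..} h" "integral {0..R} h0"] by (simp add: norm_minus_commute)
  qed
qed

text \<open>Here sin \<phi> = 1 / sqrt(1 + x) is half the argument of \<open>I_fun\<close> and cot^2
  \<phi> = x. The factor - 1 / (2 sqrt x (1 + x)) is the derivative of \<phi> in x and is kept
  apart, ready for the substitution.\<close>

lemma g_fun_mellin_integrand:
  fixes k :: nat and x r \<Delta> :: real
  assumes k: "1 \<le> k" and \<Delta>: "1 - 2 * real (2 * k) < \<Delta>" "\<Delta> < 1/2" and x: "x > 0"
  defines "K \<equiv> bold k" and "\<phi> \<equiv> arctan (1 / sqrt x)"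
    and "c \<equiv> Gamma (real (2 * k) - 1/4) / Gamma (real (2 * k) + 1/4)"
  shows "g_fun \<Delta> (2 * k) 0 0 x * of_real x powr (\<i> * of_real r - 1) =
    of_real (- 2 * sqrt 2 * c) * ((- 1 / (2 * sqrt x * (1 + x))) *\<^sub>R mellin_integrand K r \<phi>)"
proof -
  define s q where "s = sqrt (1 + x)" "q = sqrt s"
  have s: "s > 0" "s\<^sup>2 = 1 + x" "s > 1" "q > 0" "q\<^sup>2 = s" using x by (simp_all add: s_q_def)
  define t where "t = sqrt x"
  have t: "t > 0" "t\<^sup>2 = x" using x by (simp_all add: t_def)
  have "sqrt (1 + (1 / t)\<^sup>2) = s / t"
  proof -
    have "1 + (1 / t)\<^sup>2 = (s / t)\<^sup>2" using t s x by (simp add: power_divide field_simps)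
    then show ?thesis using s t by simp
  qed
  then have cs: "cos \<phi> = t / s" "sin \<phi> = 1 / s" using s t by (simp_all add: \<phi>_def cos_arctan sin_arctan flip: t_def)
  have Km: "2 * real (2 * k) - 1 = K" by (simp add: K_def bold_def)
  define y where "y = 2 / s"
  have y: "0 < y" "y < 2" "y / 2 = sin \<phi>"
    using s(1,3) by (simp_all add: y_def cs divide_less_eq)
  have m: "1 \<le> 2 * k" using k by simp
  have I: "I_fun \<Delta> (2 * k) 0 y = of_real (c * sqrt y * (\<Sum>j. legendre_coeff K j * (y/2) ^ (2*j)))"
    using I_fun_eq[OF m y(1,2) \<Delta>] unfolding Km c_def .
  have "(\<Sum>j. legendre_coeff K j * (y/2) ^ (2*j)) = legF K \<phi>"
    unfolding legF_def y(3) using s by (subst eval_legendre_fps) (simp_all add: cs)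
  then have I2: "I_fun \<Delta> (2 * k) 0 y = of_real (c * (sqrt 2 / q) * legF K \<phi>)"
    unfolding I by (simp add: y_def real_sqrt_divide s_q_def)
  have "legU K \<phi> * amp \<phi> = q * legF K \<phi>"
  proof -
    have "sqrt (cos \<phi>) / sqrt (sin \<phi> * cos \<phi>) = 1 / sqrt (sin \<phi>)"
    proof -
      have "0 < cos \<phi>" unfolding cs using s t by simp
      then show ?thesis by (simp add: real_sqrt_mult)
    qed
    also have "\<dots> = q" unfolding cs by (simp add: real_sqrt_divide s_q_def)
    finally have "sqrt (cos \<phi>) / sqrt (sin \<phi> * cos \<phi>) = q" .
    moreover have "legU K \<phi> * amp \<phi> = sqrt (cos \<phi>) / sqrt (sin \<phi> * cos \<phi>) * legF K \<phi>"
      by (simp add: legU_def amp_def)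
    ultimately show ?thesis by (simp only:)
  qed
  moreover have "2 * r * ln (cos \<phi> / sin \<phi>) = r * ln x"
  proof -
    have "cos \<phi> / sin \<phi> = t" using s by (simp add: cs)
    moreover have "ln x = 2 * ln t" using t by (simp flip: t(2) add: ln_realpow)
    ultimately show ?thesis by simp
  qed
  ultimately have rhs: "mellin_integrand K r \<phi> = of_real (q * legF K \<phi>) * cis (r * ln x)"
    unfolding mellin_integrand_def by (simp only:)
  have pw: "complex_of_real z powr (1/2 + 0) = of_real (sqrt z)" if "z > 0" for z
    using powr_of_real[of z "1/2"] that by (simp add: powr_half_sqrt)
  have e: "of_real x powr (\<i> * of_real r - 1) = cis (r * ln x) / of_real x"
  proof -
    have "of_real x powr (\<i> * of_real r - 1) = of_real x powr (\<i> * of_real r) / of_real x"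
      using x by (simp add: powr_diff)
    also have "of_real x powr (\<i> * of_real r) = cis (r * ln x)"
      using x by (simp add: powr_def cis_conv_exp Ln_of_real mult_ac)
    finally show ?thesis .
  qed
  have "2 / (1 + x) powr (1/2) = y" using x by (simp add: y_def s_q_def powr_half_sqrt)
  then have "g_fun \<Delta> (2 * k) 0 0 x * of_real x powr (\<i> * of_real r - 1) =
     of_real (t / s * (c * (sqrt 2 / q) * legF K \<phi>) / x) * cis (r * ln x)"
    unfolding g_fun_def e I2[symmetric] using x pw[of x] pw[of "1 + x"] by (simp add: I2 t_def s_q_def)
  also have "t / s * (c * (sqrt 2 / q) * legF K \<phi>) / x = - 2 * sqrt 2 * c * ((- 1 / (2 * t * s\<^sup>2)) * (q * legF K \<phi>))"
  proof -
    have "t / x = 1 / t" using t by (metis divide_divide_eq_right nonzero_divide_mult_cancel_left power2_eq_square div_by_1 less_irrefl times_divide_eq_right mult.right_neutral)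
    moreover have "1 / (s * q) = q / s\<^sup>2" unfolding s(5)[symmetric] using s(4) by (simp add: field_simps power2_eq_square)
    moreover have "t / s * (c * (sqrt 2 / q) * legF K \<phi>) / x = sqrt 2 * c * legF K \<phi> * (t / x) * (1 / (s * q))"
      by (simp add: mult_ac)
    ultimately have "t / s * (c * (sqrt 2 / q) * legF K \<phi>) / x = sqrt 2 * c * legF K \<phi> * (1 / t) * (q / s\<^sup>2)"
      by (simp only:)
    then show ?thesis by simp
  qed
  finally show ?thesis unfolding rhs t_def[symmetric] s(2)[symmetric] by (simp add: scaleR_conv_of_real)
qed

text \<open>The constant is 3 * 2 * 572: the 3 bounds 2 sqrt 2, the Gamma quotient is at most 2 /
  sqrt K, and 572 comes from \<open>legU_osc_le\<close>.\<close>

lemma g_hat_norm_le: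
  fixes k :: nat and r \<Delta> :: real
  assumes k: "1 \<le> k" and \<Delta>: "1 - 2 * real (2 * k) < \<Delta>" "\<Delta> < 1/2" and r: "1 \<le> r" "r \<le> bold k"
  shows "cmod (g_hat \<Delta> (2 * k) 0 0 (\<i> * of_real r)) \<le> 3432 * (1 / sqrt (bold k)) * transition_bound (bold k) r"
proof -
  define K where "K = bold k"
  have K: "K \<ge> 3" using k by (simp add: K_def bold_def)
  define c where "c = Gamma (real (2 * k) - 1/4) / Gamma (real (2 * k) + 1/4)"
  have c: "0 \<le> c" "c \<le> 2 / sqrt K"
  proof -
    have k1: "1 \<le> real k" using k by simp
    show "0 \<le> c" unfolding c_def using k1 by (intro divide_nonneg_nonneg less_imp_le[OF Gamma_real_pos]) auto
    have "c \<le> 1 / sqrt (real (2 * k) - 1/4 - 1/2)"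
      using Gamma_half_step_le[of "real (2 * k) - 1/4"] k1 by (simp add: c_def add.commute)
    also have "\<dots> \<le> 1 / sqrt (K / 4)" using k1 K by (intro divide_left_mono) (auto simp: K_def bold_def)
    finally show "c \<le> 2 / sqrt K" by (simp add: real_sqrt_divide)
  qed
  define f where "f = mellin_integrand K r"
  define h where "h = (\<lambda>x. g_fun \<Delta> (2 * k) 0 0 x * of_real x powr (\<i> * of_real r - 1))"
  define \<phi> where "\<phi> = (\<lambda>x. arctan (1 / sqrt x))"
  define B where "B = transition_bound K r"
  have B0: "0 \<le> B" by (simp add: B_def transition_bound_def)
  have "cmod (integral {a..b} h) \<le> 2 * sqrt 2 * c * (572 * B)" if ab: "0 < a" "a \<le> b" for a b
  proof -
    have \<phi>r: "0 < \<phi> x" "\<phi> x < pi/2" if "x > 0" for x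
      using that arctan_ubound[of "1 / sqrt x"] by (auto simp: \<phi>_def)
    have mono: "\<phi> y \<le> \<phi> x" if "0 < x" "x \<le> y" for x y
      using that by (auto simp: \<phi>_def arctan_le_iff intro!: divide_left_mono)
    have fc: "continuous_on {\<phi> b..\<phi> a} f"
    proof -
      have p: "0 < \<phi> b" "\<phi> a < pi/2" using \<phi>r ab by auto
      show ?thesis unfolding f_def by (rule continuous_on_legU_osc[OF p])
    qed
    have d\<phi>: "(\<phi> has_real_derivative - 1 / (2 * sqrt x * (1 + x))) (at x)" if x: "x > 0" for x
    proof -
      define t where "t = sqrt x"
      have t: "t > 0" "x = t * t" using x by (simp_all add: t_def)
      have "((\<lambda>x. 1 / sqrt x) has_real_derivative - (inverse (sqrt x) / 2) / (sqrt x * sqrt x)) (at x)"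
        using x by (auto intro!: derivative_eq_intros)
      from DERIV_chain2[OF DERIV_arctan this]
      have "(\<phi> has_real_derivative inverse (1 + (1 / t)\<^sup>2) * (- (inverse t / 2) / (t * t))) (at x)"
        unfolding \<phi>_def t_def .
      moreover have "inverse (1 + (1 / t)\<^sup>2) * (- (inverse t / 2) / (t * t)) = - 1 / (2 * t * (1 + x))"
      proof -
        have "1 + (1 / t)\<^sup>2 = (1 + x) / (t * t)" using t(1) unfolding t(2) by (simp add: power2_eq_square field_simps)
        moreover have "inverse (e / (t * t)) * (- (inverse t / 2) / (t * t)) = - 1 / (2 * t * e)" if "e \<noteq> 0" for e
          using t(1) that by (simp add: field_simps)
        ultimately show ?thesis using x by simp
      qed
      ultimately show ?thesis by (simp add: t_def)
    qed
    have "((\<lambda>x. (- 1 / (2 * sqrt x * (1 + x))) *\<^sub>R f (\<phi> x)) has_integral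
        (integral {\<phi> a..\<phi> b} f - integral {\<phi> b..\<phi> a} f)) {a..b}"
    proof (rule has_integral_substitution_general[of "{}" a b \<phi> "\<phi> b" "\<phi> a"])
      show "\<phi> ` {a..b} \<subseteq> {\<phi> b..\<phi> a}" using mono ab by auto
      show "continuous_on {a..b} \<phi>"
        using ab by (intro continuous_at_imp_continuous_on ballI DERIV_isCont[OF d\<phi>]) auto
      fix x assume "x \<in> {a..b} - {}"
      then show "(\<phi> has_real_derivative - 1 / (2 * sqrt x * (1 + x))) (at x within {a..b})"
        using ab by (intro has_field_derivative_at_within[OF d\<phi>]) auto
    qed (use ab fc in auto)
    \<comment> \<open>The substitution decreases, so of the two oriented integrals the one from
      \<phi> a to \<phi> b runs over an empty or one-point interval.\<close>
    moreover have "integral {\<phi> a..\<phi> b} f = 0"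
      using mono[OF ab] by (cases "\<phi> a = \<phi> b") auto
    ultimately have "((\<lambda>x. (- 1 / (2 * sqrt x * (1 + x))) *\<^sub>R f (\<phi> x)) has_integral - integral {\<phi> b..\<phi> a} f) {a..b}"
      by simp
    then have "((\<lambda>x. of_real (- 2 * sqrt 2 * c) * ((- 1 / (2 * sqrt x * (1 + x))) *\<^sub>R f (\<phi> x))) has_integral
        of_real (- 2 * sqrt 2 * c) * (- integral {\<phi> b..\<phi> a} f)) {a..b}"
      by (rule has_integral_mult_right)
    then have "(h has_integral of_real (- 2 * sqrt 2 * c) * (- integral {\<phi> b..\<phi> a} f)) {a..b}"
    proof (rule has_integral_eq[rotated])
      fix x assume "x \<in> {a..b}"
      then have "x > 0" using ab by auto
      from g_fun_mellin_integrand[OF k \<Delta> this, of r]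
      show "of_real (- 2 * sqrt 2 * c) * ((- 1 / (2 * sqrt x * (1 + x))) *\<^sub>R f (\<phi> x)) = h x"
        unfolding h_def f_def \<phi>_def c_def K_def by (rule sym)
    qed
    then have "cmod (integral {a..b} h) = 2 * sqrt 2 * c * cmod (integral {\<phi> b..\<phi> a} f)"
      using c by (simp add: integral_unique norm_mult)
    also have "\<dots> \<le> 2 * sqrt 2 * c * (572 * B)"
      unfolding f_def B_def using c ab mono[OF ab] \<phi>r r
      by (intro mult_left_mono legU_osc_le[OF K]) (auto simp: K_def)
    finally show ?thesis .
  qed
  then have "cmod (integral {0<..} h) \<le> 2 * sqrt 2 * c * (572 * B)" by (rule norm_integral_greaterThan_le)
  also have "\<dots> \<le> 3 * (2 / sqrt K) * (572 * B)"
  proof (intro mult_right_mono mult_mono)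
    have "sqrt 2 \<le> 3/2" by (rule real_le_lsqrt) (auto simp: power2_eq_square)
    then show "2 * sqrt 2 \<le> 3" by simp
  qed (use c B0 in auto)
  finally show ?thesis by (simp add: g_hat_def mellin_def h_def K_def B_def)
qed

theorem lemma1p2:
  fixes \<delta> :: real
  assumes "0 < \<delta>" and "\<delta> < 1/4"
  shows "\<exists>C::real. \<forall>(k::nat) (r::real) (\<Delta>::real).
           1 \<le> k \<longrightarrow> 1 - 2 * real (2 * k) < \<Delta> \<longrightarrow> \<Delta> < 1/2 \<longrightarrow>
           bold k powr (1/2 - \<delta>) < r \<longrightarrow> r \<le> bold k \<longrightarrow>
           norm (g_hat \<Delta> (2 * k) 0 0 (\<i> * of_real r))
             \<le> C * (1 / bold k powr (5/6) * min_factor k r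
                    + (real k powr (- 1/4 - 3 * \<delta>) + real k powr (- 1/2)) / r)"
proof (intro exI[of _ 3432] allI impI)
  fix k :: nat and r \<Delta> :: real
  assume k: "1 \<le> k" and \<Delta>: "1 - 2 * real (2 * k) < \<Delta>" "\<Delta> < 1/2"
    and r: "bold k powr (1/2 - \<delta>) < r" "r \<le> bold k"
  have K: "1 \<le> bold k" using k by (simp add: bold_def)
  \<comment> \<open>The exponent 1/2 - \<delta> is positive and the base is at least 1, which gives
    the lower bound r \<ge> 1 required by the oscillatory estimates.\<close>
  have "1 \<le> bold k powr (1/2 - \<delta>)" using K assms by (intro ge_one_powr_ge_zero) auto
  then have r1: "1 \<le> r" using r by linarith
  \<comment> \<open>The Gamma quotient supplies the exponent -1/2 and the oscillatory integral -1/3;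
    together they make -5/6.\<close>
  have "1 / sqrt (bold k) * transition_bound (bold k) r = 1 / bold k powr (5/6) * min_factor k r"
  proof -
    have "1 / sqrt (bold k) * bold k powr (- (1/3)) = bold k powr (- (5/6))"
      using K by (simp add: powr_half_sqrt[symmetric] powr_minus_divide[symmetric] flip: powr_add)
    moreover have "transition_bound (bold k) r = bold k powr (- (1/3)) * min_factor k r"
      by (simp add: transition_bound_def min_factor_def)
    ultimately show ?thesis using K by (simp add: powr_minus_divide flip: mult.assoc)
  qed
  then have "norm (g_hat \<Delta> (2 * k) 0 0 (\<i> * of_real r)) \<le> 3432 * (1 / bold k powr (5/6) * min_factor k r)"
    using g_hat_norm_le[OF k \<Delta> r1 r(2)] by (simp add: mult.assoc)
  also have "\<dots> \<le> 3432 * (1 / bold k powr (5/6) * min_factor k r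
      + (real k powr (- 1/4 - 3 * \<delta>) + real k powr (- 1/2)) / r)"
    using r1 by simp
  finally show "norm (g_hat \<Delta> (2 * k) 0 0 (\<i> * of_real r))
             \<le> 3432 * (1 / bold k powr (5/6) * min_factor k r
                    + (real k powr (- 1/4 - 3 * \<delta>) + real k powr (- 1/2)) / r)" .
qed

end
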